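(* Let $G$ be a complex linear algebraic group with a fixed embedding $G\subset \mathrm{GL}(m)$, and let $V,W$ be finite-dimensional $G$-representations. Then the locus of stable pairs in $\mathbb{P}(V\oplus W)$ is a countable union of constructible sets, and the locus of semistable pairs in $\mathbb{P}(V\oplus W)$ is constructible.
   Context: Everything is over $\mathbb{C}$; $G$ is not assumed reductive, representations are algebraic, and $\mathbb{P}(\cdot)$ denotes the projective space of lines, with the Zariski topology. A constructible set is a finite union of locally closed sets. Semistability. A pair is a point $[v:w]\in\mathbb{P}(V\oplus W)$ with $0\ne v\in V$, $w\in W$. It is semistable if $\overline{G.[v:w]}\cap\mathbb{P}(0\oplus W)=\varnothing$. (Points of $\mathbb{P}(0\oplus W)$ are neither semistable nor stable.) Stability. View $\mathrm{GL}(m)\subset\mathbb{C}^{m\times m}$, let $G$ act on $\mathbb{C}^{m\times m}$ by left multiplication, and let $e\in\mathbb{C}^{m\times m}$ be the identity matrix. For a maximal torus of $G$, the weight polytope of a nonzero vector in a representation is the convex hull of the weights of its nonzero weight components; let $\Delta$ be the weight polytope of $e$ (the standard unit simplex when $G=\mathrm{GL}(m)$). Let $\deg V$ be the smallest positive integer $d$ such that the weight polytope of every nonzero $v\in V$ lies in $d\Delta$ (stability is considered when such a $d$ exists). The pair $[v:w]$ is stable if there is an integer $l>0$ such that the pair $$\left[e^{\otimes\deg V}\otimes v^{\otimes l}: w^{\otimes (l+1)}\right]\in\mathbb{P}\left(\left((\mathbb{C}^{m\times m})^{\otimes \deg V}\otimes V^{\otimes l}\right)\oplus W^{\otimes (l+1)}\right)$$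 is semistable (for the induced $G$-action). *)

theory Defs
  imports "Jordan_Normal_Form.Determinant" "HOL-Analysis.Abstract_Topology"
begin

section \<open>Polynomial and regular functions\<close>

text \<open>The \<open>\<complex>\<close>-algebra of functions generated by \<open>X\<close>.\<close>

inductive_set function_algebra :: "('a \<Rightarrow> complex) set \<Rightarrow> ('a \<Rightarrow> complex) set"
  for X :: "('a \<Rightarrow> complex) set" where
  gen: "f \<in> X \<Longrightarrow> f \<in> function_algebra X"
| const: "(\<lambda>_. c) \<in> function_algebra X"
| add: "f \<in> function_algebra X \<Longrightarrow> h \<in> function_algebra X \<Longrightarrow> (\<lambda>x. f x + h x) \<in> function_algebra X"
| mult: "f \<in> function_algebra X \<Longrightarrow> h \<in> function_algebra X \<Longrightarrow> (\<lambda>x. f x * h x) \<in> function_algebra X"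

definition matrix_entries :: "nat \<Rightarrow> (complex mat \<Rightarrow> complex) set" where
  "matrix_entries m = {\<lambda>g. g $$ (i, j) | i j. i < m \<and> j < m}"

definition matrix_polynomials :: "nat \<Rightarrow> (complex mat \<Rightarrow> complex) set" where
  "matrix_polynomials m = function_algebra (matrix_entries m)"

text \<open>The coordinate ring of \<open>GL(m)\<close>.\<close>

definition regular_functions :: "nat \<Rightarrow> (complex mat \<Rightarrow> complex) set" where
  "regular_functions m = function_algebra (insert (\<lambda>g. inverse (det g)) (matrix_entries m))"

inductive homogeneous_polynomial :: "nat \<Rightarrow> nat \<Rightarrow> (complex vec \<Rightarrow> complex) \<Rightarrow> bool"
  for N :: nat where
  const: "homogeneous_polynomial N 0 (\<lambda>_. c)"
| zero: "homogeneous_polynomial N d (\<lambda>_. 0)"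
| coord: "i < N \<Longrightarrow> homogeneous_polynomial N 1 (\<lambda>x. x $ i)"
| add: "homogeneous_polynomial N d f \<Longrightarrow> homogeneous_polynomial N d h \<Longrightarrow>
    homogeneous_polynomial N d (\<lambda>x. f x + h x)"
| mult: "homogeneous_polynomial N d f \<Longrightarrow> homogeneous_polynomial N d' h \<Longrightarrow>
    homogeneous_polynomial N (d + d') (\<lambda>x. f x * h x)"


section \<open>Projective space and its Zariski topology\<close>

definition line :: "complex vec \<Rightarrow> complex vec set" where
  "line x = range (\<lambda>c. c \<cdot>\<^sub>v x)"

text \<open>The points of \<open>\<P>(\<complex>\<^sup>N)\<close> are the lines through the origin, as subsets of \<open>\<complex>\<^sup>N\<close>.\<close>

definition proj_space :: "nat \<Rightarrow> complex vec set set" where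
  "proj_space N = {line x | x. x \<in> carrier_vec N \<and> x \<noteq> 0\<^sub>v N}"

definition zero_locus :: "nat \<Rightarrow> (complex vec \<Rightarrow> complex) set \<Rightarrow> complex vec set set" where
  "zero_locus N F = {p \<in> proj_space N. \<forall>f\<in>F. \<forall>x\<in>p. f x = 0}"

definition proj_closed :: "nat \<Rightarrow> complex vec set set \<Rightarrow> bool" where
  "proj_closed N Z \<longleftrightarrow> (\<exists>F. (\<forall>f\<in>F. \<exists>d. homogeneous_polynomial N d f) \<and> Z = zero_locus N F)"

definition zariski :: "nat \<Rightarrow> complex vec set topology" where
  "zariski N = topology (\<lambda>U. U \<subseteq> proj_space N \<and> proj_closed N (proj_space N - U))"

lemma homogeneous_polynomial_smult:
  assumes "homogeneous_polynomial N d f" "dim_vec x = N"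
  shows "f (c \<cdot>\<^sub>v x) = c ^ d * f x"
  using assms(1)
  by induction (auto simp: assms(2) algebra_simps power_add)

lemma proj_closed_Int:
  assumes "\<And>Z. Z \<in> K \<Longrightarrow> proj_closed N Z"
  shows "proj_closed N (proj_space N \<inter> \<Inter>K)"
proof -
  from assms obtain F where
    F: "\<And>Z. Z \<in> K \<Longrightarrow> (\<forall>f\<in>F Z. \<exists>d. homogeneous_polynomial N d f) \<and> Z = zero_locus N (F Z)"
    unfolding proj_closed_def by metis
  have "proj_space N \<inter> \<Inter>K = zero_locus N (\<Union>Z\<in>K. F Z)"
    using F unfolding zero_locus_def by blast
  then show ?thesis
    unfolding proj_closed_def using F by (intro exI[of _ "\<Union>Z\<in>K. F Z"]) auto
qed

lemma proj_closed_Un: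
  assumes "proj_closed N Y" "proj_closed N Z"
  shows "proj_closed N (Y \<union> Z)"
proof -
  from assms obtain F H where
    F: "\<forall>f\<in>F. \<exists>d. homogeneous_polynomial N d f" "Y = zero_locus N F" and
    H: "\<forall>f\<in>H. \<exists>d. homogeneous_polynomial N d f" "Z = zero_locus N H"
    unfolding proj_closed_def by blast
  let ?M = "{\<lambda>x. f x * h x | f h. f \<in> F \<and> h \<in> H}"
  have "zero_locus N ?M \<subseteq> Y \<union> Z"
  proof
    fix p assume p: "p \<in> zero_locus N ?M"
    then have pp: "p \<in> proj_space N" unfolding zero_locus_def by blast
    then obtain x where x: "x \<in> carrier_vec N" "p = line x"
      unfolding proj_space_def by blast
    have xp: "x \<in> p"
      unfolding x(2) line_def by (rule range_eqI[of _ _ 1]) simp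
    show "p \<in> Y \<union> Z"
    proof (rule ccontr)
      assume n: "p \<notin> Y \<union> Z"
      have nz: "f x \<noteq> 0" if "homogeneous_polynomial N d f" "y \<in> p" "f y \<noteq> 0" for d f y
        using that homogeneous_polynomial_smult[OF that(1) carrier_vecD[OF x(1)]] unfolding x(2) line_def by auto
      from n pp obtain f y where "f \<in> F" "y \<in> p" "f y \<noteq> 0"
        unfolding F(2) zero_locus_def by auto
      then have f: "f \<in> F" "f x \<noteq> 0" using nz F(1) by blast+
      from n pp obtain h y where "h \<in> H" "y \<in> p" "h y \<noteq> 0"
        unfolding H(2) zero_locus_def by auto
      then have h: "h \<in> H" "h x \<noteq> 0" using nz H(1) by blast+
      have "(\<lambda>x. f x * h x) \<in> ?M" using f(1) h(1) by blast
      moreover have "\<forall>q\<in>?M. \<forall>y\<in>p. q y = 0" using p unfolding zero_locus_def mem_Collect_eq by (rule conjunct2)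
      ultimately have "\<forall>y\<in>p. f y * h y = 0" by (rule bspec[rotated])
      then have "f x * h x = 0" using xp by (rule bspec)
      then show False using f h by simp
    qed
  qed
  moreover have "Y \<union> Z \<subseteq> zero_locus N ?M"
    unfolding F(2) H(2) zero_locus_def by auto
  ultimately have "Y \<union> Z = zero_locus N ?M" by blast
  moreover have "\<forall>f\<in>?M. \<exists>d. homogeneous_polynomial N d f"
  proof
    fix q assume "q \<in> ?M"
    then obtain f h where q: "q = (\<lambda>x. f x * h x)" "f \<in> F" "h \<in> H" by blast
    then obtain d d' where "homogeneous_polynomial N d f" "homogeneous_polynomial N d' h"
      using F(1) H(1) by blast
    then have "homogeneous_polynomial N (d + d') q"
      unfolding q(1) by (rule homogeneous_polynomial.mult)
    then show "\<exists>d. homogeneous_polynomial N d q" ..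
  qed
  ultimately show ?thesis unfolding proj_closed_def by blast
qed

lemma istopology_zariski:
  "istopology (\<lambda>U. U \<subseteq> proj_space N \<and> proj_closed N (proj_space N - U))"
  unfolding istopology_def
proof (intro conjI allI impI; (elim conjE)?)
  fix S T assume "S \<subseteq> proj_space N" "proj_closed N (proj_space N - S)"
    "T \<subseteq> proj_space N" "proj_closed N (proj_space N - T)"
  then show "S \<inter> T \<subseteq> proj_space N" "proj_closed N (proj_space N - S \<inter> T)"
    using proj_closed_Un[of N "proj_space N - S" "proj_space N - T"] by (auto simp: Diff_Int)
next
  fix K assume K: "\<forall>S\<in>K. S \<subseteq> proj_space N \<and> proj_closed N (proj_space N - S)"
  then show "\<Union>K \<subseteq> proj_space N" by blast
  have "proj_space N - \<Union>K = proj_space N \<inter> \<Inter>((\<lambda>S. proj_space N - S) ` K)" by blast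
  moreover have "proj_closed N \<dots>" by (rule proj_closed_Int) (use K in auto)
  ultimately show "proj_closed N (proj_space N - \<Union>K)" by simp
qed

lemma topspace_zariski: "topspace (zariski N) = proj_space N"
proof -
  have "proj_closed N {}"
    unfolding proj_closed_def
  proof (intro exI[of _ "{\<lambda>_. 1}"] conjI)
    show "{} = zero_locus N {\<lambda>_. 1}" unfolding zero_locus_def proj_space_def line_def by auto
  qed (use homogeneous_polynomial.const in auto)
  then have "openin (zariski N) (proj_space N)"
    unfolding zariski_def by (simp add: istopology_zariski)
  moreover have "U \<subseteq> proj_space N" if "openin (zariski N) U" for U
    using that unfolding zariski_def by (simp add: istopology_zariski)
  ultimately show ?thesis unfolding topspace_def by blast
qed

lemma closedin_zariski: "closedin (zariski N) Z \<longleftrightarrow> proj_closed N Z"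
proof -
  have "Z \<subseteq> proj_space N" if "proj_closed N Z"
    using that unfolding proj_closed_def zero_locus_def by blast
  then show ?thesis
    unfolding closedin_def topspace_zariski
    unfolding zariski_def by (auto simp: istopology_zariski double_diff)
qed

definition locally_closed_in :: "'a topology \<Rightarrow> 'a set \<Rightarrow> bool" where
  "locally_closed_in X S \<longleftrightarrow> (\<exists>U Z. openin X U \<and> closedin X Z \<and> S = U \<inter> Z)"

definition constructible_in :: "'a topology \<Rightarrow> 'a set \<Rightarrow> bool" where
  "constructible_in X S \<longleftrightarrow> (\<exists>\<F>. finite \<F> \<and> (\<forall>A\<in>\<F>. locally_closed_in X A) \<and> S = \<Union>\<F>)"


section \<open>Linear algebraic groups and representations\<close>

definition GL :: "nat \<Rightarrow> complex mat monoid" where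
  "GL m = units_of (ring_mat TYPE(complex) m ())"

definition linear_algebraic_group :: "nat \<Rightarrow> complex mat set \<Rightarrow> bool" where
  "linear_algebraic_group m G \<longleftrightarrow> subgroup G (GL m) \<and>
    (\<exists>F \<subseteq> matrix_polynomials m. G = {g \<in> carrier (GL m). \<forall>f\<in>F. f g = 0})"

definition algebraic_hom :: "nat \<Rightarrow> complex mat set \<Rightarrow> nat \<Rightarrow> (complex mat \<Rightarrow> complex mat) \<Rightarrow> bool" where
  "algebraic_hom m G n \<rho> \<longleftrightarrow> \<rho> \<in> hom (GL m\<lparr>carrier := G\<rparr>) (GL n) \<and>
    (\<forall>i<n. \<forall>j<n. \<exists>f\<in>regular_functions m. \<forall>g\<in>G. \<rho> g $$ (i, j) = f g)"

definition algebraic_iso ::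
  "nat \<Rightarrow> complex mat set \<Rightarrow> nat \<Rightarrow> complex mat set \<Rightarrow> (complex mat \<Rightarrow> complex mat) \<Rightarrow> bool" where
  "algebraic_iso m G n H \<phi> \<longleftrightarrow>
    algebraic_hom m G n \<phi> \<and> bij_betw \<phi> G H \<and> algebraic_hom n H m (inv_into G \<phi>)"

text \<open>A representation on \<open>\<complex>\<^sup>n\<close>; up to the choice of a basis this is an arbitrary
  finite-dimensional representation (\<open>n = 0\<close> is allowed).\<close>

abbreviation representation :: "nat \<Rightarrow> complex mat set \<Rightarrow> nat \<Rightarrow> (complex mat \<Rightarrow> complex mat) \<Rightarrow> bool" where
  "representation \<equiv> algebraic_hom"

definition direct_sum_rep ::
  "nat \<Rightarrow> (complex mat \<Rightarrow> complex mat) \<Rightarrow> nat \<Rightarrow> (complex mat \<Rightarrow> complex mat) \<Rightarrow> complex mat \<Rightarrow> complex mat" where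
  "direct_sum_rep n \<rho> k \<sigma> g = four_block_mat (\<rho> g) (0\<^sub>m n k) (0\<^sub>m k n) (\<sigma> g)"

text \<open>Tensor products are Kronecker products: \<open>\<complex>\<^sup>a \<otimes> \<complex>\<^sup>b\<close> is \<open>\<complex>\<^sup>a\<^sup>b\<close>, where
  \<open>e\<^sub>i \<otimes> e\<^sub>j\<close> is the basis vector with index \<open>i * b + j\<close>.\<close>

definition tensor_vec :: "complex vec \<Rightarrow> complex vec \<Rightarrow> complex vec" where
  "tensor_vec v w = vec (dim_vec v * dim_vec w) (\<lambda>i. v $ (i div dim_vec w) * w $ (i mod dim_vec w))"

definition tensor_mat :: "complex mat \<Rightarrow> complex mat \<Rightarrow> complex mat" where
  "tensor_mat A B = mat (dim_row A * dim_row B) (dim_col A * dim_col B)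
    (\<lambda>(i, j). A $$ (i div dim_row B, j div dim_col B) * B $$ (i mod dim_row B, j mod dim_col B))"

primrec vec_tensor_power :: "complex vec \<Rightarrow> nat \<Rightarrow> complex vec" where
  "vec_tensor_power v 0 = vec 1 (\<lambda>_. 1)"
| "vec_tensor_power v (Suc l) = tensor_vec v (vec_tensor_power v l)"

primrec mat_tensor_power :: "complex mat \<Rightarrow> nat \<Rightarrow> complex mat" where
  "mat_tensor_power A 0 = 1\<^sub>m 1"
| "mat_tensor_power A (Suc l) = tensor_mat A (mat_tensor_power A l)"

text \<open>\<open>\<complex>\<^sup>m\<^sup>\<times>\<^sup>m\<close> is identified with \<open>\<complex>\<^sup>m\<^sup>*\<^sup>m\<close> by listing the entries row by row; left
  multiplication by \<open>g\<close> then becomes \<open>g \<otimes> 1\<close> (see \<open>left_mult_rep\<close> below).\<close>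

definition vec_of_matrix :: "nat \<Rightarrow> complex mat \<Rightarrow> complex vec" where
  "vec_of_matrix m A = vec (m * m) (\<lambda>i. A $$ (i div m, i mod m))"

definition left_mult_rep :: "nat \<Rightarrow> complex mat \<Rightarrow> complex mat" where
  "left_mult_rep m g = tensor_mat g (1\<^sub>m m)"

lemma sum_div_mod:
  fixes f :: "nat \<Rightarrow> nat \<Rightarrow> complex"
  assumes "0 < b"
  shows "(\<Sum>i\<in>{0..<a * b}. f (i div b) (i mod b)) = (\<Sum>i\<in>{0..<a}. \<Sum>j\<in>{0..<b}. f i j)"
proof -
  have "(\<Sum>i\<in>{0..<a * b}. f (i div b) (i mod b)) = (\<Sum>(i, j)\<in>{0..<a} \<times> {0..<b}. f i j)"
  proof (rule sum.reindex_bij_witness[of _ "\<lambda>(i, j). i * b + j" "\<lambda>i. (i div b, i mod b)"])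
    fix p assume "p \<in> {0..<a} \<times> {0..<b}"
    then obtain i j where p: "p = (i, j)" "i < a" "j < b" by auto
    have "i * b + j < Suc i * b" using p by simp
    also have "\<dots> \<le> a * b" using p by (intro mult_le_mono1) auto
    finally show "(case p of (i, j) \<Rightarrow> i * b + j) \<in> {0..<a * b}" using p by simp
  qed (use assms in \<open>auto simp: less_mult_imp_div_less\<close>)
  then show ?thesis by (simp add: sum.cartesian_product)
qed

lemma tensor_mat_mult_vec:
  assumes "dim_col A = dim_vec v" "dim_col B = dim_vec w"
  shows "tensor_mat A B *\<^sub>v tensor_vec v w = tensor_vec (A *\<^sub>v v) (B *\<^sub>v w)"
proof
  fix i assume i: "i < dim_vec (tensor_vec (A *\<^sub>v v) (B *\<^sub>v w))"
  let ?b = "dim_vec w" and ?i = "i div dim_row B" and ?j = "i mod dim_row B"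
  have i': "i < dim_row A * dim_row B" using i by (simp add: tensor_vec_def)
  then have rB: "0 < dim_row B" by (cases "dim_row B") auto
  have ij: "?i < dim_row A" "?j < dim_row B"
    using i' rB by (auto simp: less_mult_imp_div_less)
  have "(tensor_mat A B *\<^sub>v tensor_vec v w) $ i =
    (\<Sum>k\<in>{0..<dim_vec v * ?b}. A $$ (?i, k div ?b) * B $$ (?j, k mod ?b) * (v $ (k div ?b) * w $ (k mod ?b)))"
    using i' assms by (simp add: tensor_mat_def tensor_vec_def scalar_prod_def)
  also have "\<dots> = (\<Sum>k\<in>{0..<dim_vec v}. \<Sum>l\<in>{0..<?b}. A $$ (?i, k) * B $$ (?j, l) * (v $ k * w $ l))"
  proof (cases "?b = 0")
    case False
    then have pos: "0 < ?b" by (rule neq0_conv[THEN iffD1])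
    show ?thesis
      by (rule sum_div_mod[OF pos, of "\<lambda>k l. A $$ (?i, k) * B $$ (?j, l) * (v $ k * w $ l)"])
  qed simp
  also have "\<dots> = (A *\<^sub>v v) $ ?i * (B *\<^sub>v w) $ ?j"
    using ij assms by (simp add: scalar_prod_def sum_product mult_ac)
  finally show "(tensor_mat A B *\<^sub>v tensor_vec v w) $ i = tensor_vec (A *\<^sub>v v) (B *\<^sub>v w) $ i"
    using i' by (simp add: tensor_vec_def)
qed (simp add: tensor_vec_def tensor_mat_def)

lemma left_mult_rep:
  assumes "g \<in> carrier_mat m m" "A \<in> carrier_mat m m"
  shows "left_mult_rep m g *\<^sub>v vec_of_matrix m A = vec_of_matrix m (g * A)"
proof
  fix i assume "i < dim_vec (vec_of_matrix m (g * A))"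
  then have i: "i < m * m" by (simp add: vec_of_matrix_def)
  then have m: "0 < m" by (cases m) auto
  have ij: "i div m < m" "i mod m < m" using i m by (auto simp: less_mult_imp_div_less)
  have "(left_mult_rep m g *\<^sub>v vec_of_matrix m A) $ i =
    (\<Sum>k\<in>{0..<m * m}. g $$ (i div m, k div m) * 1\<^sub>m m $$ (i mod m, k mod m) * A $$ (k div m, k mod m))"
    using i assms by (simp add: left_mult_rep_def tensor_mat_def vec_of_matrix_def scalar_prod_def)
  also have "\<dots> = (\<Sum>k\<in>{0..<m}. \<Sum>l\<in>{0..<m}. g $$ (i div m, k) * 1\<^sub>m m $$ (i mod m, l) * A $$ (k, l))"
    by (rule sum_div_mod[OF m, of "\<lambda>k l. g $$ (i div m, k) * 1\<^sub>m m $$ (i mod m, l) * A $$ (k, l)"])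
  also have "\<dots> = (\<Sum>k\<in>{0..<m}. g $$ (i div m, k) * A $$ (k, i mod m))"
  proof (rule sum.cong[OF refl])
    fix k assume "k \<in> {0..<m}"
    have "(\<Sum>l\<in>{0..<m}. g $$ (i div m, k) * 1\<^sub>m m $$ (i mod m, l) * A $$ (k, l)) =
      (\<Sum>l\<in>{0..<m}. if l = i mod m then g $$ (i div m, k) * A $$ (k, l) else 0)"
      using ij by (intro sum.cong) auto
    then show "(\<Sum>l\<in>{0..<m}. g $$ (i div m, k) * 1\<^sub>m m $$ (i mod m, l) * A $$ (k, l)) =
      g $$ (i div m, k) * A $$ (k, i mod m)"
      using ij by simp
  qed
  finally show "(left_mult_rep m g *\<^sub>v vec_of_matrix m A) $ i = vec_of_matrix m (g * A) $ i"
    using i ij assms by (simp add: vec_of_matrix_def scalar_prod_def)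
qed (use assms in \<open>simp add: left_mult_rep_def tensor_mat_def vec_of_matrix_def\<close>)


section \<open>Tori and weight polytopes\<close>

definition standard_torus :: "nat \<Rightarrow> complex mat set" where
  "standard_torus r = {t \<in> carrier (GL r). diagonal_mat t}"

definition torus :: "nat \<Rightarrow> complex mat set \<Rightarrow> bool" where
  "torus m T \<longleftrightarrow> linear_algebraic_group m T \<and> (\<exists>r \<phi>. algebraic_iso r (standard_torus r) m T \<phi>)"

definition maximal_torus :: "nat \<Rightarrow> complex mat set \<Rightarrow> complex mat set \<Rightarrow> bool" where
  "maximal_torus m G T \<longleftrightarrow> torus m T \<and> T \<subseteq> G \<and> (\<forall>T'. torus m T' \<and> T \<subseteq> T' \<and> T' \<subseteq> G \<longrightarrow> T' = T)"

text \<open>For a representation \<open>\<pi>\<close> of \<open>(\<complex>\<^sup>*)\<^sup>r\<close> on \<open>\<complex>\<^sup>n\<close>. The character lattice of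
  \<open>(\<complex>\<^sup>*)\<^sup>r\<close> is \<open>\<int>\<^sup>r\<close>.\<close>

definition weight_space :: "nat \<Rightarrow> nat \<Rightarrow> (complex mat \<Rightarrow> complex mat) \<Rightarrow> int vec \<Rightarrow> complex vec set" where
  "weight_space r n \<pi> a =
    {v \<in> carrier_vec n. \<forall>t\<in>standard_torus r. \<pi> t *\<^sub>v v = (\<Prod>i<r. t $$ (i, i) powi (a $ i)) \<cdot>\<^sub>v v}"

definition weight_decomposition ::
  "nat \<Rightarrow> nat \<Rightarrow> (complex mat \<Rightarrow> complex mat) \<Rightarrow> complex vec \<Rightarrow> (int vec \<Rightarrow> complex vec) \<Rightarrow> bool" where
  "weight_decomposition r n \<pi> v u \<longleftrightarrow>
    (\<forall>a\<in>carrier_vec r. u a \<in> weight_space r n \<pi> a) \<and>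
    finite {a \<in> carrier_vec r. u a \<noteq> 0\<^sub>v n} \<and>
    v = finsum_vec TYPE(complex) n u {a \<in> carrier_vec r. u a \<noteq> 0\<^sub>v n}"

text \<open>The decomposition is unique, so the existential quantifier is harmless.\<close>

definition weights :: "nat \<Rightarrow> nat \<Rightarrow> (complex mat \<Rightarrow> complex mat) \<Rightarrow> complex vec \<Rightarrow> int vec set" where
  "weights r n \<pi> v = {a \<in> carrier_vec r. \<exists>u. weight_decomposition r n \<pi> v u \<and> u a \<noteq> 0\<^sub>v n}"

text \<open>The convex hull in \<open>\<int>\<^sup>r \<otimes> \<real> = \<real>\<^sup>r\<close>; the library's convex hull does not apply to
  vectors whose dimension is a term.\<close>

definition lattice_hull :: "nat \<Rightarrow> int vec set \<Rightarrow> real vec set" where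
  "lattice_hull r A = {vec r (\<lambda>i. \<Sum>a\<in>B. c a * real_of_int (a $ i)) | B c.
    finite B \<and> B \<subseteq> A \<and> (\<forall>a\<in>B. 0 \<le> c a) \<and> sum c B = 1}"

text \<open>Here \<open>\<phi>\<close> is an isomorphism from \<open>(\<complex>\<^sup>*)\<^sup>r\<close> onto a torus in \<open>G\<close>, which identifies the
  character lattice of that torus with \<open>\<int>\<^sup>r\<close>.\<close>

definition weight_polytope ::
  "nat \<Rightarrow> (complex mat \<Rightarrow> complex mat) \<Rightarrow> nat \<Rightarrow> (complex mat \<Rightarrow> complex mat) \<Rightarrow> complex vec \<Rightarrow> real vec set" where
  "weight_polytope r \<phi> n \<rho> v = lattice_hull r (weights r n (\<lambda>t. \<rho> (\<phi> t)) v)"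

definition Delta :: "nat \<Rightarrow> nat \<Rightarrow> (complex mat \<Rightarrow> complex mat) \<Rightarrow> real vec set" where
  "Delta m r \<phi> = weight_polytope r \<phi> (m * m) (left_mult_rep m) (vec_of_matrix m (1\<^sub>m m))"

definition degree_bound ::
  "nat \<Rightarrow> nat \<Rightarrow> (complex mat \<Rightarrow> complex mat) \<Rightarrow> nat \<Rightarrow> (complex mat \<Rightarrow> complex mat) \<Rightarrow> nat \<Rightarrow> bool" where
  "degree_bound m r \<phi> n \<rho> d \<longleftrightarrow> 0 < d \<and>
    (\<forall>v\<in>carrier_vec n. v \<noteq> 0\<^sub>v n \<longrightarrow>
      weight_polytope r \<phi> n \<rho> v \<subseteq> (\<lambda>x. real d \<cdot>\<^sub>v x) ` Delta m r \<phi>)"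

text \<open>Only meaningful if some \<open>d\<close> satisfies \<open>degree_bound\<close>.\<close>

definition rep_degree ::
  "nat \<Rightarrow> nat \<Rightarrow> (complex mat \<Rightarrow> complex mat) \<Rightarrow> nat \<Rightarrow> (complex mat \<Rightarrow> complex mat) \<Rightarrow> nat" where
  "rep_degree m r \<phi> n \<rho> = (LEAST d. degree_bound m r \<phi> n \<rho> d)"


section \<open>Semistable and stable pairs\<close>

text \<open>\<open>V = \<complex>\<^sup>n\<close> and \<open>W = \<complex>\<^sup>k\<close> carry the representations \<open>\<rho>\<close> and \<open>\<sigma>\<close>, and \<open>V \<oplus> W = \<complex>\<^sup>n\<^sup>+\<^sup>k\<close>.\<close>

definition orbit ::
  "complex mat set \<Rightarrow> nat \<Rightarrow> (complex mat \<Rightarrow> complex mat) \<Rightarrow> nat \<Rightarrow> (complex mat \<Rightarrow> complex mat)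
    \<Rightarrow> complex vec set \<Rightarrow> complex vec set set" where
  "orbit G n \<rho> k \<sigma> p = (\<lambda>g. (\<lambda>x. direct_sum_rep n \<rho> k \<sigma> g *\<^sub>v x) ` p) ` G"

definition second_summand :: "nat \<Rightarrow> nat \<Rightarrow> complex vec set set" where
  "second_summand n k = {line (0\<^sub>v n @\<^sub>v w) | w. w \<in> carrier_vec k \<and> w \<noteq> 0\<^sub>v k}"

definition semistable_locus ::
  "complex mat set \<Rightarrow> nat \<Rightarrow> (complex mat \<Rightarrow> complex mat) \<Rightarrow> nat \<Rightarrow> (complex mat \<Rightarrow> complex mat)
    \<Rightarrow> complex vec set set" where
  "semistable_locus G n \<rho> k \<sigma> = {line (v @\<^sub>v w) | v w.
    v \<in> carrier_vec n \<and> w \<in> carrier_vec k \<and> v \<noteq> 0\<^sub>v n \<and>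
    (zariski (n + k) closure_of orbit G n \<rho> k \<sigma> (line (v @\<^sub>v w))) \<inter> second_summand n k = {}}"

text \<open>Rescaling \<open>(v, w)\<close> by \<open>c\<close> rescales the two components of the associated pair by
  \<open>c\<^sup>l\<close> and \<open>c\<^sup>l\<^sup>+\<^sup>1\<close>. This can change its class, but not its semistability, since scaling
  the second summand is \<open>G\<close>-equivariant. So the choice of \<open>(v, w)\<close> does not matter.\<close>

definition stable_locus ::
  "nat \<Rightarrow> complex mat set \<Rightarrow> nat \<Rightarrow> (complex mat \<Rightarrow> complex mat)
    \<Rightarrow> nat \<Rightarrow> (complex mat \<Rightarrow> complex mat) \<Rightarrow> nat \<Rightarrow> (complex mat \<Rightarrow> complex mat)
    \<Rightarrow> complex vec set set" where
  "stable_locus m G r \<phi> n \<rho> k \<sigma> = (let d = rep_degree m r \<phi> n \<rho> in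
    {line (v @\<^sub>v w) | v w. v \<in> carrier_vec n \<and> w \<in> carrier_vec k \<and> v \<noteq> 0\<^sub>v n \<and>
      (\<exists>l>0.
        line (tensor_vec (vec_tensor_power (vec_of_matrix m (1\<^sub>m m)) d) (vec_tensor_power v l)
              @\<^sub>v vec_tensor_power w (l + 1))
        \<in> semistable_locus G
            ((m * m) ^ d * n ^ l)
            (\<lambda>g. tensor_mat (mat_tensor_power (left_mult_rep m g) d) (mat_tensor_power (\<rho> g) l))
            (k ^ (l + 1))
            (\<lambda>g. mat_tensor_power (\<sigma> g) (l + 1)))})"

end

theory Submission
  imports Defs "HOL-Library.Poly_Mapping" "HOL-Computational_Algebra.Fundamental_Theorem_Algebra"
    "HOL-Analysis.Continuum_Not_Denumerable"
begin

text \<open>Let \<open>x = (v, w)\<close> and let \<open>I\<^sub>x\<close> be the ideal of the graph of \<open>(g, s) \<mapsto> s g x\<close>, in the coordinates of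
  \<open>G\<close>, of \<open>s\<close> and of \<open>V \<oplus> W\<close>. By the Nullstellensatz the pair is semistable iff, for some \<open>d\<close>, every
  monomial of degree \<open>d\<close> in the coordinates of \<open>W\<close> is congruent modulo \<open>I\<^sub>x\<close> to a form that vanishes
  on \<open>W\<close>. For a suitable elimination order this says that these monomials are leading monomials of
  \<open>I\<^sub>x\<close>. On an irreducible closed set of parameters \<open>x\<close> the leading monomials of \<open>I\<^sub>x\<close> do not depend on
  \<open>x\<close> outside a proper closed subset, because by Dickson's lemma only finitely many leading
  coefficients have to be inverted in order to reduce to normal form. Noetherian induction now
  shows that the semistable locus is constructible. The stable locus is the union over \<open>l\<close> of the
  preimages of semistable loci under polynomial maps.\<close>

text \<open>The ideals of the orbit closures alone are a poor family: a form that vanishes on a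
  special orbit need not be the limit of forms vanishing on the neighbouring ones. The graphs behave
  better. They all lie over the same space of pairs (g, s), so an element \<open>F\<close> of
  \<open>I\<^sub>x\<close> spreads out to every \<open>y\<close> by subtracting its restriction to
  the graph of \<open>y\<close> and adding its restriction to the graph of \<open>x\<close>. The
  elimination order afterwards recovers the relations among the coordinates of V \<oplus> W alone,
  and the scaling variable makes these relations split into homogeneous components. The exponent
  \<open>d\<close> comes without a bound uniform in \<open>x\<close>, but none is asked for: on the
  open part the whole set of leading monomials is constant, and with it the truth of the statement
  that some \<open>d\<close> exists. For stability there is one more obstacle: a multiple of (v, w)
  has tensor components multiplied by two different powers, so the criterion must be invariant under
  independent scalings of the two summands.\<close>

abbreviation lookup :: "('a \<Rightarrow>\<^sub>0 'b::zero) \<Rightarrow> 'a \<Rightarrow> 'b" where "lookup \<equiv> Poly_Mapping.lookup"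
abbreviation keys :: "('a \<Rightarrow>\<^sub>0 'b::zero) \<Rightarrow> 'a set" where "keys \<equiv> Poly_Mapping.keys"
abbreviation single :: "'a \<Rightarrow> 'b \<Rightarrow> ('a \<Rightarrow>\<^sub>0 'b::zero)" where "single \<equiv> Poly_Mapping.single"

section \<open>Multivariate polynomials\<close>

type_synonym 'v mono = "'v \<Rightarrow>\<^sub>0 nat"
type_synonym 'v mpoly = "'v mono \<Rightarrow>\<^sub>0 complex"

definition monomials :: "'v set \<Rightarrow> 'v mono set" where
  "monomials V = {\<mu>. keys \<mu> \<subseteq> V}"

definition polys :: "'v set \<Rightarrow> 'v mpoly set" where
  "polys V = {F. keys F \<subseteq> monomials V}"

definition var :: "'v \<Rightarrow> 'v mpoly" where
  "var v = single (single v 1) 1"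

definition const :: "complex \<Rightarrow> 'v mpoly" where
  "const c = single 0 c"

section \<open>Supports and closure properties of polynomials in a fixed set of variables\<close>

lemma keys_add_mono: "keys (\<mu> + \<nu>) = keys \<mu> \<union> keys (\<nu> :: 'v mono)"
  by (auto simp: in_keys_iff lookup_add)

lemma zero_monomials [simp]: "0 \<in> monomials V"
  by (simp add: monomials_def)

lemma monomials_add_iff [simp]: "\<mu> + \<nu> \<in> monomials V \<longleftrightarrow> \<mu> \<in> monomials V \<and> \<nu> \<in> monomials V"
  by (auto simp: monomials_def keys_add_mono)

lemma single_monomials [simp]: "single v k \<in> monomials V \<longleftrightarrow> k = 0 \<or> v \<in> V"
  by (auto simp: monomials_def)

lemma monomials_mono: "V \<subseteq> V' \<Longrightarrow> monomials V \<subseteq> monomials V'"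
  by (auto simp: monomials_def)

lemma polys_mono: "V \<subseteq> V' \<Longrightarrow> polys V \<subseteq> polys V'"
  using monomials_mono[of V V'] by (auto simp: polys_def)

lemma polysD: "F \<in> polys V \<Longrightarrow> \<mu> \<in> keys F \<Longrightarrow> \<mu> \<in> monomials V"
  by (auto simp: polys_def)

lemma polys_zero [simp]: "0 \<in> polys V"
  by (simp add: polys_def)

lemma polys_single [simp]: "single \<mu> c \<in> polys V \<longleftrightarrow> c = 0 \<or> \<mu> \<in> monomials V"
  by (auto simp: polys_def)

lemma polys_const [simp]: "const c \<in> polys V"
  by (simp add: const_def)

lemma polys_one [simp]: "1 \<in> polys V"
  by (metis polys_single single_one zero_monomials)

lemma polys_var [simp]: "v \<in> V \<Longrightarrow> var v \<in> polys V"
  by (simp add: var_def)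

lemma polys_add: "F \<in> polys V \<Longrightarrow> H \<in> polys V \<Longrightarrow> F + H \<in> polys V"
  using Poly_Mapping.keys_add[of F H] by (auto simp: polys_def)

lemma keys_uminus [simp]: "keys (- F) = keys (F :: 'a \<Rightarrow>\<^sub>0 'b::ab_group_add)"
  by (auto simp: in_keys_iff)

lemma polys_uminus: "F \<in> polys V \<Longrightarrow> - F \<in> polys V"
  by (auto simp: polys_def)

lemma polys_diff: "F \<in> polys V \<Longrightarrow> H \<in> polys V \<Longrightarrow> F - H \<in> polys V"
  using polys_add[of F V "- H"] polys_uminus[of H V] by simp

lemma polys_mult: "F \<in> polys V \<Longrightarrow> H \<in> polys V \<Longrightarrow> F * H \<in> polys V"
  using Poly_Mapping.keys_mult[of F H] by (fastforce simp: polys_def)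

lemma polys_sum: "(\<And>i. i \<in> I \<Longrightarrow> F i \<in> polys V) \<Longrightarrow> sum F I \<in> polys V"
  by (induction I rule: infinite_finite_induct) (auto intro: polys_add)

lemma polys_prod: "(\<And>i. i \<in> I \<Longrightarrow> F i \<in> polys V) \<Longrightarrow> prod F I \<in> polys V"
  by (induction I rule: infinite_finite_induct) (auto intro: polys_mult)

lemma polys_power: "F \<in> polys V \<Longrightarrow> F ^ k \<in> polys V"
  by (induction k) (auto intro: polys_mult)

lemma const_simps:
  "const 0 = 0" "const 1 = 1" "const (a + b) = const a + const b"
  "const (a * b) = const a * const b" "const (- a) = - const a" "const (a - b) = const a - const b"
  by (simp_all add: const_def single_add mult_single single_uminus single_diff)

lemma lookup_const_mult [simp]: "lookup (const c * F) \<mu> = c * lookup F \<mu>"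
  unfolding const_def mult_map_scale_conv_mult[symmetric]
  by (simp add: Poly_Mapping.map.rep_eq when_def)

lemma lookup_single_mult_add: "lookup (single \<nu> c * F) (\<nu> + \<mu> :: 'v mono) = c * lookup F \<mu>"
proof -
  have "lookup (single \<nu> c * F) (\<nu> + \<mu>) = (\<Sum>l. lookup (single \<nu> c) l * (\<Sum>q. lookup F q when \<nu> + \<mu> = l + q))"
    by (rule lookup_mult)
  also have "(\<lambda>l. lookup (single \<nu> c) l * (\<Sum>q. lookup F q when \<nu> + \<mu> = l + q)) =
     (\<lambda>l. c * (\<Sum>q. lookup F q when \<nu> + \<mu> = \<nu> + q) when l = \<nu>)"
    by (auto simp: lookup_single when_def)
  also have "(\<Sum>l. (c * (\<Sum>q. lookup F q when \<nu> + \<mu> = \<nu> + q) when l = \<nu>)) = c * lookup F \<mu>"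
    by simp
  finally show ?thesis .
qed

lemma keys_single_mult: "keys (single \<nu> c * F) \<subseteq> (+) \<nu> ` keys (F :: 'v mpoly)"
  using Poly_Mapping.keys_mult[of "single \<nu> c" F] by (auto split: if_splits)

lemma keys_const_mult: "keys (const c * F) \<subseteq> keys F"
  by (auto simp: in_keys_iff)

lemma keys_sum_sub: "keys (sum F I) \<subseteq> (\<Union>i\<in>I. keys (F i :: 'a \<Rightarrow>\<^sub>0 'b::comm_monoid_add))"
proof (induction I rule: infinite_finite_induct)
  case (insert x A)
  then show ?case using Poly_Mapping.keys_add[of "F x" "sum F A"] by auto
qed auto

lemma poly_expand:
  assumes "finite B" "keys F \<subseteq> B"
  shows "(F :: 'a \<Rightarrow>\<^sub>0 'b::comm_monoid_add) = (\<Sum>\<mu>\<in>B. single \<mu> (lookup F \<mu>))"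
proof (rule poly_mapping_eqI)
  fix \<nu>
  have "lookup (\<Sum>\<mu>\<in>B. single \<mu> (lookup F \<mu>)) \<nu> = (\<Sum>\<mu>\<in>B. if \<mu> = \<nu> then lookup F \<nu> else 0)"
    unfolding lookup_sum by (rule sum.cong) (auto simp: lookup_single when_def)
  also have "\<dots> = lookup F \<nu>"
    using assms by (auto simp: in_keys_iff)
  finally show "lookup F \<nu> = lookup (\<Sum>\<mu>\<in>B. single \<mu> (lookup F \<mu>)) \<nu>" by simp
qed

subsection \<open>Linear extension and substitution\<close>

text \<open>Coefficients pass through \<open>h\<close> and monomials through an arbitrary
  \<open>c\<close>. One construction thus covers evaluation at a point, substitution of polynomials,
  and linear maps that are not multiplicative, such as the homogenization in
  \<open>not_degenerate_imp_power\<close>.\<close>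

definition lin_ext :: "(complex \<Rightarrow> 'r::comm_ring_1) \<Rightarrow> ('v mono \<Rightarrow> 'r) \<Rightarrow> 'v mpoly \<Rightarrow> 'r" where
  "lin_ext h c F = (\<Sum>\<mu>\<in>keys F. h (lookup F \<mu>) * c \<mu>)"

definition mono_eval :: "('v \<Rightarrow> 'r::comm_ring_1) \<Rightarrow> 'v mono \<Rightarrow> 'r" where
  "mono_eval a \<mu> = (\<Prod>v\<in>keys \<mu>. a v ^ lookup \<mu> v)"

abbreviation eval :: "('v \<Rightarrow> complex) \<Rightarrow> 'v mpoly \<Rightarrow> complex" where
  "eval a \<equiv> lin_ext (\<lambda>x. x) (mono_eval a)"

abbreviation subst :: "('v \<Rightarrow> 'w mpoly) \<Rightarrow> 'v mpoly \<Rightarrow> 'w mpoly" where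
  "subst a \<equiv> lin_ext const (mono_eval a)"

lemma mono_eval_superset:
  assumes "finite B" "keys \<mu> \<subseteq> B"
  shows "mono_eval a \<mu> = (\<Prod>v\<in>B. a v ^ lookup \<mu> v)"
  unfolding mono_eval_def by (rule prod.mono_neutral_left) (use assms in \<open>auto simp: in_keys_iff\<close>)

lemma mono_eval_zero [simp]: "mono_eval a 0 = 1"
  by (simp add: mono_eval_def)

lemma mono_eval_add: "mono_eval a (\<mu> + \<nu>) = mono_eval a \<mu> * mono_eval a \<nu>"
proof -
  let ?B = "keys \<mu> \<union> keys \<nu>"
  have "mono_eval a (\<mu> + \<nu>) = (\<Prod>v\<in>?B. a v ^ lookup (\<mu> + \<nu>) v)"
    "mono_eval a \<mu> = (\<Prod>v\<in>?B. a v ^ lookup \<mu> v)" "mono_eval a \<nu> = (\<Prod>v\<in>?B. a v ^ lookup \<nu> v)"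
    by (auto simp: keys_add_mono intro!: mono_eval_superset)
  then show ?thesis by (simp add: lookup_add power_add prod.distrib)
qed

lemma mono_eval_single [simp]: "mono_eval a (single v k) = a v ^ k"
  by (simp add: mono_eval_def)

lemma var_power: "var v ^ k = single (single v k) 1"
  by (induction k) (simp_all add: var_def mult_single single_add[symmetric])

lemma mono_eval_var: "mono_eval var \<mu> = single \<mu> 1"
proof -
  have "(\<Prod>v\<in>B. single (f v) 1) = (single (\<Sum>v\<in>B. f v) 1 :: 'a mpoly)" if "finite B" for B :: "'a set" and f
    using that by (induction B) (simp_all add: mult_single)
  then have "mono_eval var \<mu> = single (\<Sum>v\<in>keys \<mu>. single v (lookup \<mu> v)) 1"
    by (simp add: mono_eval_def var_power)
  then show ?thesis using poly_expand[of "keys \<mu>" \<mu>] by simp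
qed

text \<open>Expansion along the support writes a polynomial as a sum of constants times products of
  powers of variables.\<close>

lemma polys_induct [consumes 1, case_names const var add mult]:
  assumes F: "F \<in> polys V" and const: "\<And>c. P (const c)" and var: "\<And>v. v \<in> V \<Longrightarrow> P (var v)"
    and add: "\<And>F H. P F \<Longrightarrow> P H \<Longrightarrow> P (F + H)" and mult: "\<And>F H. P F \<Longrightarrow> P H \<Longrightarrow> P (F * H)"
  shows "P F"
proof -
  have sum: "P (sum f B)" if "\<And>i. i \<in> B \<Longrightarrow> P (f i)" for B :: "'b set" and f
    using that const[of 0] by (induction B rule: infinite_finite_induct) (auto simp: const_simps intro: add)
  have prod: "P (prod f B)" if "\<And>i. i \<in> B \<Longrightarrow> P (f i)" for B :: "'a set" and f
    using that const[of 1] by (induction B rule: infinite_finite_induct) (auto simp: const_simps intro: mult)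
  have power: "P (H ^ k)" if "P H" for H k
    using that const[of 1] by (induction k) (auto simp: const_simps intro: mult)
  have "F = (\<Sum>\<mu>\<in>keys F. const (lookup F \<mu>) * mono_eval var \<mu>)"
    using poly_expand[of "keys F" F] by (simp add: mono_eval_var const_def mult_single)
  moreover have "P (\<Sum>\<mu>\<in>keys F. const (lookup F \<mu>) * mono_eval var \<mu>)"
    unfolding mono_eval_def
  proof (intro sum mult const prod power var)
    fix \<mu> v assume "\<mu> \<in> keys F" "v \<in> keys \<mu>"
    then show "v \<in> V" using F by (auto simp: polys_def monomials_def)
  qed
  ultimately show ?thesis by simp
qed

text \<open>Instantiated with the identity of the complex numbers for evaluation and with
  \<open>const\<close> for substitution.\<close>

locale coeff_hom =
  fixes h :: "complex \<Rightarrow> 'r::comm_ring_1"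
  assumes h_add: "h (a + b) = h a + h b" and h_mult: "h (a * b) = h a * h b" and h_one: "h 1 = 1"
begin

lemma h_zero: "h 0 = 0"
  using h_add[of 0 0] by simp

lemma lin_ext_superset:
  assumes "finite B" "keys F \<subseteq> B"
  shows "lin_ext h c F = (\<Sum>\<mu>\<in>B. h (lookup F \<mu>) * c \<mu>)"
  unfolding lin_ext_def by (rule sum.mono_neutral_left) (use assms in \<open>auto simp: in_keys_iff h_zero\<close>)

lemma lin_ext_zero [simp]: "lin_ext h c 0 = 0"
  by (simp add: lin_ext_def)

lemma lin_ext_add: "lin_ext h c (F + H) = lin_ext h c F + lin_ext h c H"
proof -
  let ?B = "keys F \<union> keys H"
  have "lin_ext h c (F + H) = (\<Sum>\<mu>\<in>?B. h (lookup (F + H) \<mu>) * c \<mu>)"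
    "lin_ext h c F = (\<Sum>\<mu>\<in>?B. h (lookup F \<mu>) * c \<mu>)"
    "lin_ext h c H = (\<Sum>\<mu>\<in>?B. h (lookup H \<mu>) * c \<mu>)"
    using Poly_Mapping.keys_add[of F H] by (auto intro!: lin_ext_superset)
  then show ?thesis by (simp add: lookup_add h_add algebra_simps sum.distrib)
qed

lemma lin_ext_single: "lin_ext h c (single \<mu> b) = h b * c \<mu>"
  by (simp add: lin_ext_def h_zero)

lemma lin_ext_uminus: "lin_ext h c (- F) = - lin_ext h c F"
  using lin_ext_add[of c F "- F"] by (simp add: minus_unique)

lemma lin_ext_diff: "lin_ext h c (F - H) = lin_ext h c F - lin_ext h c H"
  using lin_ext_add[of c F "- H"] by (simp add: lin_ext_uminus)

lemma lin_ext_sum: "lin_ext h c (sum F I) = (\<Sum>i\<in>I. lin_ext h c (F i))"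
  by (induction I rule: infinite_finite_induct) (auto simp: lin_ext_add)

lemma lin_ext_mono_mult:
  "lin_ext h c (single \<nu> b * F) = (\<Sum>\<mu>\<in>keys F. h (b * lookup F \<mu>) * c (\<nu> + \<mu>))"
proof -
  have "single \<nu> b * F = single \<nu> b * (\<Sum>\<mu>\<in>keys F. single \<mu> (lookup F \<mu>))"
    using poly_expand[of "keys F" F] by simp
  then show ?thesis by (simp add: sum_distrib_left mult_single lin_ext_sum lin_ext_single)
qed

lemma lin_ext_mult: "lin_ext h (mono_eval a) (F * H) = lin_ext h (mono_eval a) F * lin_ext h (mono_eval a) H"
proof -
  have "lin_ext h (mono_eval a) (single \<mu> b * H) = h b * mono_eval a \<mu> * lin_ext h (mono_eval a) H" for \<mu> b
    unfolding lin_ext_mono_mult by (simp add: lin_ext_def sum_distrib_left h_mult mono_eval_add mult_ac)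
  moreover have "F * H = (\<Sum>\<mu>\<in>keys F. single \<mu> (lookup F \<mu>) * H)"
    unfolding sum_distrib_right[symmetric] using poly_expand[of "keys F" F] by simp
  ultimately show ?thesis by (simp add: lin_ext_sum lin_ext_def[of h "mono_eval a" F] sum_distrib_right)
qed

lemma lin_ext_const: "lin_ext h (mono_eval a) (const b) = h b"
  by (simp add: const_def lin_ext_single)

lemma lin_ext_one: "lin_ext h (mono_eval a) 1 = 1"
  using lin_ext_const[of a 1] by (simp add: const_simps h_one)

lemma lin_ext_var: "lin_ext h (mono_eval a) (var v) = a v"
  by (simp add: var_def lin_ext_single h_one)

lemma lin_ext_power: "lin_ext h (mono_eval a) (F ^ k) = lin_ext h (mono_eval a) F ^ k"
  by (induction k) (auto simp: lin_ext_mult lin_ext_one)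

lemma lin_ext_prod: "lin_ext h (mono_eval a) (prod F I) = (\<Prod>i\<in>I. lin_ext h (mono_eval a) (F i))"
  by (induction I rule: infinite_finite_induct) (auto simp: lin_ext_mult lin_ext_one)

lemmas lin_ext_simps = lin_ext_add lin_ext_diff lin_ext_uminus lin_ext_mult lin_ext_const lin_ext_one
  lin_ext_var lin_ext_power lin_ext_sum lin_ext_prod lin_ext_single

end

interpretation ev: coeff_hom "\<lambda>x::complex. x"
  by unfold_locales auto

interpretation sb: coeff_hom const
  by unfold_locales (auto simp: const_simps)

lemma mono_eval_cong: "\<mu> \<in> monomials V \<Longrightarrow> (\<And>v. v \<in> V \<Longrightarrow> a v = b v) \<Longrightarrow> mono_eval a \<mu> = mono_eval b \<mu>"
  unfolding mono_eval_def monomials_def by (rule prod.cong) auto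

lemma eval_cong: "F \<in> polys V \<Longrightarrow> (\<And>v. v \<in> V \<Longrightarrow> a v = b v) \<Longrightarrow> eval a F = eval b F"
  unfolding lin_ext_def by (intro sum.cong refl arg_cong2[where f = "(*)"] mono_eval_cong[of _ V]) (auto dest: polysD)

lemma eval_mono_eval: "eval a (mono_eval t \<mu>) = mono_eval (\<lambda>v. eval a (t v)) \<mu>"
  by (simp add: mono_eval_def ev.lin_ext_simps)

lemma eval_subst: "eval a (subst t F) = eval (\<lambda>v. eval a (t v)) F"
  by (simp add: lin_ext_def[of const] ev.lin_ext_simps eval_mono_eval) (simp add: lin_ext_def)

lemma polys_subst:
  assumes "F \<in> polys V" "\<And>v. v \<in> V \<Longrightarrow> t v \<in> polys V'"
  shows "subst t F \<in> polys V'"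
  unfolding lin_ext_def mono_eval_def
proof (intro polys_sum polys_mult polys_const polys_prod polys_power)
  fix \<mu> v assume "\<mu> \<in> keys F" "v \<in> keys \<mu>"
  then have "v \<in> V" using assms(1) by (auto simp: polys_def monomials_def)
  then show "t v \<in> polys V'" by (rule assms(2))
qed

section \<open>Function algebras as images of polynomial rings\<close>

lemma function_algebra_sum:
  "(\<And>i. i \<in> I \<Longrightarrow> q i \<in> function_algebra X) \<Longrightarrow> (\<lambda>x. \<Sum>i\<in>I. q i x) \<in> function_algebra X"
  by (induction I rule: infinite_finite_induct) (simp_all add: function_algebra.const function_algebra.add)

lemma function_algebra_prod:
  "(\<And>i. i \<in> I \<Longrightarrow> q i \<in> function_algebra X) \<Longrightarrow> (\<lambda>x. \<Prod>i\<in>I. q i x) \<in> function_algebra X"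
  by (induction I rule: infinite_finite_induct) (simp_all add: function_algebra.const function_algebra.mult)

lemma function_algebra_power:
  "q \<in> function_algebra X \<Longrightarrow> (\<lambda>x. q x ^ k) \<in> function_algebra X"
  by (induction k) (simp_all add: function_algebra.const function_algebra.mult)

text \<open>The functions generating the algebra serve as the variables themselves.\<close>

lemma function_algebra_eval: "f \<in> function_algebra X \<longleftrightarrow> (\<exists>F\<in>polys X. f = (\<lambda>x. eval (\<lambda>f. f x) F))"
proof
  assume "f \<in> function_algebra X"
  then show "\<exists>F\<in>polys X. f = (\<lambda>x. eval (\<lambda>f. f x) F)"
  proof induction
    case (gen f)
    then show ?case by (intro bexI[of _ "var f"]) (auto simp: ev.lin_ext_var)
  next
    case (const c)
    show ?case by (intro bexI[of _ "single 0 c"]) (auto simp: ev.lin_ext_single)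
  next
    case (add f h)
    then obtain F H where "F \<in> polys X" "H \<in> polys X" "f = (\<lambda>x. eval (\<lambda>f. f x) F)" "h = (\<lambda>x. eval (\<lambda>f. f x) H)"
      by blast
    then show ?case by (intro bexI[of _ "F + H"]) (auto simp: ev.lin_ext_add intro: polys_add)
  next
    case (mult f h)
    then obtain F H where "F \<in> polys X" "H \<in> polys X" "f = (\<lambda>x. eval (\<lambda>f. f x) F)" "h = (\<lambda>x. eval (\<lambda>f. f x) H)"
      by blast
    then show ?case by (intro bexI[of _ "F * H"]) (auto simp: ev.lin_ext_mult intro: polys_mult)
  qed
next
  assume "\<exists>F\<in>polys X. f = (\<lambda>x. eval (\<lambda>f. f x) F)"
  then obtain F where F: "F \<in> polys X" and f: "f = (\<lambda>x. eval (\<lambda>f. f x) F)" by blast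
  show "f \<in> function_algebra X"
    unfolding f lin_ext_def mono_eval_def
  proof (intro function_algebra_sum function_algebra.mult function_algebra.const function_algebra_prod function_algebra_power)
    fix \<mu> v assume "\<mu> \<in> keys F" "v \<in> keys \<mu>"
    then show "(\<lambda>x. v x) \<in> function_algebra X"
      using F by (auto simp: polys_def monomials_def intro: function_algebra.gen)
  qed
qed

section \<open>Monomial orders and Dickson's lemma\<close>

text \<open>The partial degree in the variables of \<open>A\<close>.\<close>

definition weight :: "'v set \<Rightarrow> 'v mono \<Rightarrow> nat" where
  "weight A \<mu> = (\<Sum>v\<in>A. lookup \<mu> v)"

lemma weight_zero [simp]: "weight A 0 = 0"
  by (simp add: weight_def)

lemma weight_add: "weight A (\<mu> + \<nu>) = weight A \<mu> + weight A \<nu>"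
  by (simp add: weight_def lookup_add sum.distrib)

lemma weight_single: "finite A \<Longrightarrow> weight A (single v k) = (if v \<in> A then k else 0)"
  by (simp add: weight_def lookup_single when_def)

text \<open>The matrix order whose rows are the indicator vectors of the listed sets. Distinct
  monomials may be incomparable; totality comes from listing singletons.\<close>

fun mless :: "'v set list \<Rightarrow> 'v mono \<Rightarrow> 'v mono \<Rightarrow> bool" where
  "mless [] \<mu> \<nu> = False"
| "mless (A # ws) \<mu> \<nu> \<longleftrightarrow> weight A \<mu> < weight A \<nu> \<or> weight A \<mu> = weight A \<nu> \<and> mless ws \<mu> \<nu>"

lemma mless_irrefl: "\<not> mless ws \<mu> \<mu>"
  by (induction ws) auto

lemma mless_trans: "mless ws \<mu> \<nu> \<Longrightarrow> mless ws \<nu> \<kappa> \<Longrightarrow> mless ws \<mu> \<kappa>"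
  by (induction ws) auto

lemma mless_add: "mless ws (\<kappa> + \<mu>) (\<kappa> + \<nu>) \<longleftrightarrow> mless ws \<mu> \<nu>"
  by (induction ws) (auto simp: weight_add)

text \<open>The order is pulled back from a finite lexicographic product of copies of the natural
  numbers, so it is well-founded even where it is not total.\<close>

lemma wf_mless: "wf {(\<mu>, \<nu>). mless ws \<mu> \<nu>}"
proof (induction ws)
  case (Cons A ws)
  have "{(\<mu>, \<nu>). mless (A # ws) \<mu> \<nu>} =
    inv_image (less_than <*lex*> {(\<mu>, \<nu>). mless ws \<mu> \<nu>}) (\<lambda>\<mu>. (weight A \<mu>, \<mu>))"
    by auto
  then show ?case
    using Cons by (simp add: wf_lex_prod)
qed simp

lemma mless_total:
  assumes "\<not> mless ws \<mu> \<nu>" "\<not> mless ws \<nu> \<mu>" "A \<in> set ws"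
  shows "weight A \<mu> = weight A \<nu>"
  using assms by (induction ws) (auto split: if_splits)

definition is_lead :: "'v set list \<Rightarrow> 'v mpoly \<Rightarrow> 'v mono \<Rightarrow> bool" where
  "is_lead ws F \<mu> \<longleftrightarrow> \<mu> \<in> keys F \<and> (\<forall>\<nu>\<in>keys F. mless ws \<nu> \<mu> \<or> \<nu> = \<mu>)"

definition leads :: "'v set list \<Rightarrow> 'v mpoly set \<Rightarrow> 'v mono set" where
  "leads ws S = {\<mu>. \<exists>F\<in>S. is_lead ws F \<mu>}"

text \<open>Some subsequence is monotone; if it decreases, it is constant from the place on where it
  attains its minimum.\<close>

lemma nat_seq_mono:
  fixes f :: "nat \<Rightarrow> nat"
  shows "\<exists>r :: nat \<Rightarrow> nat. strict_mono r \<and> (\<forall>i j. i \<le> j \<longrightarrow> f (r i) \<le> f (r j))"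
proof -
  obtain r :: "nat \<Rightarrow> nat" where r: "strict_mono r" "monoseq (\<lambda>n. f (r n))"
    using seq_monosub by blast
  from r(2) consider "\<forall>i j. i \<le> j \<longrightarrow> f (r i) \<le> f (r j)" | "\<forall>i j. i \<le> j \<longrightarrow> f (r j) \<le> f (r i)"
    unfolding monoseq_def by blast
  then show ?thesis
  proof cases
    case 1
    then show ?thesis using r(1) by blast
  next
    case 2
    obtain n where n: "\<And>i. f (r n) \<le> f (r i)"
      using ex_has_least_nat[of "\<lambda>_. True" 0 "\<lambda>i. f (r i)"] by auto
    have "f (r (n + i)) = f (r n)" for i
      using n[of "n + i"] 2 by (simp add: le_antisym)
    then show ?thesis
      using r(1) by (intro exI[of _ "\<lambda>i. r (n + i)"]) (simp add: strict_mono_def)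
  qed
qed

text \<open>One variable is treated at a time, passing to a further subsequence, which keeps the
  monotonicity already achieved.\<close>

lemma mono_seq_mono:
  assumes "finite V"
  shows "\<exists>r :: nat \<Rightarrow> nat. strict_mono r \<and> (\<forall>v\<in>V. \<forall>i j. i \<le> j \<longrightarrow> lookup (s (r i)) v \<le> lookup (s (r j) :: 'v mono) v)"
  using assms
proof (induction V)
  case empty
  have "strict_mono (id :: nat \<Rightarrow> nat)" by (simp add: strict_mono_def)
  then show ?case by blast
next
  case (insert v V)
  from insert.IH obtain r :: "nat \<Rightarrow> nat" where r': "strict_mono r \<and>
    (\<forall>v\<in>V. \<forall>i j. i \<le> j \<longrightarrow> lookup (s (r i)) v \<le> lookup (s (r j)) v)" ..
  note r = r'[THEN conjunct1] r'[THEN conjunct2]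
  from nat_seq_mono[of "\<lambda>i. lookup (s (r i)) v"]
  obtain q :: "nat \<Rightarrow> nat" where q': "strict_mono q \<and> (\<forall>i j. i \<le> j \<longrightarrow> lookup (s (r (q i))) v \<le> lookup (s (r (q j))) v)" ..
  note q = q'[THEN conjunct1] q'[THEN conjunct2]
  have sm: "strict_mono (\<lambda>i. r (q i))" using r(1) q(1) by (simp add: strict_mono_def)
  have le: "lookup (s (r (q i))) u \<le> lookup (s (r (q j))) u" if "u \<in> insert v V" "i \<le> j" for u i j
    using that r(2) q by (auto simp: strict_mono_less_eq)
  show ?case
    by (rule exI[of _ "\<lambda>i. r (q i)"], intro conjI ballI allI impI) (fact sm, fact le)
qed

lemma mono_le_imp_add:
  assumes "\<And>v. lookup \<mu> v \<le> lookup (\<nu> :: 'v mono) v"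
  shows "\<exists>\<kappa>. \<nu> = \<mu> + \<kappa>"
proof -
  have "\<nu> = \<mu> + (\<nu> - \<mu>)"
    by (rule poly_mapping_eqI) (simp add: lookup_add lookup_minus assms)
  then show ?thesis ..
qed

text \<open>The minimal elements of \<open>L\<close> under divisibility suffice. Infinitely many of
  them would contain a sequence increasing in every exponent, hence two distinct ones of which one
  divides the other.\<close>

lemma Dickson:
  assumes V: "finite V" and L: "L \<subseteq> monomials V"
  shows "\<exists>B. finite B \<and> B \<subseteq> L \<and> (\<forall>\<mu>\<in>L. \<exists>\<beta>\<in>B. \<exists>\<kappa>. \<mu> = \<beta> + \<kappa>)"
proof -
  define B where "B = {\<mu> \<in> L. \<forall>\<beta>\<in>L. \<forall>\<kappa>. \<mu> = \<beta> + \<kappa> \<longrightarrow> \<kappa> = 0}"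
  have "finite B"
  proof (rule ccontr)
    assume "infinite B"
    then obtain s :: "nat \<Rightarrow> 'a mono" where s: "inj s" "range s \<subseteq> B"
      using infinite_countable_subset by blast
    from mono_seq_mono[OF V, of s] obtain r :: "nat \<Rightarrow> nat" where r': "strict_mono r \<and>
      (\<forall>v\<in>V. \<forall>i j. i \<le> j \<longrightarrow> lookup (s (r i)) v \<le> lookup (s (r j)) v)" ..
    note r = r'[THEN conjunct1] r'[THEN conjunct2]
    have sB: "s i \<in> B" "s i \<in> monomials V" for i
      using s(2) L unfolding B_def by auto
    have "lookup (s (r 0)) v \<le> lookup (s (r 1)) v" for v
    proof (cases "v \<in> V")
      case False
      then have "v \<notin> keys (s (r 0))" using sB(2)[of "r 0"] by (auto simp: monomials_def)
      then show ?thesis by (simp add: in_keys_iff)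
    qed (use r(2) in auto)
    from mono_le_imp_add[OF this] obtain \<kappa> where \<kappa>: "s (r 1) = s (r 0) + \<kappa>" by blast
    then have "\<kappa> = 0" using sB(1)[of "r 0"] sB(1)[of "r 1"] unfolding B_def by blast
    then have "r 1 = r 0" using \<kappa> s(1) by (simp add: inj_eq)
    then show False using strict_monoD[OF r(1), of 0 1] by simp
  qed
  moreover have "B \<subseteq> L" by (auto simp: B_def)
  \<comment> \<open>Splitting off a nontrivial cofactor lowers the total degree, so a minimal
    divisor is reached.\<close>
  moreover have "\<exists>\<beta>\<in>B. \<exists>\<kappa>. \<mu> = \<beta> + \<kappa>" if "\<mu> \<in> L" for \<mu>
    using that
  proof (induction "weight V \<mu>" arbitrary: \<mu> rule: less_induct)
    case less
    show ?case
    proof (cases "\<mu> \<in> B")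
      case True
      then show ?thesis by (metis add.right_neutral)
    next
      case False
      then obtain \<beta> \<kappa> where b: "\<beta> \<in> L" "\<mu> = \<beta> + \<kappa>" "\<kappa> \<noteq> 0"
        using less.prems unfolding B_def by blast
      have "\<kappa> \<in> monomials V" using less.prems L b(2) by auto
      moreover obtain v where v: "v \<in> keys \<kappa>" using b(3) by (metis all_not_in_conv keys_eq_empty)
      ultimately have "v \<in> V" by (auto simp: monomials_def)
      then have "lookup \<kappa> v \<le> weight V \<kappa>"
        using V unfolding weight_def by (intro member_le_sum) auto
      moreover have "lookup \<kappa> v > 0" using v by (simp add: in_keys_iff)
      ultimately have "weight V \<kappa> > 0" by simp
      then obtain \<beta>' \<kappa>' where "\<beta>' \<in> B" "\<beta> = \<beta>' + \<kappa>'"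
        using less.hyps[of \<beta>] b by (auto simp: weight_add)
      then show ?thesis using b(2) by (metis add.assoc)
    qed
  qed
  ultimately show ?thesis by blast
qed

section \<open>Ideals and their leading monomials\<close>

text \<open>The polynomial type allows every element of its index type as a variable, so an ideal of
  the polynomial ring in the variables \<open>V\<close> is described as a subset of
  \<open>polys V\<close>.\<close>

definition ideal_in :: "'v set \<Rightarrow> 'v mpoly set \<Rightarrow> bool" where
  "ideal_in V I \<longleftrightarrow> I \<subseteq> polys V \<and> 0 \<in> I \<and> (\<forall>F\<in>I. \<forall>H\<in>I. F + H \<in> I) \<and> (\<forall>F\<in>I. \<forall>H\<in>polys V. H * F \<in> I)"

lemma ideal_inI:
  assumes "I \<subseteq> polys V" "0 \<in> I" "\<And>F H. F \<in> I \<Longrightarrow> H \<in> I \<Longrightarrow> F + H \<in> I"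
    "\<And>F H. F \<in> I \<Longrightarrow> H \<in> polys V \<Longrightarrow> H * F \<in> I"
  shows "ideal_in V I"
  using assms unfolding ideal_in_def by blast

context
  fixes V :: "'v set" and I
  assumes I: "ideal_in V I"
begin

lemma ideal_polys: "F \<in> I \<Longrightarrow> F \<in> polys V"
  using I by (auto simp: ideal_in_def)

lemma ideal_zero: "0 \<in> I"
  using I by (auto simp: ideal_in_def)

lemma ideal_add: "F \<in> I \<Longrightarrow> H \<in> I \<Longrightarrow> F + H \<in> I"
  using I by (auto simp: ideal_in_def)

lemma ideal_mult: "F \<in> I \<Longrightarrow> H \<in> polys V \<Longrightarrow> H * F \<in> I"
  using I by (auto simp: ideal_in_def)

lemma ideal_scale: "F \<in> I \<Longrightarrow> const c * F \<in> I"
  by (simp add: ideal_mult)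

lemma ideal_uminus: "F \<in> I \<Longrightarrow> - F \<in> I"
  using ideal_scale[of F "-1"] by (simp add: const_simps)

lemma ideal_diff: "F \<in> I \<Longrightarrow> H \<in> I \<Longrightarrow> F - H \<in> I"
  using ideal_add[of F "- H"] ideal_uminus by simp

lemma ideal_sum: "(\<And>i. i \<in> J \<Longrightarrow> F i \<in> I) \<Longrightarrow> sum F J \<in> I"
  by (induction J rule: infinite_finite_induct) (auto intro: ideal_add ideal_zero)

end

text \<open>The singleton rows compare each exponent separately and thereby make the order total on
  the monomials in \<open>V\<close>.\<close>

locale monomial_order =
  fixes V :: "'v set" and ws :: "'v set list"
  assumes finite_V: "finite V" and singles: "v \<in> V \<Longrightarrow> {v} \<in> set ws"
begin

abbreviation lt (infix "\<prec>" 50) where "\<mu> \<prec> \<nu> \<equiv> mless ws \<mu> \<nu>"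

lemma total:
  assumes "\<mu> \<in> monomials V" "\<nu> \<in> monomials V" "\<mu> \<noteq> \<nu>"
  shows "\<mu> \<prec> \<nu> \<or> \<nu> \<prec> \<mu>"
proof (rule ccontr)
  assume n: "\<not> (\<mu> \<prec> \<nu> \<or> \<nu> \<prec> \<mu>)"
  have "lookup \<mu> v = lookup \<nu> v" for v
  proof (cases "v \<in> V")
    case True
    then show ?thesis using mless_total[of ws \<mu> \<nu> "{v}"] n singles by (auto simp: weight_def)
  next
    case False
    then have "v \<notin> keys \<mu>" "v \<notin> keys \<nu>" using assms(1,2) by (auto simp: monomials_def)
    then show ?thesis by (simp add: in_keys_iff)
  qed
  then show False using assms(3) by (auto intro: poly_mapping_eqI)
qed

lemma exists_max:
  assumes "finite B" "B \<noteq> {}" "B \<subseteq> monomials V"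
  shows "\<exists>\<mu>\<in>B. \<forall>\<nu>\<in>B. \<nu> \<prec> \<mu> \<or> \<nu> = \<mu>"
  using assms
proof (induction rule: finite_ne_induct)
  case (insert \<mu> B)
  then obtain \<beta> where \<beta>: "\<beta> \<in> B" "\<forall>\<nu>\<in>B. \<nu> \<prec> \<beta> \<or> \<nu> = \<beta>" by auto
  consider "\<mu> \<prec> \<beta>" | "\<beta> \<prec> \<mu>" | "\<mu> = \<beta>"
    using total[of \<mu> \<beta>] insert.prems \<beta>(1) by auto
  then show ?case
  proof cases
    case 2
    then show ?thesis using \<beta> mless_trans by (intro bexI[of _ \<mu>]) blast+
  qed (use \<beta> in auto)
qed simp

lemma exists_lead: "F \<in> polys V \<Longrightarrow> F \<noteq> 0 \<Longrightarrow> \<exists>\<mu>. is_lead ws F \<mu>"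
  using exists_max[of "keys F"] by (auto simp: is_lead_def polys_def)

lemma leads_add:
  assumes "ideal_in V I" "\<mu> \<in> leads ws I" "\<kappa> \<in> monomials V"
  shows "\<mu> + \<kappa> \<in> leads ws I"
proof -
  from assms(2) obtain F where F: "F \<in> I" "is_lead ws F \<mu>" by (auto simp: leads_def)
  have "single \<kappa> 1 * F \<in> I" using assms F by (intro ideal_mult) auto
  moreover have "is_lead ws (single \<kappa> 1 * F) (\<kappa> + \<mu>)"
    using F(2) keys_single_mult[of \<kappa> 1 F] lookup_single_mult_add[of \<kappa> 1 F \<mu>]
    by (fastforce simp: is_lead_def mless_add lookup_eq_zero_in_keys_contradict in_keys_iff[of "\<kappa> + \<mu>"] in_keys_iff[of \<mu>])
  ultimately show ?thesis by (auto simp: leads_def add.commute)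
qed

text \<open>Subtracting a multiple of an element of \<open>I\<close> with the same leading monomial
  leaves an element of \<open>J\<close> that is zero or has a smaller leading monomial; well-founded
  induction brings it into \<open>I\<close>.\<close>

lemma leads_subset_imp_subset:
  assumes I: "ideal_in V I" and J: "ideal_in V J" and "I \<subseteq> J" and leads: "leads ws J \<subseteq> leads ws I"
  shows "J \<subseteq> I"
proof -
  have "\<forall>F\<in>J. is_lead ws F \<mu> \<longrightarrow> F \<in> I" for \<mu>
  proof (induction \<mu> rule: wf_induct_rule[OF wf_mless[of ws]])
    case (1 \<mu>)
    show ?case
    proof (intro ballI impI)
      fix F assume F: "F \<in> J" "is_lead ws F \<mu>"
      then obtain H where H: "H \<in> I" "is_lead ws H \<mu>" using leads by (auto simp: leads_def)
      define c where "c = lookup F \<mu> / lookup H \<mu>"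
      define D where "D = F - const c * H"
      have D: "D \<in> J" unfolding D_def
        using F(1) H(1) assms(3) by (intro ideal_diff[OF J] ideal_scale[OF J]) auto
      have "lookup D \<mu> = 0"
        using H(2) by (auto simp: D_def lookup_minus c_def is_lead_def in_keys_iff)
      then have kD: "\<nu> \<prec> \<mu>" if "\<nu> \<in> keys D" for \<nu>
      proof -
        have "\<nu> \<noteq> \<mu>" using that \<open>lookup D \<mu> = 0\<close> by (auto simp: in_keys_iff)
        moreover have "\<nu> \<in> keys F \<or> \<nu> \<in> keys H"
          using that by (auto simp: D_def lookup_minus in_keys_iff)
        ultimately show ?thesis using F(2) H(2) by (auto simp: is_lead_def)
      qed
      have "D \<in> I"
      proof (cases "D = 0")
        case False
        then obtain \<nu> where \<nu>: "is_lead ws D \<nu>" using exists_lead ideal_polys[OF J D] by blast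
        then have "\<nu> \<prec> \<mu>" using kD by (auto simp: is_lead_def)
        then show ?thesis using 1 \<nu> D by auto
      qed (simp add: ideal_zero[OF I])
      then have "D + const c * H \<in> I" using H(1) by (intro ideal_add[OF I] ideal_scale[OF I])
      then show "F \<in> I" by (simp add: D_def)
    qed
  qed
  then show ?thesis
    using exists_lead ideal_polys[OF J] ideal_zero[OF I] by blast
qed

text \<open>By Dickson's lemma the leading monomials of all the ideals together are generated by
  finitely many. These occur at a finite stage \<open>n\<close>, so the ideals of this stage and the
  next have the same leading monomials and coincide.\<close>

lemma ideal_chain_stable:
  assumes I: "\<And>i. ideal_in V (I i)" and mono: "\<And>i. I i \<subseteq> I (Suc i)"
  shows "\<exists>n. I (Suc n) = I (n :: nat)"
proof -
  have mono': "I i \<subseteq> I j" if "i \<le> j" for i j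
    using that mono by (rule lift_Suc_mono_le[rotated])
  then have lmono: "leads ws (I i) \<subseteq> leads ws (I j)" if "i \<le> j" for i j
    using that by (fastforce simp: leads_def)
  have lV: "leads ws (I i) \<subseteq> monomials V" for i
    using ideal_polys[OF I] by (auto simp: leads_def is_lead_def dest: polysD)
  let ?U = "\<Union>i. leads ws (I i)"
  have "?U \<subseteq> monomials V" using lV by blast
  from Dickson[OF finite_V this]
  obtain B where B': "finite B \<and> B \<subseteq> ?U \<and> (\<forall>\<mu>\<in>?U. \<exists>\<beta>\<in>B. \<exists>\<kappa>. \<mu> = \<beta> + \<kappa>)" ..
  note B = B'[THEN conjunct1] B'[THEN conjunct2, THEN conjunct1] B'[THEN conjunct2, THEN conjunct2]
  have "\<exists>n. B \<subseteq> leads ws (I n)"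
    using B(1,2)
  proof (induction B)
    case (insert \<beta> B)
    then obtain n i where "B \<subseteq> leads ws (I n)" "\<beta> \<in> leads ws (I i)" by auto
    then have "insert \<beta> B \<subseteq> leads ws (I (max n i))"
      using lmono[of n "max n i"] lmono[of i "max n i"] by auto
    then show ?case ..
  qed auto
  then obtain n where n: "B \<subseteq> leads ws (I n)" ..
  have "leads ws (I (Suc n)) \<subseteq> leads ws (I n)"
  proof
    fix \<mu> assume \<mu>: "\<mu> \<in> leads ws (I (Suc n))"
    then obtain \<beta> \<kappa> where b: "\<beta> \<in> B" "\<mu> = \<beta> + \<kappa>" using B(3) by blast
    have "\<kappa> \<in> monomials V" using \<mu> lV[of "Suc n"] b(2) by auto
    then show "\<mu> \<in> leads ws (I n)" unfolding b(2) using b(1) n by (intro leads_add I) auto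
  qed
  then have "I (Suc n) \<subseteq> I n" by (rule leads_subset_imp_subset[OF I I mono])
  then show ?thesis using mono by blast
qed

end

section \<open>Generic constancy of leading monomials\<close>

text \<open>Polynomials in \<open>V\<close> whose coefficients are functions of a parameter. The
  finite set \<open>B\<close>, common to all parameters, keeps the degree bounded.\<close>

definition families :: "'v set \<Rightarrow> ('x \<Rightarrow> complex) set \<Rightarrow> ('x \<Rightarrow> 'v mpoly) set" where
  "families V X = {P. (\<exists>B. finite B \<and> B \<subseteq> monomials V \<and> (\<forall>x. keys (P x) \<subseteq> B)) \<and>
    (\<forall>\<mu>. (\<lambda>x. lookup (P x) \<mu>) \<in> function_algebra X)}"

lemma families_polys: "P \<in> families V X \<Longrightarrow> P x \<in> polys V"
  by (fastforce simp: families_def polys_def)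

lemma families_lookup: "P \<in> families V X \<Longrightarrow> (\<lambda>x. lookup (P x) \<mu>) \<in> function_algebra X"
  by (simp add: families_def)

lemma families_single:
  assumes "\<mu> \<in> monomials V" "f \<in> function_algebra X"
  shows "(\<lambda>x. single \<mu> (f x)) \<in> families V X"
proof -
  have "(\<lambda>x. lookup (single \<mu> (f x)) \<nu>) \<in> function_algebra X" for \<nu>
    using assms(2) by (cases "\<mu> = \<nu>") (auto simp: lookup_single_not_eq intro: function_algebra.const)
  moreover have "keys (single \<mu> (f x)) \<subseteq> {\<mu>}" for x by simp
  ultimately show ?thesis using assms(1) unfolding families_def by blast
qed

lemma families_scalar: "f \<in> function_algebra X \<Longrightarrow> (\<lambda>x. const (f x)) \<in> families V X"
  unfolding const_def by (rule families_single) auto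

lemma families_add:
  assumes "P \<in> families V X" "Q \<in> families V X"
  shows "(\<lambda>x. P x + Q x) \<in> families V X"
proof -
  obtain B C where B: "finite B" "B \<subseteq> monomials V" "\<And>x. keys (P x) \<subseteq> B"
    and C: "finite C" "C \<subseteq> monomials V" "\<And>x. keys (Q x) \<subseteq> C"
    using assms unfolding families_def by blast
  have "finite (B \<union> C) \<and> B \<union> C \<subseteq> monomials V \<and> (\<forall>x. keys (P x + Q x) \<subseteq> B \<union> C)"
    using B C Poly_Mapping.keys_add by fast
  moreover have "(\<lambda>x. lookup (P x + Q x) \<mu>) \<in> function_algebra X" for \<mu>
    unfolding lookup_add using assms by (intro function_algebra.add families_lookup)
  ultimately show ?thesis unfolding families_def by blast
qed

lemma families_const: "F \<in> polys V \<Longrightarrow> (\<lambda>_. F) \<in> families V X"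
  unfolding families_def polys_def by (auto intro: function_algebra.const intro!: exI[of _ "keys F"])

lemma families_sum:
  "(\<And>i. i \<in> I \<Longrightarrow> P i \<in> families V X) \<Longrightarrow> (\<lambda>x. \<Sum>i\<in>I. P i x) \<in> families V X"
  by (induction I rule: infinite_finite_induct) (simp_all add: families_const families_add)

lemma families_expand:
  assumes "P \<in> families V X"
  shows "\<exists>B. finite B \<and> B \<subseteq> monomials V \<and> P = (\<lambda>x. \<Sum>\<mu>\<in>B. single \<mu> (lookup (P x) \<mu>))"
proof -
  obtain B where B: "finite B" "B \<subseteq> monomials V" "\<And>x. keys (P x) \<subseteq> B"
    using assms unfolding families_def by blast
  have "P = (\<lambda>x. \<Sum>\<mu>\<in>B. single \<mu> (lookup (P x) \<mu>))"
    by (rule ext, rule poly_expand[OF B(1) B(3)])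
  then show ?thesis using B by blast
qed

lemma families_mult:
  assumes "P \<in> families V X" "Q \<in> families V X"
  shows "(\<lambda>x. P x * Q x) \<in> families V X"
proof -
  obtain B where B: "B \<subseteq> monomials V" "P = (\<lambda>x. \<Sum>\<mu>\<in>B. single \<mu> (lookup (P x) \<mu>))"
    using families_expand[OF assms(1)] by blast
  obtain C where C: "C \<subseteq> monomials V" "Q = (\<lambda>x. \<Sum>\<nu>\<in>C. single \<nu> (lookup (Q x) \<nu>))"
    using families_expand[OF assms(2)] by blast
  have "(\<lambda>x. P x * Q x) = (\<lambda>x. \<Sum>\<mu>\<in>B. \<Sum>\<nu>\<in>C. single (\<mu> + \<nu>) (lookup (P x) \<mu> * lookup (Q x) \<nu>))"
    by (rule ext, subst B(2), subst C(2)) (simp add: sum_product mult_single)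
  also have "\<dots> \<in> families V X"
    using B(1) C(1) assms
    by (intro families_sum families_single function_algebra.mult families_lookup) auto
  finally show ?thesis .
qed

lemma families_diff:
  assumes "P \<in> families V X" "Q \<in> families V X"
  shows "(\<lambda>x. P x - Q x) \<in> families V X"
  using families_add[OF assms(1) families_mult[OF families_const[OF polys_const[of "-1"]] assms(2)]]
  by (simp add: const_simps)

lemma families_prod:
  "(\<And>i. i \<in> I \<Longrightarrow> P i \<in> families V X) \<Longrightarrow> (\<lambda>x. \<Prod>i\<in>I. P i x) \<in> families V X"
  by (induction I rule: infinite_finite_induct) (simp_all add: families_const families_mult)

lemma families_power: "P \<in> families V X \<Longrightarrow> (\<lambda>x. P x ^ k) \<in> families V X"
  by (induction k) (simp_all add: families_const families_mult)

text \<open>\<open>prime\<close> says that \<open>Z\<close> is irreducible. \<open>extend\<close>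
  says that each fibre consists of values of global sections; this excludes fibres that jump up at a
  special point in a way no section detects.\<close>

locale ideal_family = monomial_order V ws for V :: "'v set" and ws +
  fixes X :: "('x \<Rightarrow> complex) set" and Z :: "'x set" and I :: "'x \<Rightarrow> 'v mpoly set"
  assumes Z_nonempty: "Z \<noteq> {}"
    and prime: "\<And>f h. f \<in> function_algebra X \<Longrightarrow> h \<in> function_algebra X \<Longrightarrow>
      \<forall>x\<in>Z. f x * h x = 0 \<Longrightarrow> (\<forall>x\<in>Z. f x = 0) \<or> (\<forall>x\<in>Z. h x = 0)"
    and ideal: "\<And>x. x \<in> Z \<Longrightarrow> ideal_in V (I x)"
    and extend: "\<And>x F. x \<in> Z \<Longrightarrow> F \<in> I x \<Longrightarrow> \<exists>P\<in>families V X. P x = F \<and> (\<forall>y\<in>Z. P y \<in> I y)"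
begin

definition sections :: "('x \<Rightarrow> 'v mpoly) set" where
  "sections = {P \<in> families V X. \<forall>y\<in>Z. P y \<in> I y}"

text \<open>Up to denominators, the leading monomials of the ideal that the sections generate over
  the function field of \<open>Z\<close>: the coefficient of the monomial may vanish at some points
  of \<open>Z\<close>, but larger monomials are absent at all of them.\<close>

definition generic_leads :: "'v mono set" where
  "generic_leads = {\<mu>. \<exists>P\<in>sections. (\<exists>x\<in>Z. \<mu> \<in> keys (P x)) \<and> (\<forall>x\<in>Z. \<forall>\<nu>\<in>keys (P x). \<nu> \<prec> \<mu> \<or> \<nu> = \<mu>)}"

lemma generic_leads_monomials: "generic_leads \<subseteq> monomials V"
  by (auto simp: generic_leads_def sections_def dest: families_polys intro: polysD)

text \<open>If the section is nonzero somewhere on \<open>Z\<close>, the largest monomial occurring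
  in it over \<open>Z\<close> is a generic leading monomial by definition.\<close>

lemma sections_zero:
  assumes P: "P \<in> sections" and disj: "\<And>x. x \<in> Z \<Longrightarrow> keys (P x) \<inter> generic_leads = {}" and "x \<in> Z"
  shows "P x = 0"
proof (rule ccontr)
  assume nz: "P x \<noteq> 0"
  let ?S = "\<Union>y\<in>Z. keys (P y)"
  obtain B where B: "finite B" "B \<subseteq> monomials V" "\<And>x. keys (P x) \<subseteq> B"
    using P unfolding sections_def families_def by blast
  have "?S \<subseteq> B" using B(3) by blast
  then have "finite ?S" "?S \<subseteq> monomials V" using B by (auto intro: finite_subset)
  moreover have "?S \<noteq> {}" using nz \<open>x \<in> Z\<close> by (auto simp: keys_eq_empty)
  ultimately obtain \<mu> where "\<mu> \<in> ?S" "\<forall>\<nu>\<in>?S. \<nu> \<prec> \<mu> \<or> \<nu> = \<mu>" using exists_max[of ?S] by blast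
  then have "\<mu> \<in> generic_leads" "\<exists>y\<in>Z. \<mu> \<in> keys (P y)" using P unfolding generic_leads_def by blast+
  then show False using disj by blast
qed

text \<open>\<open>N\<close> is a normal form of \<open>a\<^sup>k \<mu>\<close> modulo the ideals: only powers of the
  one function \<open>a\<close> are ever divided by.\<close>

definition normal_form :: "('x \<Rightarrow> complex) \<Rightarrow> 'v mono \<Rightarrow> nat \<Rightarrow> ('x \<Rightarrow> 'v mpoly) \<Rightarrow> bool" where
  "normal_form a \<mu> k N \<longleftrightarrow> N \<in> families V X \<and>
    (\<forall>y\<in>Z. single \<mu> (a y ^ k) - N y \<in> I y \<and> keys (N y) \<inter> generic_leads = {} \<and>
      (\<forall>\<nu>\<in>keys (N y). \<nu> \<prec> \<mu> \<or> \<nu> = \<mu>)) \<and>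
    (\<mu> \<notin> generic_leads \<longrightarrow> (\<forall>y\<in>Z. N y = single \<mu> (a y ^ k)))"

lemma const_mult_single: "const c * single \<mu> b = single \<mu> (c * b)"
  by (simp add: const_def mult_single)

text \<open>Multiplying by a further power of \<open>a\<close> keeps every clause; this lets
  finitely many normal forms share one exponent.\<close>

lemma normal_form_mono:
  assumes a: "a \<in> function_algebra X" and N: "normal_form a \<mu> k N" and "k \<le> k'"
  shows "normal_form a \<mu> k' (\<lambda>y. const (a y ^ (k' - k)) * N y)"
proof -
  have pow: "a y ^ (k' - k) * a y ^ k = a y ^ k'" for y
    using \<open>k \<le> k'\<close> by (simp flip: power_add)
  have "single \<mu> (a y ^ k') - const (a y ^ (k' - k)) * N y =
    const (a y ^ (k' - k)) * (single \<mu> (a y ^ k) - N y)" for y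
    by (simp add: right_diff_distrib const_mult_single pow)
  note eq = this
  let ?N = "\<lambda>y. const (a y ^ (k' - k)) * N y"
  have fam: "?N \<in> families V X"
    using N a by (intro families_mult families_scalar function_algebra_power) (simp_all add: normal_form_def)
  have I': "single \<mu> (a y ^ k') - ?N y \<in> I y" if "y \<in> Z" for y
    unfolding eq using N that by (intro ideal_scale[OF ideal]) (simp_all add: normal_form_def)
  have keys': "\<nu> \<in> keys (N y)" if "\<nu> \<in> keys (?N y)" for y \<nu>
    using that keys_const_mult by blast
  have "keys (?N y) \<inter> generic_leads = {}" "\<forall>\<nu>\<in>keys (?N y). \<nu> \<prec> \<mu> \<or> \<nu> = \<mu>" if "y \<in> Z" for y
    using keys' N that unfolding normal_form_def by blast+
  moreover have "?N y = single \<mu> (a y ^ k')" if "y \<in> Z" "\<mu> \<notin> generic_leads" for y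
    using N that by (simp add: normal_form_def const_mult_single pow)
  ultimately show ?thesis using fam I' unfolding normal_form_def by blast
qed

lemma normal_form_common:
  assumes a: "a \<in> function_algebra X" and "finite B" and "\<And>\<mu>. \<mu> \<in> B \<Longrightarrow> \<exists>k N. normal_form a \<mu> k N"
  shows "\<exists>K N. \<forall>\<mu>\<in>B. normal_form a \<mu> K (N \<mu>)"
proof -
  obtain k where k: "\<And>\<mu>. \<mu> \<in> B \<Longrightarrow> \<exists>N. normal_form a \<mu> (k \<mu>) N" using assms(3) by metis
  have "\<exists>N. normal_form a \<mu> (sum k B) N" if "\<mu> \<in> B" for \<mu>
    using k[OF that] normal_form_mono[OF a] member_le_sum[of \<mu> B k] that assms(2) by blast
  then show ?thesis by metis
qed

text \<open>Here \<open>a\<close> is the product of the leading coefficients of finitely many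
  sections whose leading monomials generate \<open>generic_leads\<close>. Where \<open>a\<close> is
  nonzero, these sections produce every generic leading monomial in the fibre. Conversely, a fibre
  element with another leading monomial would reduce to a nonzero fibre element free of generic
  leading monomials, which \<open>reduced_zero\<close> excludes.\<close>

lemma leads_generically_constant:
  "\<exists>a\<in>function_algebra X. (\<exists>x\<in>Z. a x \<noteq> 0) \<and> (\<forall>x\<in>Z. a x \<noteq> 0 \<longrightarrow> leads ws (I x) = generic_leads)"
proof -
  from Dickson[OF finite_V generic_leads_monomials]
  obtain B where B': "finite B \<and> B \<subseteq> generic_leads \<and> (\<forall>\<mu>\<in>generic_leads. \<exists>\<beta>\<in>B. \<exists>\<kappa>. \<mu> = \<beta> + \<kappa>)" ..
  note B = B'[THEN conjunct1] B'[THEN conjunct2, THEN conjunct1] B'[THEN conjunct2, THEN conjunct2]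
  have "\<forall>\<beta>\<in>B. \<exists>P. P \<in> sections \<and> (\<exists>x\<in>Z. \<beta> \<in> keys (P x)) \<and> (\<forall>x\<in>Z. \<forall>\<nu>\<in>keys (P x). \<nu> \<prec> \<beta> \<or> \<nu> = \<beta>)"
    using B(2) unfolding generic_leads_def by blast
  from bchoice[OF this] obtain f where f': "\<forall>\<beta>\<in>B. f \<beta> \<in> sections \<and>
    (\<exists>x\<in>Z. \<beta> \<in> keys (f \<beta> x)) \<and> (\<forall>x\<in>Z. \<forall>\<nu>\<in>keys (f \<beta> x). \<nu> \<prec> \<beta> \<or> \<nu> = \<beta>)" ..
  then have f: "f \<beta> \<in> families V X" "\<And>x. x \<in> Z \<Longrightarrow> f \<beta> x \<in> I x" "\<exists>x\<in>Z. lookup (f \<beta> x) \<beta> \<noteq> 0"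
    "\<And>x \<nu>. x \<in> Z \<Longrightarrow> \<nu> \<in> keys (f \<beta> x) \<Longrightarrow> \<nu> \<prec> \<beta> \<or> \<nu> = \<beta>" if "\<beta> \<in> B" for \<beta>
    using that unfolding sections_def lookup_not_eq_zero_eq_in_keys by auto
  define lc where "lc \<beta> x = lookup (f \<beta> x) \<beta>" for \<beta> x
  have lc: "lc \<beta> \<in> function_algebra X" if "\<beta> \<in> B" for \<beta>
    using families_lookup[OF f(1)[OF that], of \<beta>] by (simp add: lc_def[abs_def])
  define a where "a = (\<lambda>x. \<Prod>\<beta>\<in>B. lc \<beta> x)"
  have a: "a \<in> function_algebra X"
    unfolding a_def using lc by (intro function_algebra_prod)
  \<comment> \<open>Irreducibility of \<open>Z\<close> enters: each factor is nonzero somewhere on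
    \<open>Z\<close>, hence so is the product.\<close>
  have a_nz: "\<exists>x\<in>Z. a x \<noteq> 0"
  proof -
    have "\<exists>x\<in>Z. (\<Prod>\<beta>\<in>C. lc \<beta> x) \<noteq> 0" if "finite C" "C \<subseteq> B" for C
      using that
    proof (induction C)
      case (insert \<beta> C)
      then have "\<not> (\<forall>x\<in>Z. (\<Prod>\<beta>\<in>C. lc \<beta> x) = 0)" "\<not> (\<forall>x\<in>Z. lc \<beta> x = 0)"
        using f(3)[of \<beta>] by (auto simp: lc_def)
      moreover have "lc \<beta> \<in> function_algebra X" "(\<lambda>x. \<Prod>\<beta>\<in>C. lc \<beta> x) \<in> function_algebra X"
        using insert.prems lc by (auto intro!: function_algebra_prod)
      ultimately have "\<not> (\<forall>x\<in>Z. lc \<beta> x * (\<Prod>\<beta>\<in>C. lc \<beta> x) = 0)"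
        using prime[of "lc \<beta>" "\<lambda>x. \<Prod>\<beta>\<in>C. lc \<beta> x"] by blast
      then show ?case using insert.hyps by simp
    qed (use Z_nonempty in auto)
    then show ?thesis using B(1) unfolding a_def by blast
  qed
  have nf: "\<exists>k N. normal_form a \<mu> k N" if "\<mu> \<in> monomials V" for \<mu>
    using that
  proof (induction \<mu> rule: wf_induct_rule[OF wf_mless[of ws]])
    case (1 \<mu>)
    show ?case
    proof (cases "\<mu> \<in> generic_leads")
      case False
      have "normal_form a \<mu> 0 (\<lambda>y. single \<mu> 1)"
        using False 1(2) ideal_zero[OF ideal]
        by (auto simp: normal_form_def intro!: families_single function_algebra.const)
      then show ?thesis by blast
    next
      case True
      then obtain \<beta> \<kappa> where \<mu>: "\<beta> \<in> B" "\<mu> = \<beta> + \<kappa>" using B(3) by blast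
      have \<kappa>: "\<kappa> \<in> monomials V" using 1(2) \<mu>(2) by simp
      \<comment> \<open>Since \<open>a\<close> is \<open>rest\<close> times the leading coefficient
        of \<open>f \<beta>\<close>, the monomial \<mu> cancels in \<open>P\<close> without any
        division.\<close>
      define rest where "rest = (\<lambda>y. \<Prod>\<beta>\<in>B - {\<beta>}. lc \<beta> y)"
      have rest: "rest \<in> function_algebra X"
        unfolding rest_def using lc by (intro function_algebra_prod) auto
      have a_rest: "a y = rest y * lc \<beta> y" for y
        unfolding a_def rest_def using B(1) \<mu>(1) by (subst prod.remove[of _ \<beta>]) auto
      define P where "P = (\<lambda>y. single \<mu> (a y) - single \<kappa> (rest y) * f \<beta> y)"
      have P: "P \<in> families V X"
        unfolding P_def using a rest f(1) \<mu>(1) \<kappa> 1(2)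
        by (intro families_diff families_mult families_single) auto
      have P_keys: "\<nu> \<prec> \<mu>" if "y \<in> Z" "\<nu> \<in> keys (P y)" for y \<nu>
      proof -
        have "lookup (P y) \<mu> = 0"
          using lookup_single_mult_add[of \<kappa> "rest y" "f \<beta> y" \<beta>]
          by (simp add: P_def lookup_minus \<mu>(2) add.commute a_rest lc_def)
        then have "\<nu> \<noteq> \<mu>" using that(2) by (auto simp: in_keys_iff)
        moreover from this have "\<nu> \<in> keys (single \<kappa> (rest y) * f \<beta> y)"
          using that(2) by (auto simp: P_def in_keys_iff lookup_minus lookup_single when_def split: if_splits)
        then obtain \<nu>' where "\<nu> = \<kappa> + \<nu>'" "\<nu>' \<in> keys (f \<beta> y)"
          using keys_single_mult[of \<kappa> "rest y" "f \<beta> y"] by blast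
        ultimately show ?thesis
          using f(4)[OF \<mu>(1) that(1), of \<nu>'] by (auto simp: \<mu>(2) add.commute[of \<beta>] mless_add)
      qed
      obtain C where C: "finite C" "C \<subseteq> monomials V" "\<And>x. keys (P x) \<subseteq> C"
        using P unfolding families_def by blast
      \<comment> \<open>Outside \<open>Z\<close> the family \<open>P\<close> may contain other
        monomials; over \<open>Z\<close> only those below \<mu> occur, and for these the induction
        provides normal forms.\<close>
      define D where "D = {\<nu> \<in> C. \<nu> \<prec> \<mu>}"
      have D: "finite D" "\<And>\<nu>. \<nu> \<in> D \<Longrightarrow> \<exists>k N. normal_form a \<nu> k N"
        using C(1,2) 1 by (auto simp: D_def)
      have PD: "P y = (\<Sum>\<nu>\<in>D. single \<nu> (lookup (P y) \<nu>))" if "y \<in> Z" for y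
        using P_keys[OF that] C(3)[of y] by (intro poly_expand D) (auto simp: D_def)
      obtain K N where N: "\<And>\<nu>. \<nu> \<in> D \<Longrightarrow> normal_form a \<nu> K (N \<nu>)"
        using normal_form_common[OF a D] by blast
      define N' where "N' = (\<lambda>y. \<Sum>\<nu>\<in>D. const (lookup (P y) \<nu>) * N \<nu> y)"
      have "N' \<in> families V X"
        unfolding N'_def using N P
        by (intro families_sum families_mult families_scalar families_lookup) (auto simp: normal_form_def)
      moreover have "single \<mu> (a y ^ Suc K) - N' y \<in> I y" if y: "y \<in> Z" for y
      proof -
        have "single \<mu> (a y ^ Suc K) = const (a y ^ K) * single \<mu> (a y)"
          unfolding const_mult_single by (simp add: mult.commute)
        also have "\<dots> = const (a y ^ K) * (single \<kappa> (rest y) * f \<beta> y) + const (a y ^ K) * P y"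
          by (simp add: P_def algebra_simps)
        also have "const (a y ^ K) * P y = (\<Sum>\<nu>\<in>D. const (lookup (P y) \<nu>) * single \<nu> (a y ^ K))"
          by (subst PD[OF y]) (simp add: sum_distrib_left const_mult_single mult.commute[of "a y ^ K"])
        finally have "single \<mu> (a y ^ Suc K) - N' y = const (a y ^ K) * (single \<kappa> (rest y) * f \<beta> y) +
          (\<Sum>\<nu>\<in>D. const (lookup (P y) \<nu>) * (single \<nu> (a y ^ K) - N \<nu> y))"
          by (simp add: N'_def right_diff_distrib sum_subtractf)
        also have "\<dots> \<in> I y"
          using f(2)[OF \<mu>(1) y] \<kappa> N y
          by (intro ideal_add[OF ideal] ideal_scale[OF ideal] ideal_mult[OF ideal] ideal_sum[OF ideal])
            (auto simp: normal_form_def)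
        finally show ?thesis .
      qed
      moreover have "\<nu> \<prec> \<mu>" "\<nu> \<notin> generic_leads" if y: "y \<in> Z" and k: "\<nu> \<in> keys (N' y)" for y \<nu>
      proof -
        obtain \<delta> where \<delta>: "\<delta> \<in> D" "\<nu> \<in> keys (const (lookup (P y) \<delta>) * N \<delta> y)"
          using k keys_sum_sub[of "\<lambda>\<nu>. const (lookup (P y) \<nu>) * N \<nu> y" D] unfolding N'_def by blast
        then have "\<nu> \<in> keys (N \<delta> y)" using keys_const_mult by blast
        then show "\<nu> \<prec> \<mu>" "\<nu> \<notin> generic_leads"
          using N[OF \<delta>(1)] y \<delta>(1) mless_trans unfolding normal_form_def D_def by blast+
      qed
      \<comment> \<open>One power of \<open>a\<close> pays for cancelling \<mu>, and
        \<open>K\<close> more for the normal forms of the remaining monomials.\<close>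
      ultimately have "normal_form a \<mu> (Suc K) N'"
        using True unfolding normal_form_def by blast
      then show ?thesis by blast
    qed
  qed
  \<comment> \<open>The section through \<open>r\<close> need not stay reduced away from
    \<open>x\<close>. Its difference \<open>D\<close> from the constant family \<open>r\<close>
    vanishes at \<open>x\<close>, so replacing \<open>D\<close> by its normal form changes nothing
    there and gives a reduced section \<open>R\<close> whose value at \<open>x\<close> is
    \<open>r\<close> times a power of \<open>a x\<close>.\<close>
  have reduced_zero: "r = 0"
    if x: "x \<in> Z" "a x \<noteq> 0" and r: "r \<in> I x" "keys r \<inter> generic_leads = {}" for x r
  proof -
    obtain P where P: "P \<in> families V X" "P x = r" "\<And>y. y \<in> Z \<Longrightarrow> P y \<in> I y"
      using extend[OF x(1) r(1)] by blast
    define D where "D = (\<lambda>y. P y - r)"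
    have D: "D \<in> families V X"
      unfolding D_def using P(1) ideal_polys[OF ideal[OF x(1)] r(1)] by (intro families_diff families_const)
    obtain C where C: "finite C" "C \<subseteq> monomials V" "\<And>x. keys (D x) \<subseteq> C"
      using D unfolding families_def by blast
    obtain K N where N: "\<And>\<nu>. \<nu> \<in> C \<Longrightarrow> normal_form a \<nu> K (N \<nu>)"
      using normal_form_common[OF a C(1)] nf C(2) by blast
    define R where "R = (\<lambda>y. const (a y ^ K) * r + (\<Sum>\<nu>\<in>C. const (lookup (D y) \<nu>) * N \<nu> y))"
    have "R \<in> families V X"
      unfolding R_def using N D a ideal_polys[OF ideal[OF x(1)] r(1)]
      by (intro families_add families_sum families_mult families_scalar families_lookup families_const
          function_algebra_power) (auto simp: normal_form_def)
    moreover have "R y \<in> I y" if y: "y \<in> Z" for y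
    proof -
      have "const (a y ^ K) * D y = (\<Sum>\<nu>\<in>C. const (lookup (D y) \<nu>) * single \<nu> (a y ^ K))"
        by (subst poly_expand[OF C(1) C(3)[of y]]) (simp add: sum_distrib_left const_mult_single mult.commute[of "a y ^ K"])
      moreover have "r = P y - D y" by (simp add: D_def)
      ultimately have "R y = const (a y ^ K) * P y -
        (\<Sum>\<nu>\<in>C. const (lookup (D y) \<nu>) * (single \<nu> (a y ^ K) - N \<nu> y))"
        by (simp add: R_def right_diff_distrib sum_subtractf)
      also have "\<dots> \<in> I y"
        by (rule ideal_diff[OF ideal[OF y] ideal_scale[OF ideal[OF y] P(3)[OF y]]],
            intro ideal_sum[OF ideal[OF y]] ideal_scale[OF ideal[OF y]])
          (use N y in \<open>simp add: normal_form_def\<close>)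
      finally show ?thesis .
    qed
    ultimately have "R \<in> sections" by (simp add: sections_def)
    moreover have "keys (R y) \<inter> generic_leads = {}" if y: "y \<in> Z" for y
    proof -
      have "keys (R y) \<subseteq> keys (const (a y ^ K) * r) \<union> keys (\<Sum>\<nu>\<in>C. const (lookup (D y) \<nu>) * N \<nu> y)"
        unfolding R_def by (rule Poly_Mapping.keys_add)
      also have "\<dots> \<subseteq> keys r \<union> (\<Union>\<nu>\<in>C. keys (const (lookup (D y) \<nu>) * N \<nu> y))"
        by (rule Un_mono[OF keys_const_mult keys_sum_sub])
      also have "\<dots> \<subseteq> keys r \<union> (\<Union>\<nu>\<in>C. keys (N \<nu> y))"
        by (intro Un_mono UN_mono order_refl keys_const_mult)
      finally have "keys (R y) \<subseteq> keys r \<union> (\<Union>\<nu>\<in>C. keys (N \<nu> y))" .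
      moreover have "keys (N \<nu> y) \<inter> generic_leads = {}" if "\<nu> \<in> C" for \<nu>
        using N[OF that] y by (simp add: normal_form_def)
      ultimately show ?thesis using r(2) by blast
    qed
    ultimately have "R x = 0" using x(1) by (rule sections_zero)
    moreover have "D x = 0" by (simp add: D_def P(2))
    ultimately have "const (a x ^ K) * r = 0" by (simp add: R_def const_simps)
    then have "a x ^ K * lookup r \<nu> = 0" for \<nu>
      by (metis lookup_const_mult lookup_zero)
    then show "r = 0" using x(2) by (intro poly_mapping_eqI) simp
  qed
  have "leads ws (I x) = generic_leads" if x: "x \<in> Z" "a x \<noteq> 0" for x
  proof
    show "generic_leads \<subseteq> leads ws (I x)"
    proof
      fix \<mu> assume \<mu>: "\<mu> \<in> generic_leads"
      then obtain \<beta> \<kappa> where b: "\<beta> \<in> B" "\<mu> = \<beta> + \<kappa>" using B(3) by blast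
      have "\<kappa> \<in> monomials V" using \<mu> generic_leads_monomials b(2) by auto
      moreover have "lc \<beta> x \<noteq> 0" using x(2) b(1) B(1) by (auto simp: a_def)
      then have "is_lead ws (f \<beta> x) \<beta>"
        using f(4)[OF b(1) x(1)] by (auto simp: is_lead_def lc_def in_keys_iff[of \<beta>])
      then have "\<beta> \<in> leads ws (I x)" using f(2)[OF b(1) x(1)] by (auto simp: leads_def)
      ultimately show "\<mu> \<in> leads ws (I x)" unfolding b(2) using ideal[OF x(1)] by (intro leads_add)
    qed
    show "leads ws (I x) \<subseteq> generic_leads"
    proof (rule subsetI, rule ccontr)
      fix \<mu> assume "\<mu> \<in> leads ws (I x)" and notin: "\<mu> \<notin> generic_leads"
      then obtain r where r: "r \<in> I x" "is_lead ws r \<mu>" by (auto simp: leads_def)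
      have rV: "keys r \<subseteq> monomials V"
        using ideal_polys[OF ideal[OF x(1)] r(1)] by (simp add: polys_def)
      obtain K N where N: "\<And>\<nu>. \<nu> \<in> keys r \<Longrightarrow> normal_form a \<nu> K (N \<nu>)"
        using normal_form_common[OF a finite_keys, of r] nf rV by blast
      define r' where "r' = (\<Sum>\<nu>\<in>keys r. const (lookup r \<nu>) * N \<nu> x)"
      have "const (a x ^ K) * r = (\<Sum>\<nu>\<in>keys r. const (lookup r \<nu>) * single \<nu> (a x ^ K))"
        by (subst poly_expand[of "keys r" r]) (simp_all add: sum_distrib_left const_mult_single mult.commute[of "a x ^ K"])
      then have "r' = const (a x ^ K) * r - (\<Sum>\<nu>\<in>keys r. const (lookup r \<nu>) * (single \<nu> (a x ^ K) - N \<nu> x))"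
        by (simp add: r'_def right_diff_distrib sum_subtractf)
      also have "\<dots> \<in> I x"
        by (rule ideal_diff[OF ideal[OF x(1)] ideal_scale[OF ideal[OF x(1)] r(1)]],
            intro ideal_sum[OF ideal[OF x(1)]] ideal_scale[OF ideal[OF x(1)]])
          (use N x(1) in \<open>simp add: normal_form_def\<close>)
      finally have "r' \<in> I x" .
      moreover have "keys r' \<inter> generic_leads = {}"
      proof -
        have "keys r' \<subseteq> (\<Union>\<nu>\<in>keys r. keys (const (lookup r \<nu>) * N \<nu> x))"
          unfolding r'_def by (rule keys_sum_sub)
        also have "\<dots> \<subseteq> (\<Union>\<nu>\<in>keys r. keys (N \<nu> x))"
          by (intro UN_mono order_refl keys_const_mult)
        finally have "keys r' \<subseteq> (\<Union>\<nu>\<in>keys r. keys (N \<nu> x))" .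
        moreover have "keys (N \<nu> x) \<inter> generic_leads = {}" if "\<nu> \<in> keys r" for \<nu>
          using N[OF that] x(1) by (simp add: normal_form_def)
        ultimately show ?thesis by blast
      qed
      ultimately have "r' = 0" using reduced_zero x by blast
      \<comment> \<open>The coefficient of \<mu> survives the reduction: up to a power of
        \<open>a\<close>, \<mu> is its own normal form, and the normal forms of smaller monomials do
        not reach up to \<mu>.\<close>
      have "lookup r' \<mu> = (\<Sum>\<nu>\<in>keys r. if \<nu> = \<mu> then lookup r \<mu> * a x ^ K else 0)"
        unfolding r'_def lookup_sum
      proof (rule sum.cong[OF refl])
        fix \<nu> assume \<nu>: "\<nu> \<in> keys r"
        show "lookup (const (lookup r \<nu>) * N \<nu> x) \<mu> = (if \<nu> = \<mu> then lookup r \<mu> * a x ^ K else 0)"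
        proof (cases "\<nu> = \<mu>")
          case True
          then show ?thesis using N[OF \<nu>] notin x(1) by (simp add: normal_form_def)
        next
          case False
          then have "\<nu> \<prec> \<mu>" using r(2) \<nu> by (auto simp: is_lead_def)
          then have "\<mu> \<notin> keys (N \<nu> x)"
            using N[OF \<nu>] x(1) mless_trans mless_irrefl unfolding normal_form_def by blast
          then show ?thesis using False by (simp add: in_keys_iff)
        qed
      qed
      also have "\<dots> \<noteq> 0"
        using r(2) x(2) by (simp add: is_lead_def in_keys_iff[of \<mu>])
      finally show False using \<open>r' = 0\<close> by simp
    qed
  qed
  then show ?thesis using a a_nz by blast
qed

end

section \<open>A weak Nullstellensatz\<close>

text \<open>Gaussian elimination: coordinate \<open>b\<close> is cleared from all other vectors with
  the help of a pivot vector \<open>t\<close>.\<close>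

lemma linear_dependence:
  fixes f :: "'s \<Rightarrow> 'b \<Rightarrow> complex"
  assumes "finite B" "finite S" "card B < card S"
  shows "\<exists>\<alpha>. (\<exists>s\<in>S. \<alpha> s \<noteq> 0) \<and> (\<forall>b\<in>B. (\<Sum>s\<in>S. \<alpha> s * f s b) = 0)"
  using assms
proof (induction B arbitrary: S f)
  case empty
  then have "S \<noteq> {}" by auto
  then show ?case by (intro exI[of _ "\<lambda>_. 1"]) auto
next
  case (insert b B)
  show ?case
  proof (cases "\<forall>s\<in>S. f s b = 0")
    case True
    obtain \<alpha> where "\<exists>s\<in>S. \<alpha> s \<noteq> 0" "\<forall>b\<in>B. (\<Sum>s\<in>S. \<alpha> s * f s b) = 0"
      using insert.IH[of S f] insert.prems insert.hyps by auto
    then show ?thesis using True by (intro exI[of _ \<alpha>]) auto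
  next
    case False
    then obtain t where t: "t \<in> S" "f t b \<noteq> 0" by blast
    let ?S = "S - {t}"
    have "card B < card ?S" using insert.prems insert.hyps t(1) by simp
    then obtain \<alpha> where \<alpha>: "\<exists>s\<in>?S. \<alpha> s \<noteq> 0"
      "\<And>b'. b' \<in> B \<Longrightarrow> (\<Sum>s\<in>?S. \<alpha> s * (f s b' - f s b / f t b * f t b')) = 0"
      using insert.IH[of ?S "\<lambda>s b'. f s b' - f s b / f t b * f t b'"] insert.prems by auto
    define r where "r = (\<Sum>s\<in>?S. \<alpha> s * f s b) / f t b"
    define \<beta> where "\<beta> = \<alpha>(t := - r)"
    have split: "(\<Sum>s\<in>S. \<beta> s * f s b') = (\<Sum>s\<in>?S. \<alpha> s * f s b') - r * f t b'" for b'
    proof -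
      have "(\<Sum>s\<in>?S. \<beta> s * f s b') = (\<Sum>s\<in>?S. \<alpha> s * f s b')"
        by (rule sum.cong) (auto simp: \<beta>_def)
      then show ?thesis using t(1) insert.prems by (subst sum.remove[of _ t]) (auto simp: \<beta>_def)
    qed
    have "(\<Sum>s\<in>S. \<beta> s * f s b') = 0" if "b' \<in> B" for b'
    proof -
      have "r * f t b' = (\<Sum>s\<in>?S. \<alpha> s * (f s b / f t b * f t b'))"
        by (simp add: r_def sum_divide_distrib sum_distrib_right mult.assoc)
      then show ?thesis using \<alpha>(2)[OF that] unfolding split
        by (simp add: right_diff_distrib sum_subtractf)
    qed
    moreover have "(\<Sum>s\<in>S. \<beta> s * f s b) = 0" unfolding split using t(2) by (simp add: r_def)
    moreover have "\<exists>s\<in>S. \<beta> s \<noteq> 0" using \<alpha>(1) by (auto simp: \<beta>_def)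
    ultimately show ?thesis by blast
  qed
qed

text \<open>The value of \<open>p\<close> at the variable \<open>v\<close>, by Horner's scheme; it
  transports roots and factorizations of univariate polynomials to the multivariate ring.\<close>

definition univariate :: "'v \<Rightarrow> complex poly \<Rightarrow> 'v mpoly" where
  "univariate v p = fold_coeffs (\<lambda>a r. const a + var v * r) p 0"

lemma univariate_zero [simp]: "univariate v 0 = 0"
  by (simp add: univariate_def)

lemma univariate_pCons: "univariate v (pCons a p) = const a + var v * univariate v p"
  by (cases "a = 0 \<and> p = 0") (auto simp: univariate_def const_simps)

lemma univariate_add: "univariate v (p + q) = univariate v p + univariate v q"
  by (induction p q rule: poly_induct2) (simp_all add: univariate_pCons const_simps algebra_simps)

lemma univariate_smult: "univariate v (smult c p) = const c * univariate v p"
  by (induction p) (simp_all add: univariate_pCons const_simps algebra_simps)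

lemma univariate_mult: "univariate v (p * q) = univariate v p * univariate v q"
  by (induction p) (simp_all add: univariate_pCons univariate_add univariate_smult const_simps algebra_simps)

lemma univariate_prod: "univariate v (prod f S) = (\<Prod>s\<in>S. univariate v (f s))"
  by (induction S rule: infinite_finite_induct)
    (simp_all add: univariate_mult one_pCons univariate_pCons const_simps)

lemma univariate_sum: "univariate v (sum f S) = (\<Sum>s\<in>S. univariate v (f s))"
  by (induction S rule: infinite_finite_induct) (simp_all add: univariate_add)

lemma polys_univariate: "v \<in> V \<Longrightarrow> univariate v p \<in> polys V"
  by (induction p) (simp_all add: univariate_pCons polys_add polys_mult)

lemma finite_bounded_monomials:
  assumes "finite V"
  shows "finite {\<mu> \<in> monomials V. \<forall>v\<in>V. lookup \<mu> v \<le> D}"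
proof (rule finite_imageD[where f = lookup])
  have "finite {f. \<forall>v. (v \<in> V \<longrightarrow> f v \<in> {..D}) \<and> (v \<notin> V \<longrightarrow> f v = (0::nat))}"
    by (rule finite_set_of_finite_funs) (use assms in auto)
  moreover have "lookup ` {\<mu> \<in> monomials V. \<forall>v\<in>V. lookup \<mu> v \<le> D} \<subseteq>
    {f. \<forall>v. (v \<in> V \<longrightarrow> f v \<in> {..D}) \<and> (v \<notin> V \<longrightarrow> f v = 0)}"
    by (auto simp: monomials_def in_keys_iff)
  ultimately show "finite (lookup ` {\<mu> \<in> monomials V. \<forall>v\<in>V. lookup \<mu> v \<le> D})"
    by (rule finite_subset[rotated])
qed (auto intro: inj_onI poly_mapping_eqI)

lemma poly_bounded_exponents:
  assumes "finite V" "F \<in> polys V"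
  shows "\<exists>D. keys F \<subseteq> {\<mu> \<in> monomials V. \<forall>v\<in>V. lookup \<mu> v \<le> D}"
proof -
  define D where "D = (\<Sum>\<mu>\<in>keys F. \<Sum>v\<in>V. lookup \<mu> v)"
  have "lookup \<mu> v \<le> D" if "\<mu> \<in> keys F" "v \<in> V" for \<mu> v
  proof -
    have "lookup \<mu> v \<le> (\<Sum>v\<in>V. lookup \<mu> v)" using that assms(1) by (intro member_le_sum) auto
    also have "\<dots> \<le> D" unfolding D_def using that by (intro member_le_sum[of \<mu> _ "\<lambda>\<mu>. \<Sum>v\<in>V. lookup \<mu> v"]) auto
    finally show ?thesis .
  qed
  then show ?thesis using assms(2) by (auto simp: polys_def)
qed

text \<open>Otherwise \<open>v - c\<close> is invertible modulo \<open>J\<close> for all of the uncountably many \<open>c\<close>.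
  As there are only countably many monomials, some of the inverses are linearly dependent, which
  yields a nonzero univariate polynomial in \<open>J\<close>; but its linear factors are invertible modulo \<open>J\<close>.\<close>

lemma exists_coordinate:
  assumes V: "finite V" and J: "ideal_in V J" and proper: "1 \<notin> J" and v: "v \<in> V"
  shows "\<exists>c. \<forall>F\<in>J. \<forall>H\<in>polys V. F + H * (var v - const c) \<noteq> 1"
proof (rule ccontr)
  assume "\<not> ?thesis"
  then have "\<forall>c. \<exists>H. H \<in> polys V \<and> (\<exists>F\<in>J. F + H * (var v - const c) = 1)" by blast
  from choice[OF this] obtain H where H': "\<forall>c. H c \<in> polys V \<and> (\<exists>F\<in>J. F + H c * (var v - const c) = 1)" ..
  then have H: "H c \<in> polys V" for c by blast
  have inv: "1 - H c * (var v - const c) \<in> J" for c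
  proof -
    from H' obtain F where "F \<in> J" "F + H c * (var v - const c) = 1" by blast
    then show ?thesis by (metis add_diff_cancel_right')
  qed
  let ?M = "\<lambda>D. {\<mu> \<in> monomials V. \<forall>v\<in>V. lookup \<mu> v \<le> D}"
  \<comment> \<open>Each \<open>H c\<close> has bounded exponents, so the uncountable set of all
    \<open>c\<close> is a union over the countably many bounds, and one of its members must be
    infinite.\<close>
  have "\<exists>D. infinite {c. keys (H c) \<subseteq> ?M D}"
  proof (rule ccontr)
    assume "\<not> ?thesis"
    then have "countable (\<Union>D. {c. keys (H c) \<subseteq> ?M D})" by (auto intro: countable_finite)
    moreover have "(\<Union>D. {c. keys (H c) \<subseteq> ?M D}) = UNIV"
      using poly_bounded_exponents[OF V H] by blast
    ultimately have "countable (UNIV :: complex set)" by simp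
    then show False using uncountable_UNIV_complex by simp
  qed
  then obtain D where D: "infinite {c. keys (H c) \<subseteq> ?M D}" ..
  \<comment> \<open>One inverse more than there are monomials forces a linear relation among the
    inverses.\<close>
  obtain S where S: "finite S" "card S = Suc (card (?M D))" "S \<subseteq> {c. keys (H c) \<subseteq> ?M D}"
    using infinite_arbitrarily_large[OF D] by blast
  obtain \<alpha> where \<alpha>: "\<exists>s\<in>S. \<alpha> s \<noteq> 0" "\<And>\<mu>. \<mu> \<in> ?M D \<Longrightarrow> (\<Sum>s\<in>S. \<alpha> s * lookup (H s) \<mu>) = 0"
    using linear_dependence[of "?M D" S "\<lambda>s. lookup (H s)"] finite_bounded_monomials[OF V] S by auto
  have rel: "(\<Sum>s\<in>S. const (\<alpha> s) * H s) = 0"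
  proof (rule poly_mapping_eqI)
    fix \<mu>
    show "lookup (\<Sum>s\<in>S. const (\<alpha> s) * H s) \<mu> = lookup 0 \<mu>"
    proof (cases "\<mu> \<in> ?M D")
      case True
      then show ?thesis using \<alpha>(2)[OF True] by (simp only: lookup_sum lookup_const_mult lookup_zero)
    next
      case False
      then have "\<mu> \<notin> keys (H s)" if "s \<in> S" for s
        using S(3) that by blast
      then have "lookup (H s) \<mu> = 0" if "s \<in> S" for s
        using that by (simp add: in_keys_iff)
      then show ?thesis by (simp add: lookup_sum)
    qed
  qed
  \<comment> \<open>Numerator of the sum of \<alpha>(s) / (X - s) over the common denominator; the
    relation says that this sum, with X read as \<open>v\<close>, is zero modulo
    \<open>J\<close>.\<close>
  define p where "p = (\<Sum>s\<in>S. smult (\<alpha> s) (\<Prod>l\<in>S - {s}. [:- l, 1:]))"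
  have lin: "univariate v [:- l, 1:] = var v - const l" for l
    by (simp add: univariate_pCons const_simps)
  have "univariate v p = (\<Sum>s\<in>S. const (\<alpha> s) * (\<Prod>l\<in>S - {s}. var v - const l) * (1 - H s * (var v - const s)))"
  proof -
    have "(\<Sum>s\<in>S. const (\<alpha> s) * (\<Prod>l\<in>S - {s}. var v - const l) * (H s * (var v - const s))) =
      (\<Sum>s\<in>S. const (\<alpha> s) * H s) * (\<Prod>l\<in>S. var v - const l)"
      unfolding sum_distrib_right
      by (intro sum.cong refl) (simp add: prod.remove[OF S(1)] mult_ac)
    then show ?thesis
      by (simp add: p_def univariate_sum univariate_smult univariate_prod lin right_diff_distrib sum_subtractf rel)
  qed
  also have "\<dots> \<in> J"
    using v inv by (intro ideal_sum[OF J] ideal_mult[OF J] polys_mult polys_prod polys_diff) auto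
  finally have pJ: "univariate v p \<in> J" .
  \<comment> \<open>At a node \<open>s\<close> with nonzero coefficient only its own summand
    survives, as all others contain the factor X - s.\<close>
  have "p \<noteq> 0"
  proof
    assume "p = 0"
    from \<alpha>(1) obtain s where s: "s \<in> S" "\<alpha> s \<noteq> 0" by blast
    have "poly p s = (\<Sum>s'\<in>S. if s' = s then \<alpha> s * (\<Prod>l\<in>S - {s}. s - l) else 0)"
      unfolding p_def poly_sum poly_smult poly_prod
      by (rule sum.cong) (use S(1) s(1) in \<open>auto intro!: prod_zero\<close>)
    also have "\<dots> = \<alpha> s * (\<Prod>l\<in>S - {s}. s - l)" using s(1) S(1) by simp
    also have "\<dots> \<noteq> 0" using s S(1) by (auto simp: prod_zero_iff)
    finally show False using \<open>p = 0\<close> by simp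
  qed
  \<comment> \<open>Linear factors are invertible modulo \<open>J\<close>, so they can be removed
    one at a time until a nonzero constant is left.\<close>
  have "1 \<in> J" if "univariate v q \<in> J" "q \<noteq> 0" for q
    using that
  proof (induction "degree q" arbitrary: q)
    case 0
    then obtain b where b: "q = [:b:]" by (metis degree_eq_zeroE)
    then have "const (1 / b) * const b \<in> J"
      using 0 by (intro ideal_scale[OF J]) (simp add: univariate_pCons)
    then show ?case using 0 b by (simp flip: const_simps(4) add: const_simps(2))
  next
    case (Suc n)
    have "\<not> constant (poly q)" using Suc.hyps(2) by (simp add: constant_degree)
    then obtain z where "poly q z = 0" using fundamental_theorem_of_algebra by blast
    then obtain q' where q': "q = [:- z, 1:] * q'" by (auto simp: poly_eq_0_iff_dvd elim: dvdE)
    have nz: "q' \<noteq> 0" using q' Suc.prems by auto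
    then have deg: "n = degree q'"
      using Suc.hyps(2) unfolding q' by (subst (asm) degree_mult_eq) auto
    have q: "univariate v q = (var v - const z) * univariate v q'"
      by (simp only: q' univariate_mult lin)
    have "univariate v q' = univariate v q' * (1 - H z * (var v - const z)) + H z * univariate v q"
      unfolding q by (simp add: algebra_simps)
    also have "\<dots> \<in> J"
      using inv H Suc.prems v by (intro ideal_add[OF J] ideal_mult[OF J]) (auto intro: polys_univariate)
    finally show ?case using Suc.hyps(1)[OF deg] nz by blast
  qed
  then show False using pJ \<open>p \<noteq> 0\<close> proper by blast
qed

text \<open>Adjoining v - c for one variable after another, with \<open>c\<close> taken from
  \<open>exists_coordinate\<close>, keeps the ideal proper. Modulo the final ideal every polynomial
  is congruent to its value at \<open>a\<close>, so a nonzero value on \<open>J\<close> would put 1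
  into that ideal.\<close>

lemma Nullstellensatz:
  assumes V: "finite V" and J: "ideal_in V J" and proper: "1 \<notin> J"
  shows "\<exists>a. \<forall>F\<in>J. eval a F = 0"
proof -
  have "\<exists>K a. ideal_in V K \<and> J \<subseteq> K \<and> 1 \<notin> K \<and> (\<forall>v\<in>U. var v - const (a v) \<in> K)" if "finite U" "U \<subseteq> V" for U
    using that
  proof (induction U)
    case empty
    then show ?case using J proper by blast
  next
    case (insert v U)
    then obtain K a where K: "ideal_in V K" "J \<subseteq> K" "1 \<notin> K" "\<forall>v\<in>U. var v - const (a v) \<in> K" by auto
    obtain c where c: "\<And>F H. F \<in> K \<Longrightarrow> H \<in> polys V \<Longrightarrow> F + H * (var v - const c) \<noteq> 1"
      using exists_coordinate[OF V K(1,3), of v] insert.prems by auto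
    define K' where "K' = {F + H * (var v - const c) | F H. F \<in> K \<and> H \<in> polys V}"
    have in_K': "F + H * (var v - const c) \<in> K'" if "F \<in> K" "H \<in> polys V" for F H
      using that unfolding K'_def by blast
    have sub: "K \<subseteq> K'" using in_K'[of _ 0] by auto
    have "ideal_in V K'"
    proof (rule ideal_inI)
      show "K' \<subseteq> polys V"
        using insert.prems ideal_polys[OF K(1)] unfolding K'_def
        by (auto intro!: polys_add polys_mult polys_diff)
      show "0 \<in> K'" using sub ideal_zero[OF K(1)] by blast
      show "F + H \<in> K'" if FH: "F \<in> K'" "H \<in> K'" for F H
      proof -
        obtain F1 F2 H1 H2 where "F = F1 + F2 * (var v - const c)" "H = H1 + H2 * (var v - const c)"
          "F1 \<in> K" "H1 \<in> K" "F2 \<in> polys V" "H2 \<in> polys V"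
          using FH unfolding K'_def by blast
        moreover from this have "F + H = (F1 + H1) + (F2 + H2) * (var v - const c)"
          by (simp only:) (simp add: algebra_simps)
        ultimately show ?thesis
          using in_K'[of "F1 + H1" "F2 + H2"] ideal_add[OF K(1)] polys_add by metis
      qed
      show "H * F \<in> K'" if FH: "F \<in> K'" "H \<in> polys V" for F H
      proof -
        obtain F1 F2 where "F = F1 + F2 * (var v - const c)" "F1 \<in> K" "F2 \<in> polys V"
          using FH(1) unfolding K'_def by blast
        moreover from this have "H * F = H * F1 + H * F2 * (var v - const c)"
          by (simp only:) (simp add: algebra_simps)
        ultimately show ?thesis
          using in_K'[of "H * F1" "H * F2"] ideal_mult[OF K(1)] polys_mult FH(2) by metis
      qed
    qed
    moreover have "1 \<notin> K'" using c unfolding K'_def by fastforce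
    moreover have "var v - const c \<in> K'" using in_K'[of 0 1] ideal_zero[OF K(1)] by simp
    ultimately show ?case
      using K(2,4) sub insert.hyps(2) by (intro exI[of _ K'] exI[of _ "a(v := c)"]) auto
  qed
  from this[OF V order_refl] obtain K a where
    K: "ideal_in V K" "J \<subseteq> K" "1 \<notin> K" "\<forall>v\<in>V. var v - const (a v) \<in> K" by blast
  have point: "F - const (eval a F) \<in> K \<and> F \<in> polys V" if "F \<in> polys V" for F
    using that
  proof (induction rule: polys_induct)
    case (mult F H)
    have "F * H - const (eval a (F * H)) =
      H * (F - const (eval a F)) + const (eval a F) * (H - const (eval a H))"
      by (simp add: ev.lin_ext_mult const_simps algebra_simps)
    then show ?case
      using mult ideal_add[OF K(1)] ideal_mult[OF K(1)] polys_mult by auto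
  next
    case (add F H)
    have eq: "F + H - const (eval a (F + H)) = (F - const (eval a F)) + (H - const (eval a H))"
      by (simp add: ev.lin_ext_add const_simps)
    show ?case using add ideal_add[OF K(1)] polys_add unfolding eq by blast
  qed (use K(4) ideal_zero[OF K(1)] in \<open>auto simp: ev.lin_ext_const ev.lin_ext_var\<close>)
  have "eval a F = 0" if "F \<in> J" for F
  proof (rule ccontr)
    assume nz: "eval a F \<noteq> 0"
    have "F \<in> K" "F - const (eval a F) \<in> K"
      using that K(2) point[OF ideal_polys[OF J that]] by auto
    from ideal_diff[OF K(1) this] have "const (eval a F) \<in> K" by simp
    then have "const (1 / eval a F) * const (eval a F) \<in> K" by (intro ideal_scale[OF K(1)]) simp
    then show False using nz K(3) by (simp flip: const_simps(4) add: const_simps(2))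
  qed
  then show ?thesis by blast
qed

section \<open>Semistability in terms of leading monomials\<close>

text \<open>\<open>Zv f\<close> is the coordinate on the group given by the function
  \<open>f\<close>, \<open>Sv\<close> the scaling factor, and \<open>Pv i\<close> the coordinate of
  V \<oplus> W with index \<open>i\<close>.\<close>

datatype 'f gvar = Zv 'f | Sv | Pv nat

definition coords :: "nat \<Rightarrow> (complex vec \<Rightarrow> complex) set" where
  "coords N = {\<lambda>x. x $ i | i. i < N}"

lemma coordinate_regular: "i < N \<Longrightarrow> (\<lambda>x. x $ i) \<in> function_algebra (coords N)"
  by (rule function_algebra.gen) (auto simp: coords_def)

lemma mono_eval_mult: "mono_eval (\<lambda>v. t v * a v) \<mu> = mono_eval t \<mu> * mono_eval a (\<mu> :: 'v mono)"
  by (simp add: mono_eval_def power_mult_distrib prod.distrib)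

lemma mono_eval_nonzero: "(\<And>v. t v \<noteq> 0) \<Longrightarrow> mono_eval t \<mu> \<noteq> (0 :: complex)"
  by (simp add: mono_eval_def)

lemma mono_eval_zero_if: "v \<in> keys \<mu> \<Longrightarrow> a v = 0 \<Longrightarrow> mono_eval a \<mu> = (0 :: complex)"
  unfolding mono_eval_def by (rule prod_zero) (auto intro!: bexI[of _ v] simp: in_keys_iff)

text \<open>The finitely many functions in \<open>X\<close> act as coordinates on \<open>G\<close>,
  and \<open>c i j\<close> is the entry of the matrix by which an element of \<open>G\<close>
  acts.\<close>

locale matrix_family =
  fixes X :: "('g \<Rightarrow> complex) set" and G :: "'g set" and n k :: nat and c :: "nat \<Rightarrow> nat \<Rightarrow> 'g \<Rightarrow> complex"
  assumes finite_X: "finite X"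
    and regular: "\<And>i j. i < n + k \<Longrightarrow> j < n + k \<Longrightarrow> c i j \<in> function_algebra X"
begin

definition act :: "'g \<Rightarrow> complex vec \<Rightarrow> nat \<Rightarrow> complex" where
  "act g x i = (\<Sum>j<n + k. c i j g * x $ j)"

definition zs_vars :: "('g \<Rightarrow> complex) gvar set" where "zs_vars = insert Sv (Zv ` X)"
definition p_vars :: "('g \<Rightarrow> complex) gvar set" where "p_vars = Pv ` {..<n + k}"
definition v_vars :: "('g \<Rightarrow> complex) gvar set" where "v_vars = Pv ` {..<n}"
definition w_vars :: "('g \<Rightarrow> complex) gvar set" where "w_vars = Pv ` {n..<n + k}"
definition V where "V = zs_vars \<union> p_vars"

lemmas vars_defs = zs_vars_def p_vars_def v_vars_def w_vars_def V_def

lemma finite_vars [simp]: "finite zs_vars" "finite p_vars" "finite v_vars" "finite w_vars" "finite V"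
  using finite_X by (auto simp: vars_defs)

text \<open>The first entry makes this an elimination order for the coordinates of \<open>G\<close> and the
  scaling variable \<open>Sv\<close>; among forms of equal degree, the monomials that are free of the
  coordinates of \<open>V\<close> then come out as the largest.\<close>

definition ws :: "('g \<Rightarrow> complex) gvar set list" where
  "ws = [zs_vars, p_vars, w_vars] @ map (\<lambda>v. {v}) (SOME vs. set vs = V)"

lemma mless_ws: "mless ws \<mu> \<nu> \<longleftrightarrow> weight zs_vars \<mu> < weight zs_vars \<nu> \<or> weight zs_vars \<mu> = weight zs_vars \<nu> \<and>
  (weight p_vars \<mu> < weight p_vars \<nu> \<or> weight p_vars \<mu> = weight p_vars \<nu> \<and>
  (weight w_vars \<mu> < weight w_vars \<nu> \<or> weight w_vars \<mu> = weight w_vars \<nu> \<and>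
   mless (map (\<lambda>v. {v}) (SOME vs. set vs = V)) \<mu> \<nu>))"
  by (simp add: ws_def)

sublocale monomial_order V ws
proof
  fix v assume "v \<in> V"
  moreover have "set (SOME vs. set vs = V) = V"
    by (rule someI_ex[of "\<lambda>vs. set vs = V"]) (simp add: finite_list)
  ultimately show "{v} \<in> set ws" by (auto simp: ws_def)
qed simp

text \<open>The point over (g, s) of the graph belonging to \<open>x\<close>.\<close>

definition pt :: "complex vec \<Rightarrow> 'g \<Rightarrow> complex \<Rightarrow> ('g \<Rightarrow> complex) gvar \<Rightarrow> complex" where
  "pt x g s v = (case v of Zv f \<Rightarrow> f g | Sv \<Rightarrow> s | Pv i \<Rightarrow> s * act g x i)"

definition orbit_ideal :: "complex vec \<Rightarrow> ('g \<Rightarrow> complex) gvar mpoly set" where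
  "orbit_ideal x = {F \<in> polys V. \<forall>g\<in>G. \<forall>s. eval (pt x g s) F = 0}"

text \<open>If \<open>k = 0\<close>, the only monomial in \<open>w_vars\<close> is 1, of degree 0,
  and d = 1 satisfies the condition vacuously. This is as it should be, since the projective space
  of W is then empty.\<close>

definition crit :: "complex vec \<Rightarrow> bool" where
  "crit x \<longleftrightarrow> (\<exists>d. \<forall>\<mu>\<in>monomials w_vars. weight w_vars \<mu> = d \<longrightarrow> \<mu> \<in> leads ws (orbit_ideal x))"

lemma ideal_orbit_ideal: "ideal_in V (orbit_ideal x)"
  by (rule ideal_inI) (auto simp: orbit_ideal_def ev.lin_ext_add ev.lin_ext_mult polys_add polys_mult)

text \<open>The restriction of \<open>F\<close> to the graph of \<open>y\<close> is a polynomial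
  \<open>E y\<close> in the coordinates of \<open>G\<close> and \<open>Sv\<close> alone, whose
  values make sense on every graph. So \<open>F - E y\<close> vanishes on the graph of
  \<open>y\<close>, and \<open>E x\<close> vanishes on all graphs because \<open>F\<close> vanishes
  on that of \<open>x\<close>.\<close>

lemma extend_orbit_ideal:
  assumes F: "F \<in> orbit_ideal x"
  shows "\<exists>P\<in>families V (coords (n + k)). P x = F \<and> (\<forall>y. P y \<in> orbit_ideal y)"
proof -
  have "\<exists>H\<in>polys zs_vars. \<forall>y g s. eval (pt y g s) H = c i j g" if ij: "i < n + k" "j < n + k" for i j
  proof -
    from regular[OF ij] obtain H where H: "H \<in> polys X" "c i j = (\<lambda>g. eval (\<lambda>f. f g) H)"
      unfolding function_algebra_eval by blast
    have "subst (\<lambda>f. var (Zv f)) H \<in> polys zs_vars"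
      by (rule polys_subst[OF H(1)]) (simp add: zs_vars_def)
    moreover have "eval (pt y g s) (subst (\<lambda>f. var (Zv f)) H) = c i j g" for y g s
      unfolding eval_subst H(2) by (simp add: ev.lin_ext_var pt_def)
    ultimately show ?thesis by blast
  qed
  then obtain Cp where Cp: "\<And>i j. i < n + k \<Longrightarrow> j < n + k \<Longrightarrow> Cp i j \<in> polys zs_vars"
    "\<And>i j y g s. i < n + k \<Longrightarrow> j < n + k \<Longrightarrow> eval (pt y g s) (Cp i j) = c i j g"
    by metis
  \<comment> \<open>\<open>Pv i\<close> is replaced by its expression on the graph of
    \<open>y\<close>, which is linear in the coordinates of \<open>y\<close>; this makes
    \<open>E\<close> a polynomial family.\<close>
  define t where "t y v = (case v of Pv i \<Rightarrow> \<Sum>j<n + k. const (y $ j) * (var Sv * Cp i j) | _ \<Rightarrow> var v)"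
    for y :: "complex vec" and v
  have t_fam: "(\<lambda>y. t y v) \<in> families V (coords (n + k))" if "v \<in> V" for v
  proof (cases v)
    case (Pv i)
    then have "i < n + k" using that by (auto simp: vars_defs)
    then have "var Sv * Cp i j \<in> polys V" if "j < n + k" for j
      using Cp(1)[of i j] polys_mono[of zs_vars V] that by (auto simp: V_def zs_vars_def intro!: polys_mult)
    moreover have "(\<lambda>y. y $ j) \<in> function_algebra (coords (n + k))" if "j < n + k" for j
      using that by (auto simp: coords_def intro!: function_algebra.gen)
    ultimately show ?thesis
      unfolding t_def Pv by (auto intro!: families_sum families_mult families_scalar families_const)
  qed (use that in \<open>auto simp: t_def intro!: families_const\<close>)
  have t_eval: "eval (pt y g s) (t y' v) = pt y' g s v" if "v \<in> V" for y y' g s v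
  proof (cases v)
    case (Pv i)
    then have "i < n + k" using that by (auto simp: vars_defs)
    then show ?thesis
      unfolding t_def Pv
      by (simp add: ev.lin_ext_simps Cp(2)) (simp add: pt_def act_def sum_distrib_left mult_ac)
  qed (simp_all add: t_def ev.lin_ext_var pt_def)
  define E where "E y = subst (t y) F" for y
  have FV: "F \<in> polys V" using F by (simp add: orbit_ideal_def)
  have E_fam: "E \<in> families V (coords (n + k))"
    unfolding E_def[abs_def] lin_ext_def mono_eval_def
  proof (intro families_sum families_mult families_const polys_const families_prod families_power)
    fix \<mu> v assume "\<mu> \<in> keys F" "v \<in> keys \<mu>"
    then have "v \<in> V" using FV by (auto simp: polys_def monomials_def)
    then show "(\<lambda>y. t y v) \<in> families V (coords (n + k))" by (rule t_fam)
  qed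
  have E_eval: "eval (pt y g s) (E y') = eval (pt y' g s) F" for y y' g s
    unfolding E_def eval_subst by (rule eval_cong[OF FV t_eval])
  let ?P = "\<lambda>y. F - E y + E x"
  have "?P \<in> families V (coords (n + k))"
    using E_fam FV by (intro families_add families_diff families_const families_polys[OF E_fam])
  moreover have "?P y \<in> orbit_ideal y" for y
    using F families_polys[OF E_fam]
    by (auto simp: orbit_ideal_def ev.lin_ext_simps E_eval intro!: polys_add polys_diff)
  ultimately show ?thesis by (intro bexI[of _ ?P]) auto
qed

text \<open>A diagonal change of coordinates multiplies each monomial by a nonzero scalar, so it
  carries one ideal into the other without changing supports.\<close>

lemma leads_scale:
  assumes "\<And>v. t v \<noteq> 0" and "\<And>g s v. g \<in> G \<Longrightarrow> v \<in> V \<Longrightarrow> pt y g s v = t v * pt x g s v"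
  shows "leads ws (orbit_ideal y) \<subseteq> leads ws (orbit_ideal x)"
proof
  fix \<mu> assume "\<mu> \<in> leads ws (orbit_ideal y)"
  then obtain F where F: "F \<in> orbit_ideal y" "is_lead ws F \<mu>" by (auto simp: leads_def)
  define H where "H = (\<Sum>\<nu>\<in>keys F. single \<nu> (lookup F \<nu> * mono_eval t \<nu>))"
  have "lookup H \<nu> = lookup F \<nu> * mono_eval t \<nu>" for \<nu>
  proof -
    have "lookup H \<nu> = (\<Sum>\<kappa>\<in>keys F. if \<kappa> = \<nu> then lookup F \<nu> * mono_eval t \<nu> else 0)"
      unfolding H_def lookup_sum by (rule sum.cong) (auto simp: lookup_single when_def)
    then show ?thesis by (simp add: in_keys_iff)
  qed
  then have keys: "keys H = keys F"
    using mono_eval_nonzero[of t] assms(1) by (auto simp: in_keys_iff)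
  have FV: "F \<in> polys V" using F(1) by (simp add: orbit_ideal_def)
  have "eval (pt x g s) H = 0" if "g \<in> G" for g s
  proof -
    have "eval (pt x g s) H = eval (\<lambda>v. t v * pt x g s v) F"
      by (simp add: H_def ev.lin_ext_simps mono_eval_mult mult_ac) (simp add: lin_ext_def mono_eval_mult mult_ac)
    also have "\<dots> = eval (pt y g s) F"
      by (rule eval_cong[OF FV]) (simp add: assms(2)[OF that])
    finally show ?thesis using F(1) that by (simp add: orbit_ideal_def)
  qed
  moreover have "H \<in> polys V" using FV keys by (simp add: polys_def)
  ultimately have "H \<in> orbit_ideal x" by (simp add: orbit_ideal_def)
  moreover have "is_lead ws H \<mu>" using F(2) keys by (simp add: is_lead_def)
  ultimately show "\<mu> \<in> leads ws (orbit_ideal x)" by (auto simp: leads_def)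
qed

definition scale :: "complex \<Rightarrow> complex \<Rightarrow> complex vec \<Rightarrow> complex vec" where
  "scale a b x = vec (n + k) (\<lambda>i. (if i < n then a else b) * x $ i)"

text \<open>Independent scalings of V and W commute with block-diagonal matrices, so the two graphs
  differ by a diagonal change of coordinates.\<close>

lemma crit_scale:
  assumes "a \<noteq> 0" "b \<noteq> 0"
    and block: "\<And>i j g. g \<in> G \<Longrightarrow> i < n + k \<Longrightarrow> j < n + k \<Longrightarrow> (i < n) \<noteq> (j < n) \<Longrightarrow> c i j g = 0"
  shows "crit (scale a b x) \<longleftrightarrow> crit x"
proof -
  define t :: "complex \<Rightarrow> complex \<Rightarrow> ('g \<Rightarrow> complex) gvar \<Rightarrow> complex" where
    "t a b v = (case v of Pv i \<Rightarrow> if i < n then a else b | _ \<Rightarrow> 1)" for a b v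
  have act: "act g (scale a b x) i = (if i < n then a else b) * act g x i" if "g \<in> G" "i < n + k" for g i
    unfolding act_def sum_distrib_left
    by (rule sum.cong) (use block[OF that(1), of i] that(2) in \<open>auto simp: scale_def\<close>)
  have pt: "pt (scale a b x) g s v = t a b v * pt x g s v" if "g \<in> G" "v \<in> V" for g s v
    using that act by (cases v) (auto simp: pt_def t_def vars_defs)
  have inv: "t (1 / a) (1 / b) v * t a b v = 1" for v
    using assms(1,2) by (cases v) (auto simp: t_def)
  have "pt x g s v = t (1 / a) (1 / b) v * pt (scale a b x) g s v" if "g \<in> G" "v \<in> V" for g s v
    unfolding pt[OF that] mult.assoc[symmetric] inv by simp
  moreover have "t a b v \<noteq> 0" "t (1 / a) (1 / b) v \<noteq> 0" for v
    using inv[of v] by auto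
  ultimately have "leads ws (orbit_ideal (scale a b x)) = leads ws (orbit_ideal x)"
    using pt by (intro subset_antisym leads_scale[of "t a b"] leads_scale[of "t (1 / a) (1 / b)"])
  then show ?thesis by (simp add: crit_def)
qed

section \<open>Forms vanishing on the cone over an orbit\<close>

definition vpt :: "complex vec \<Rightarrow> ('g \<Rightarrow> complex) gvar \<Rightarrow> complex" where
  "vpt y v = (case v of Pv i \<Rightarrow> y $ i | _ \<Rightarrow> 0)"

definition orbit_vec :: "complex vec \<Rightarrow> 'g \<Rightarrow> complex \<Rightarrow> complex vec" where
  "orbit_vec x g s = vec (n + k) (\<lambda>i. s * act g x i)"

lemma eval_orbit_vec: "F \<in> polys p_vars \<Longrightarrow> eval (pt x g s) F = eval (vpt (orbit_vec x g s)) F"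
  by (rule eval_cong[of _ p_vars]) (auto simp: vpt_def pt_def orbit_vec_def p_vars_def)

lemma polys_p_vars: "F \<in> polys p_vars \<Longrightarrow> F \<in> polys V"
  using polys_mono[of p_vars V] by (auto simp: V_def)

lemma orbit_ideal_iff:
  "F \<in> polys p_vars \<Longrightarrow> F \<in> orbit_ideal x \<longleftrightarrow> (\<forall>g\<in>G. \<forall>s. eval (vpt (orbit_vec x g s)) F = 0)"
  by (simp add: orbit_ideal_def polys_p_vars eval_orbit_vec)

text \<open>The algebraic form of the condition that [0 : w] lies in the closure of the orbit of
  [x]: forms cut out the closed sets, and \<open>orbit_vec x g s\<close> runs through the cone over
  the orbit.\<close>

definition degenerate :: "complex vec \<Rightarrow> complex vec \<Rightarrow> bool" where
  "degenerate x w \<longleftrightarrow> (\<forall>d f. homogeneous_polynomial (n + k) d f \<and>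
    (\<forall>g\<in>G. \<forall>s. f (orbit_vec x g s) = 0) \<longrightarrow> f (0\<^sub>v n @\<^sub>v w) = 0)"

lemma homogeneous_to_poly:
  assumes "homogeneous_polynomial (n + k) d f"
  shows "\<exists>F\<in>polys p_vars. \<forall>y. f y = eval (vpt y) F"
  using assms
proof induction
  case (const a)
  then show ?case by (intro bexI[of _ "single 0 a"]) (auto simp: ev.lin_ext_single)
next
  case (zero d)
  then show ?case by (intro bexI[of _ 0]) auto
next
  case (coord i)
  then show ?case by (intro bexI[of _ "var (Pv i)"]) (auto simp: ev.lin_ext_var vpt_def p_vars_def)
next
  case (add d f h)
  then obtain F H where "F \<in> polys p_vars" "H \<in> polys p_vars" "\<forall>y. f y = eval (vpt y) F" "\<forall>y. h y = eval (vpt y) H"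
    by blast
  then show ?case by (intro bexI[of _ "F + H"]) (auto simp: ev.lin_ext_add intro: polys_add)
next
  case (mult d f d' h)
  then obtain F H where "F \<in> polys p_vars" "H \<in> polys p_vars" "\<forall>y. f y = eval (vpt y) F" "\<forall>y. h y = eval (vpt y) H"
    by blast
  then show ?case by (intro bexI[of _ "F * H"]) (auto simp: ev.lin_ext_mult intro: polys_mult)
qed

lemma homogeneous_sum:
  "(\<And>i. i \<in> B \<Longrightarrow> homogeneous_polynomial M d (q i)) \<Longrightarrow> homogeneous_polynomial M d (\<lambda>y. \<Sum>i\<in>B. q i y)"
  by (induction B rule: infinite_finite_induct)
    (simp_all add: homogeneous_polynomial.zero homogeneous_polynomial.add)

lemma poly_to_homogeneous:
  assumes F: "F \<in> polys p_vars" and d: "\<And>\<mu>. \<mu> \<in> keys F \<Longrightarrow> weight p_vars \<mu> = d"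
  shows "homogeneous_polynomial (n + k) d (\<lambda>y. eval (vpt y) F)"
  unfolding lin_ext_def
proof (rule homogeneous_sum)
  fix \<mu> assume \<mu>: "\<mu> \<in> keys F"
  have pow: "homogeneous_polynomial (n + k) e (\<lambda>y. vpt y v ^ e)" if "v \<in> p_vars" for v e
  proof (induction e)
    case 0
    show ?case by (simp add: homogeneous_polynomial.const)
  next
    case (Suc e)
    have "homogeneous_polynomial (n + k) 1 (\<lambda>y. vpt y v)"
      using that by (auto simp: vpt_def p_vars_def intro: homogeneous_polynomial.coord[simplified])
    from homogeneous_polynomial.mult[OF this Suc] show ?case by simp
  qed
  have "homogeneous_polynomial (n + k) (\<Sum>v\<in>B. lookup \<mu> v) (\<lambda>y. \<Prod>v\<in>B. vpt y v ^ lookup \<mu> v)"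
    if "finite B" "B \<subseteq> p_vars" for B
    using that
  proof (induction B)
    case empty
    show ?case by (simp add: homogeneous_polynomial.const)
  next
    case (insert v B)
    then have "homogeneous_polynomial (n + k) (lookup \<mu> v + (\<Sum>v\<in>B. lookup \<mu> v))
      (\<lambda>y. vpt y v ^ lookup \<mu> v * (\<Prod>v\<in>B. vpt y v ^ lookup \<mu> v))"
      by (intro homogeneous_polynomial.mult pow) auto
    then show ?case using insert.hyps by simp
  qed
  from this[of p_vars] have "homogeneous_polynomial (n + k) d (\<lambda>y. \<Prod>v\<in>p_vars. vpt y v ^ lookup \<mu> v)"
    using d[OF \<mu>] by (simp add: weight_def)
  moreover have "mono_eval a \<mu> = (\<Prod>v\<in>p_vars. a v ^ lookup \<mu> v)" for a :: "_ \<Rightarrow> complex"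
    using F \<mu> by (intro mono_eval_superset) (auto simp: polys_def monomials_def)
  ultimately have "homogeneous_polynomial (n + k) d (\<lambda>y. mono_eval (vpt y) \<mu>)" by simp
  from homogeneous_polynomial.mult[OF homogeneous_polynomial.const this]
  show "homogeneous_polynomial (n + k) d (\<lambda>y. lookup F \<mu> * mono_eval (vpt y) \<mu>)" by simp
qed

definition component :: "nat \<Rightarrow> ('g \<Rightarrow> complex) gvar mpoly \<Rightarrow> ('g \<Rightarrow> complex) gvar mpoly" where
  "component d F = (\<Sum>\<mu>\<in>{\<mu> \<in> keys F. weight p_vars \<mu> = d}. single \<mu> (lookup F \<mu>))"

lemma lookup_component: "lookup (component d F) \<mu> = (if weight p_vars \<mu> = d then lookup F \<mu> else 0)"
proof -
  have "lookup (component d F) \<mu> = (\<Sum>\<nu>\<in>{\<nu> \<in> keys F. weight p_vars \<nu> = d}. if \<nu> = \<mu> then lookup F \<mu> else 0)"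
    unfolding component_def lookup_sum by (rule sum.cong) (auto simp: lookup_single when_def)
  then show ?thesis by (simp add: in_keys_iff)
qed

lemma keys_component: "keys (component d F) = {\<mu> \<in> keys F. weight p_vars \<mu> = d}"
  unfolding set_eq_iff by (simp add: in_keys_iff lookup_component)

text \<open>For fixed \<open>g\<close>, the value of \<open>F\<close> at s g x is a polynomial in
  \<open>s\<close> whose coefficient in degree \<open>d\<close> is the value at g x of the
  homogeneous component. As it vanishes for all \<open>s\<close>, so does each coefficient.\<close>

lemma component_in_orbit_ideal:
  assumes F: "F \<in> orbit_ideal x" "F \<in> polys p_vars"
  shows "component d F \<in> orbit_ideal x"
proof -
  have comp: "component d F \<in> polys p_vars"
    using F(2) by (auto simp: polys_def keys_component)
  have scale: "mono_eval (vpt (orbit_vec x g s)) \<mu> = s ^ weight p_vars \<mu> * mono_eval (vpt (orbit_vec x g 1)) \<mu>"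
    if "\<mu> \<in> keys F" for \<mu> g s
  proof -
    have "\<mu> \<in> monomials p_vars" using that F(2) by (rule polysD[rotated])
    then have "mono_eval (vpt (orbit_vec x g s)) \<mu> = mono_eval (\<lambda>v. s * vpt (orbit_vec x g 1) v) \<mu>"
      by (rule mono_eval_cong) (auto simp: vpt_def orbit_vec_def p_vars_def)
    also have "mono_eval (\<lambda>_. s) \<mu> = s ^ weight p_vars \<mu>"
      using \<open>\<mu> \<in> monomials p_vars\<close> mono_eval_superset[of p_vars \<mu> "\<lambda>_. s"]
      by (simp add: monomials_def weight_def power_sum)
    ultimately show ?thesis by (simp add: mono_eval_mult)
  qed
  have "eval (vpt (orbit_vec x g s)) (component d F) = 0" if g: "g \<in> G" for g s
  proof -
    define p where "p = (\<Sum>\<mu>\<in>keys F. Polynomial.monom (lookup F \<mu> * mono_eval (vpt (orbit_vec x g 1)) \<mu>) (weight p_vars \<mu>))"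
    have "poly p s' = eval (vpt (orbit_vec x g s')) F" for s'
      unfolding p_def lin_ext_def poly_sum
      by (rule sum.cong) (simp_all add: poly_monom scale[of _ g s'] mult_ac)
    then have "p = 0"
      using F g by (simp add: orbit_ideal_iff poly_all_0_iff_0[symmetric])
    have "0 = Polynomial.coeff p d" using \<open>p = 0\<close> by simp
    also have "\<dots> = (\<Sum>\<mu>\<in>keys F. if weight p_vars \<mu> = d then lookup F \<mu> * mono_eval (vpt (orbit_vec x g 1)) \<mu> else 0)"
      unfolding p_def coeff_sum by (rule sum.cong) auto
    also have "\<dots> = (\<Sum>\<mu>\<in>{\<mu> \<in> keys F. weight p_vars \<mu> = d}. lookup F \<mu> * mono_eval (vpt (orbit_vec x g 1)) \<mu>)"
      by (rule sum.inter_filter[symmetric]) simp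
    finally have zero: "(\<Sum>\<mu>\<in>{\<mu> \<in> keys F. weight p_vars \<mu> = d}. lookup F \<mu> * mono_eval (vpt (orbit_vec x g 1)) \<mu>) = 0"
      by simp
    have "eval (vpt (orbit_vec x g s)) (component d F) =
      (\<Sum>\<mu>\<in>{\<mu> \<in> keys F. weight p_vars \<mu> = d}. s ^ d * (lookup F \<mu> * mono_eval (vpt (orbit_vec x g 1)) \<mu>))"
      unfolding lin_ext_def keys_component
      by (rule sum.cong) (auto simp: lookup_component scale[of _ g s])
    then show ?thesis by (simp only: sum_distrib_left[symmetric] zero mult_zero_right)
  qed
  then show ?thesis using comp by (simp add: orbit_ideal_iff)
qed

lemma weight_p_vars: "weight p_vars \<mu> = weight v_vars \<mu> + weight w_vars \<mu>"
proof -
  have "p_vars = v_vars \<union> w_vars" "v_vars \<inter> w_vars = {}" by (auto simp: vars_defs image_iff)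
  then show ?thesis by (simp add: weight_def sum.union_disjoint)
qed

lemma weight_zero_iff: "finite A \<Longrightarrow> weight A \<mu> = 0 \<longleftrightarrow> keys \<mu> \<inter> A = {}"
  by (auto simp: weight_def in_keys_iff)

text \<open>If \<open>x\<close> degenerates to \<open>w\<close>, induction along the order shows
  that all monomials of degree \<open>d\<close> in the coordinates of W vanish at (0, w): each is
  expressed by terms that contain a coordinate of V or are smaller monomials of the same kind. The
  \<open>d\<close>-th power of a nonzero coordinate of \<open>w\<close> contradicts this.\<close>

lemma crit_imp_not_degenerate:
  assumes "crit x" and w: "w \<in> carrier_vec k" "w \<noteq> 0\<^sub>v k"
  shows "\<not> degenerate x w"
proof
  assume deg: "degenerate x w"
  let ?y = "0\<^sub>v n @\<^sub>v w"
  from \<open>crit x\<close> obtain d where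
    d: "\<And>\<mu>. \<mu> \<in> monomials w_vars \<Longrightarrow> weight w_vars \<mu> = d \<Longrightarrow> \<mu> \<in> leads ws (orbit_ideal x)"
    unfolding crit_def by blast
  have zero: "\<mu> \<in> monomials w_vars \<and> weight w_vars \<mu> = d \<longrightarrow> mono_eval (vpt ?y) \<mu> = 0" for \<mu>
  proof (induction \<mu> rule: wf_induct_rule[OF wf_mless[of ws]])
    case (1 \<mu>)
    show ?case
    proof
      assume \<mu>: "\<mu> \<in> monomials w_vars \<and> weight w_vars \<mu> = d"
      then obtain F where F: "F \<in> orbit_ideal x" "is_lead ws F \<mu>" using d by (auto simp: leads_def)
      have sub: "keys \<mu> \<subseteq> w_vars" using \<mu> by (simp add: monomials_def)
      have w0: "weight zs_vars \<mu> = 0" "weight v_vars \<mu> = 0"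
        using sub unfolding weight_zero_iff[OF finite_vars(1)] weight_zero_iff[OF finite_vars(3)]
        by (auto simp: vars_defs)
      \<comment> \<open>Elimination: the leading monomial has degree 0 in \<open>zs_vars\<close>,
        which the order compares before anything else, so no term of \<open>F\<close> involves these
        variables.\<close>
      have Fp: "F \<in> polys p_vars"
        unfolding polys_def
      proof (rule CollectI, rule subsetI)
        fix \<nu> assume \<nu>: "\<nu> \<in> keys F"
        then have "weight zs_vars \<nu> = 0" using F(2) w0 by (auto simp: is_lead_def mless_ws)
        moreover have "\<nu> \<in> monomials V" using F(1) \<nu> by (auto simp: orbit_ideal_def polys_def)
        ultimately show "\<nu> \<in> monomials p_vars" by (auto simp: weight_zero_iff V_def monomials_def)
      qed
      \<comment> \<open>\<open>degenerate\<close> speaks of forms only; the component of degree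
        \<open>d\<close> still has \<mu> as its leading monomial.\<close>
      let ?C = "component d F"
      have "?C \<in> orbit_ideal x" by (rule component_in_orbit_ideal[OF F(1) Fp])
      moreover have Cp: "?C \<in> polys p_vars" using Fp by (auto simp: polys_def keys_component)
      moreover have "homogeneous_polynomial (n + k) d (\<lambda>y. eval (vpt y) ?C)"
        by (rule poly_to_homogeneous[OF Cp]) (simp add: keys_component)
      ultimately have "eval (vpt ?y) ?C = 0"
        using deg unfolding degenerate_def by (auto simp: orbit_ideal_iff)
      moreover have "eval (vpt ?y) ?C = (\<Sum>\<nu>\<in>keys ?C. if \<nu> = \<mu> then lookup ?C \<mu> * mono_eval (vpt ?y) \<mu> else 0)"
        unfolding lin_ext_def
      proof (rule sum.cong[OF refl])
        fix \<nu> assume \<nu>: "\<nu> \<in> keys ?C"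
        show "lookup ?C \<nu> * mono_eval (vpt ?y) \<nu> = (if \<nu> = \<mu> then lookup ?C \<mu> * mono_eval (vpt ?y) \<mu> else 0)"
        proof (cases "\<nu> = \<mu>")
          case False
          then have lt: "mless ws \<nu> \<mu>" using \<nu> F(2) by (auto simp: is_lead_def keys_component)
          have "mono_eval (vpt ?y) \<nu> = 0"
          proof (cases "weight v_vars \<nu> = 0")
            case True
            have "\<nu> \<in> monomials p_vars" using Cp \<nu> by (auto simp: polys_def)
            then have "\<nu> \<in> monomials w_vars"
              using True unfolding weight_zero_iff[OF finite_vars(3)] monomials_def
              by (fastforce simp: vars_defs)
            moreover have "weight w_vars \<nu> = d"
              using \<nu> True weight_p_vars[of \<nu>] by (simp add: keys_component)
            ultimately show ?thesis using 1 lt by auto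
          next
            case False
            then obtain i where "i < n" "Pv i \<in> keys \<nu>" by (auto simp: weight_zero_iff v_vars_def)
            then show ?thesis using w(1) by (intro mono_eval_zero_if[of "Pv i"]) (auto simp: vpt_def)
          qed
          then show ?thesis using False by simp
        qed simp
      qed
      moreover have "\<mu> \<in> keys ?C"
        using F(2) \<mu> w0 weight_p_vars[of \<mu>] by (simp add: keys_component is_lead_def)
      ultimately show "mono_eval (vpt ?y) \<mu> = 0" by (simp add: in_keys_iff[of \<mu>])
    qed
  qed
  obtain i where i: "i < k" "w $ i \<noteq> 0"
    using w by (metis carrier_vecD eq_vecI index_zero_vec(1) index_zero_vec(2))
  have "mono_eval (vpt ?y) (single (Pv (n + i)) d) = 0"
    using i(1) zero[of "single (Pv (n + i)) d"] by (simp add: weight_single w_vars_def)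
  moreover have "vpt ?y (Pv (n + i)) = w $ i" using i(1) w(1) by (simp add: vpt_def)
  ultimately show False using i(2) by simp
qed

text \<open>The ideal generated by the coordinates of V, which is the ideal of the subspace 0
  \<oplus> W.\<close>

definition v_polys :: "('g \<Rightarrow> complex) gvar mpoly set" where
  "v_polys = {F \<in> polys p_vars. \<forall>\<mu>\<in>keys F. weight v_vars \<mu> \<noteq> 0}"

text \<open>By the Nullstellensatz, \<open>1\<close> lies in the sum of the ideal of the orbit, the ideal \<open>v_polys\<close>
  and the ideal of the hyperplane \<open>Pv j = 1\<close>; homogenizing with powers of \<open>Pv j\<close> gives the claim.\<close>

lemma not_degenerate_imp_power:
  assumes nd: "\<And>w. w \<in> carrier_vec k \<Longrightarrow> w \<noteq> 0\<^sub>v k \<Longrightarrow> \<not> degenerate x w"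
    and j: "n \<le> j" "j < n + k"
  shows "\<exists>d F. F \<in> orbit_ideal x \<and> F \<in> polys p_vars \<and> (\<forall>\<mu>\<in>keys F. weight p_vars \<mu> = d) \<and>
    single (single (Pv j) d) 1 - F \<in> v_polys"
proof -
  let ?q = "var (Pv j) :: ('g \<Rightarrow> complex) gvar mpoly"
  have jp: "Pv j \<in> p_vars" "Pv j \<in> w_vars" "Pv j \<notin> v_vars" using j by (auto simp: vars_defs)
  define K where "K = orbit_ideal x \<inter> polys p_vars"
  have K: "ideal_in p_vars K"
    using ideal_orbit_ideal[of x] polys_p_vars unfolding K_def
    by (intro ideal_inI) (auto intro: polys_add polys_mult ideal_add ideal_mult ideal_zero)
  have v_polys: "ideal_in p_vars v_polys"
  proof (rule ideal_inI)
    show "F + H \<in> v_polys" if "F \<in> v_polys" "H \<in> v_polys" for F H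
      using that Poly_Mapping.keys_add[of F H] by (auto simp: v_polys_def intro: polys_add)
    show "H * F \<in> v_polys" if "F \<in> v_polys" "H \<in> polys p_vars" for F H
      using that Poly_Mapping.keys_mult[of H F] by (fastforce simp: v_polys_def weight_add intro: polys_mult)
  qed (auto simp: v_polys_def)
  define A where "A = {F + H + R * (?q - 1) | F H R. F \<in> K \<and> H \<in> v_polys \<and> R \<in> polys p_vars}"
  have in_A: "F + H + R * (?q - 1) \<in> A" if "F \<in> K" "H \<in> v_polys" "R \<in> polys p_vars" for F H R
    using that unfolding A_def by blast
  have A: "ideal_in p_vars A"
  proof (rule ideal_inI)
    show "A \<subseteq> polys p_vars"
      using ideal_polys[OF K] ideal_polys[OF v_polys] jp unfolding A_def
      by (auto intro!: polys_add polys_mult polys_diff)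
    show "0 \<in> A" using in_A[of 0 0 0] ideal_zero[OF K] ideal_zero[OF v_polys] by simp
    show "F + F' \<in> A" if FF': "F \<in> A" "F' \<in> A" for F F'
    proof -
      obtain F1 H1 R1 where e: "F = F1 + H1 + R1 * (?q - 1)" "F1 \<in> K" "H1 \<in> v_polys" "R1 \<in> polys p_vars"
        using FF'(1) unfolding A_def by blast
      obtain F2 H2 R2 where e': "F' = F2 + H2 + R2 * (?q - 1)" "F2 \<in> K" "H2 \<in> v_polys" "R2 \<in> polys p_vars"
        using FF'(2) unfolding A_def by blast
      have "F + F' = (F1 + F2) + (H1 + H2) + (R1 + R2) * (?q - 1)"
        unfolding e(1) e'(1) by (simp add: algebra_simps)
      then show ?thesis
        using in_A[of "F1 + F2" "H1 + H2" "R1 + R2"] e(2-) e'(2-) ideal_add[OF K] ideal_add[OF v_polys] polys_add by metis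
    qed
    show "S * F \<in> A" if FS: "F \<in> A" "S \<in> polys p_vars" for F S
    proof -
      obtain F1 H1 R1 where e: "F = F1 + H1 + R1 * (?q - 1)" "F1 \<in> K" "H1 \<in> v_polys" "R1 \<in> polys p_vars"
        using FS unfolding A_def by blast
      have "S * F = S * F1 + S * H1 + (S * R1) * (?q - 1)"
        unfolding e(1) by (simp add: algebra_simps)
      then show ?thesis
        using in_A[of "S * F1" "S * H1" "S * R1"] e(2-) FS(2) ideal_mult[OF K] ideal_mult[OF v_polys] polys_mult by metis
    qed
  qed
  \<comment> \<open>A common zero of \<open>A\<close> would be a point (0, w), with \<open>w\<close>
    nonzero because of the equation \<open>Pv j = 1\<close>, at which all forms vanishing on the
    orbit vanish.\<close>
  have "1 \<in> A"
  proof (rule ccontr)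
    assume "1 \<notin> A"
    from Nullstellensatz[OF _ A this] obtain a where a: "\<And>F. F \<in> A \<Longrightarrow> eval a F = 0" by auto
    define w where "w = vec k (\<lambda>i. a (Pv (n + i)))"
    have "?q - 1 \<in> A" using in_A[of 0 0 1] ideal_zero[OF K] ideal_zero[OF v_polys] by simp
    from a[OF this] have "a (Pv j) = 1" by (simp add: ev.lin_ext_simps)
    have "w \<noteq> 0\<^sub>v k"
    proof
      assume "w = 0\<^sub>v k"
      moreover have "n + (j - n) = j" using j(1) by simp
      ultimately have "a (Pv j) = 0" using j by (metis index_vec index_zero_vec(1) less_diff_conv2 add.commute w_def)
      then show False using \<open>a (Pv j) = 1\<close> by simp
    qed
    moreover have "degenerate x w"
      unfolding degenerate_def
    proof (intro allI impI, elim conjE)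
      fix d f assume f: "homogeneous_polynomial (n + k) d f" "\<forall>g\<in>G. \<forall>s. f (orbit_vec x g s) = 0"
      obtain F where F: "F \<in> polys p_vars" "\<And>y. f y = eval (vpt y) F"
        using homogeneous_to_poly[OF f(1)] by blast
      then have "F \<in> K" using f(2) by (simp add: K_def orbit_ideal_iff)
      then have "eval a F = 0" using a in_A[of F 0 0] ideal_zero[OF v_polys] by simp
      moreover have "eval a F = eval (vpt (0\<^sub>v n @\<^sub>v w)) F"
      proof (rule eval_cong[OF F(1)])
        fix v assume "v \<in> p_vars"
        then obtain i where i: "v = Pv i" "i < n + k" by (auto simp: p_vars_def)
        show "a v = vpt (0\<^sub>v n @\<^sub>v w) v"
        proof (cases "i < n")
          case True
          then have "var (Pv i) \<in> v_polys"
            by (simp add: v_polys_def var_def weight_single v_vars_def p_vars_def)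
          then have "var (Pv i) \<in> A" using in_A[of 0 "var (Pv i)" 0] ideal_zero[OF K] by simp
          from a[OF this] show ?thesis using i True by (simp add: ev.lin_ext_simps vpt_def w_def)
        next
          case False
          then have "n + (i - n) = i" by simp
          then show ?thesis using i False by (simp add: vpt_def w_def)
        qed
      qed
      ultimately show "f (0\<^sub>v n @\<^sub>v w) = 0" using F(2) by simp
    qed
    ultimately show False using nd[of w] by (simp add: w_def)
  qed
  then obtain F H R where one: "1 = F + H + R * (?q - 1)" and F: "F \<in> K" and H: "H \<in> v_polys"
    and R: "R \<in> polys p_vars"
    unfolding A_def by blast
  \<comment> \<open>The strict bound leaves a positive power of \<open>Pv j\<close> to multiply
    with. This is used for \<open>T\<close> to kill the multiple of \<open>?q - 1\<close> and for
    \<open>T F\<close> to vanish where the coordinate with index \<open>j\<close> is 0.\<close>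
  define d where "d = Suc (\<Sum>\<mu>\<in>keys F \<union> keys H \<union> keys R. weight p_vars \<mu>)"
  have d: "weight p_vars \<mu> < d" if "\<mu> \<in> keys F \<union> keys H \<union> keys R" for \<mu>
    unfolding d_def less_Suc_eq_le using that by (intro member_le_sum) auto
  \<comment> \<open>Each monomial is filled up to degree \<open>d\<close> by a power of
    \<open>Pv j\<close>. This is not multiplicative, so \<open>T\<close> is only a linear
    extension.\<close>
  define h where "h \<mu> = single (\<mu> + single (Pv j) (d - weight p_vars \<mu>)) (1::complex)"
    for \<mu> :: "('g \<Rightarrow> complex) gvar mono"
  define T where "T = lin_ext const h"
  have T_single: "T P = (\<Sum>\<mu>\<in>keys P. single (\<mu> + single (Pv j) (d - weight p_vars \<mu>)) (lookup P \<mu>))" for P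
    by (simp add: T_def lin_ext_def h_def const_def mult_single)
  have T_keys: "\<exists>\<mu>\<in>keys P. \<nu> = \<mu> + single (Pv j) (d - weight p_vars \<mu>)" if "\<nu> \<in> keys (T P)" for P \<nu>
    using that keys_sum_sub[of "\<lambda>\<mu>. single (\<mu> + single (Pv j) (d - weight p_vars \<mu>)) (lookup P \<mu>)" "keys P"]
    unfolding T_single by (auto split: if_splits)
  have T_poly: "T P \<in> polys p_vars" if "P \<in> polys p_vars" for P
    using T_keys that jp unfolding polys_def by fastforce
  have "?q * R = single (single (Pv j) 1) 1 * R" by (simp add: var_def)
  then have "T (?q * R) = (\<Sum>\<mu>\<in>keys R. const (lookup R \<mu>) * h (single (Pv j) 1 + \<mu>))"
    unfolding T_def by (simp only: sb.lin_ext_mono_mult mult_1_left)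
  also have "\<dots> = T R"
    unfolding T_def lin_ext_def
  proof (intro sum.cong refl arg_cong2[where f = "(*)"])
    fix \<mu> assume "\<mu> \<in> keys R"
    then have "weight p_vars \<mu> < d" using d by blast
    then have e: "d - weight p_vars \<mu> = 1 + (d - Suc (weight p_vars \<mu>))" by simp
    have "\<mu> + single (Pv j) (d - weight p_vars \<mu>) =
      single (Pv j) 1 + \<mu> + single (Pv j) (d - weight p_vars (single (Pv j) 1 + \<mu>))"
      unfolding e single_add by (simp add: weight_add weight_single jp add_ac)
    then show "h (single (Pv j) 1 + \<mu>) = h \<mu>" unfolding h_def by simp
  qed
  finally have "T (R * (?q - 1)) = 0"
    unfolding T_def by (simp add: algebra_simps sb.lin_ext_diff)
  moreover have "T 1 = single (single (Pv j) d) 1"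
    unfolding T_single by simp
  ultimately have T1: "single (single (Pv j) d) 1 = T F + T H"
    using arg_cong[OF one, of T] unfolding T_def by (simp add: sb.lin_ext_add)
  have "T F \<in> orbit_ideal x"
  proof -
    have "eval (vpt (orbit_vec x g s)) (T F) = 0" if g: "g \<in> G" for g s
    proof -
      let ?y = "orbit_vec x g s"
      have eq: "eval (vpt ?y) (T F) =
        (\<Sum>\<mu>\<in>keys F. lookup F \<mu> * (mono_eval (vpt ?y) \<mu> * ?y $ j ^ (d - weight p_vars \<mu>)))"
        by (simp add: T_single ev.lin_ext_simps mono_eval_add) (simp add: vpt_def)
      show ?thesis
      proof (cases "?y $ j = 0")
        case True
        have "d - weight p_vars \<mu> > 0" if "\<mu> \<in> keys F" for \<mu> using d[of \<mu>] that by simp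
        then show ?thesis unfolding eq True by (intro sum.neutral) (force simp: power_0_left)
      next
        case False
        \<comment> \<open>The value of \<open>T F\<close> at \<open>?y\<close> is a power of the
          coordinate \<open>?y $ j\<close> times the value of \<open>F\<close> at the multiple of
          \<open>?y\<close> whose coordinate with index \<open>j\<close> is 1; this multiple lies on
          the same cone, with \<open>s\<close> rescaled.\<close>
        have "mono_eval (vpt ?y) \<mu> * ?y $ j ^ (d - weight p_vars \<mu>) =
          ?y $ j ^ d * mono_eval (vpt (orbit_vec x g (s / ?y $ j))) \<mu>" if "\<mu> \<in> keys F" for \<mu>
        proof -
          have \<mu>: "\<mu> \<in> monomials p_vars" using that F by (auto simp: K_def polys_def)
          then have "mono_eval (vpt ?y) \<mu> = mono_eval (\<lambda>v. ?y $ j * vpt (orbit_vec x g (s / ?y $ j)) v) \<mu>"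
            by (rule mono_eval_cong) (use False in \<open>auto simp: vpt_def orbit_vec_def p_vars_def\<close>)
          moreover have "mono_eval (\<lambda>_. ?y $ j) \<mu> = ?y $ j ^ weight p_vars \<mu>"
            using \<mu> mono_eval_superset[of p_vars \<mu> "\<lambda>_. ?y $ j"] by (simp add: monomials_def weight_def power_sum)
          moreover have "?y $ j ^ weight p_vars \<mu> * ?y $ j ^ (d - weight p_vars \<mu>) = ?y $ j ^ d"
            using d[of \<mu>] that by (simp flip: power_add)
          ultimately show ?thesis by (simp add: mono_eval_mult mult_ac)
        qed
        then have "eval (vpt ?y) (T F) = ?y $ j ^ d * eval (vpt (orbit_vec x g (s / ?y $ j))) F"
          unfolding eq by (simp add: lin_ext_def sum_distrib_left mult_ac)
        moreover have "F \<in> orbit_ideal x" "F \<in> polys p_vars" using F by (simp_all add: K_def)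
        ultimately show ?thesis using g by (simp add: orbit_ideal_iff)
      qed
    qed
    moreover have "T F \<in> polys p_vars" using F T_poly by (simp add: K_def)
    ultimately show ?thesis by (simp add: orbit_ideal_iff)
  qed
  moreover have "T F \<in> polys p_vars" using F T_poly by (simp add: K_def)
  moreover have "weight p_vars \<nu> = d" if \<nu>: "\<nu> \<in> keys (T F)" for \<nu>
  proof -
    obtain \<mu> where \<mu>: "\<mu> \<in> keys F" "\<nu> = \<mu> + single (Pv j) (d - weight p_vars \<mu>)"
      using T_keys[OF \<nu>] by blast
    then show ?thesis using d[of \<mu>] jp by (simp add: weight_add weight_single)
  qed
  moreover have "single (single (Pv j) d) 1 - T F \<in> v_polys"
  proof -
    have "T H \<in> v_polys"
      using H T_poly T_keys jp by (fastforce simp: v_polys_def weight_add)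
    then show ?thesis unfolding T1 by simp
  qed
  ultimately show ?thesis by blast
qed

text \<open>By the pigeonhole principle, a monomial of large degree in the coordinates of W is
  divisible by the \<open>e j\<close>-th power of some \<open>Pv j\<close>. The cofactor times the
  relation for that power is a relation led by the given monomial: its other terms have the same
  degree but involve V, so they lose in the comparison of degrees in \<open>w_vars\<close>.\<close>

lemma not_degenerate_imp_crit:
  assumes nd: "\<And>w. w \<in> carrier_vec k \<Longrightarrow> w \<noteq> 0\<^sub>v k \<Longrightarrow> \<not> degenerate x w"
  shows "crit x"
proof -
  obtain e F where F: "\<And>j. n \<le> j \<Longrightarrow> j < n + k \<Longrightarrow> F j \<in> orbit_ideal x \<and> F j \<in> polys p_vars \<and>
    (\<forall>\<mu>\<in>keys (F j). weight p_vars \<mu> = e j) \<and> single (single (Pv j) (e j)) 1 - F j \<in> v_polys"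
    using not_degenerate_imp_power[OF nd] by metis
  \<comment> \<open>With all exponents below the bounds \<open>e j\<close> the degree is at most
    their sum; \<open>Suc\<close> exceeds it even when W has no coordinates.\<close>
  define d where "d = Suc (\<Sum>j\<in>{n..<n + k}. e j)"
  have "\<mu> \<in> leads ws (orbit_ideal x)" if \<mu>: "\<mu> \<in> monomials w_vars" "weight w_vars \<mu> = d" for \<mu>
  proof -
    have "\<exists>j\<in>{n..<n + k}. e j \<le> lookup \<mu> (Pv j)"
    proof (rule ccontr)
      assume "\<not> ?thesis"
      then have "(\<Sum>j\<in>{n..<n + k}. lookup \<mu> (Pv j)) \<le> (\<Sum>j\<in>{n..<n + k}. e j)"
        by (intro sum_mono) (auto simp: not_le intro: less_imp_le)
      moreover have "weight w_vars \<mu> = (\<Sum>j\<in>{n..<n + k}. lookup \<mu> (Pv j))"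
        unfolding weight_def w_vars_def by (subst sum.reindex) (auto simp: inj_on_def)
      ultimately show False using \<mu>(2) by (simp add: d_def)
    qed
    then obtain j where j: "n \<le> j" "j < n + k" "e j \<le> lookup \<mu> (Pv j)" by auto
    note Fj = F[OF j(1,2)]
    have "lookup (single (Pv j) (e j)) v \<le> lookup \<mu> v" for v
      using j(3) by (auto simp: lookup_single when_def)
    then obtain \<nu> where \<nu>: "\<mu> = single (Pv j) (e j) + \<nu>" using mono_le_imp_add by blast
    have \<nu>w: "\<nu> \<in> monomials w_vars" using \<mu>(1) \<nu> by simp
    define H where "H = single (single (Pv j) (e j)) 1 - F j"
    define P where "P = single \<nu> 1 * F j"
    have w_sub: "w_vars \<subseteq> p_vars" "w_vars \<subseteq> V" by (auto simp: vars_defs)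
    have P_in: "P \<in> orbit_ideal x"
      unfolding P_def using Fj \<nu>w monomials_mono[OF w_sub(2)]
      by (intro ideal_mult[OF ideal_orbit_ideal]) auto
    have P_eq: "P = single \<mu> 1 - single \<nu> 1 * H"
      by (simp add: P_def H_def \<nu> right_diff_distrib mult_single add.commute)
    have w0: "weight v_vars \<kappa> = 0" "weight zs_vars \<kappa> = 0" if "\<kappa> \<in> monomials w_vars" for \<kappa>
      using that unfolding weight_zero_iff[OF finite_vars(1)] weight_zero_iff[OF finite_vars(3)]
      by (auto simp: monomials_def vars_defs)
    have kH: "weight v_vars \<kappa> > 0" "weight p_vars \<kappa> = weight p_vars \<mu>" "weight zs_vars \<kappa> = 0"
      if \<kappa>: "\<kappa> \<in> keys (single \<nu> 1 * H)" for \<kappa>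
    proof -
      obtain \<gamma> where \<gamma>: "\<gamma> \<in> keys H" "\<kappa> = \<nu> + \<gamma>" using \<kappa> keys_single_mult[of \<nu> 1 H] by blast
      have "H \<in> v_polys" using Fj by (simp add: H_def)
      then have "weight v_vars \<gamma> \<noteq> 0" "\<gamma> \<in> monomials p_vars" using \<gamma>(1) by (auto simp: v_polys_def polys_def)
      moreover from this(2) have zs: "weight zs_vars \<gamma> = 0"
        unfolding weight_zero_iff[OF finite_vars(1)] by (auto simp: monomials_def zs_vars_def p_vars_def)
      ultimately show "weight v_vars \<kappa> > 0" "weight zs_vars \<kappa> = 0"
        using w0[OF \<nu>w] zs by (auto simp: \<gamma>(2) weight_add)
      have "\<gamma> \<in> keys (F j) \<or> \<gamma> = single (Pv j) (e j)"
        using \<gamma>(1) by (auto simp: H_def in_keys_iff lookup_minus lookup_single when_def split: if_splits)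
      then have "weight p_vars \<gamma> = e j"
        using Fj j(2) by (auto simp: weight_single p_vars_def)
      then show "weight p_vars \<kappa> = weight p_vars \<mu>"
        using j(2) by (simp add: \<gamma>(2) \<nu> weight_add weight_single) (simp add: p_vars_def)
    qed
    have "\<mu> \<notin> keys (single \<nu> 1 * H)" using kH(1) w0(1)[OF \<mu>(1)] by force
    then have "lookup P \<mu> = 1" by (simp add: P_eq lookup_minus in_keys_iff)
    moreover have "mless ws \<kappa> \<mu>" if "\<kappa> \<in> keys P" "\<kappa> \<noteq> \<mu>" for \<kappa>
    proof -
      have "\<kappa> \<in> keys (single \<nu> 1 * H)"
        using that by (auto simp: P_eq in_keys_iff lookup_minus lookup_single when_def split: if_splits)
      from kH[OF this] show ?thesis
        using w0[OF \<mu>(1)] weight_p_vars[of \<kappa>] weight_p_vars[of \<mu>] by (simp add: mless_ws)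
    qed
    ultimately have "is_lead ws P \<mu>" by (auto simp: is_lead_def in_keys_iff[of \<mu>])
    then show ?thesis using P_in by (auto simp: leads_def)
  qed
  then show ?thesis unfolding crit_def by blast
qed

lemma crit_iff: "crit x \<longleftrightarrow> (\<forall>w\<in>carrier_vec k. w \<noteq> 0\<^sub>v k \<longrightarrow> \<not> degenerate x w)"
  using crit_imp_not_degenerate not_degenerate_imp_crit by blast

end

section \<open>Constructible sets\<close>

lemma constructible_in_Un:
  assumes "constructible_in T A" "constructible_in T B"
  shows "constructible_in T (A \<union> B)"
proof -
  from assms obtain \<F> \<H> where "finite \<F>" "\<forall>S\<in>\<F>. locally_closed_in T S" "A = \<Union>\<F>"
    "finite \<H>" "\<forall>S\<in>\<H>. locally_closed_in T S" "B = \<Union>\<H>"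
    unfolding constructible_in_def by blast
  then show ?thesis
    unfolding constructible_in_def by (intro exI[of _ "\<F> \<union> \<H>"]) auto
qed

lemma constructible_in_locally_closed: "locally_closed_in T A \<Longrightarrow> constructible_in T A"
  unfolding constructible_in_def by (intro exI[of _ "{A}"]) auto

lemma constructible_in_open_Int_closed:
  "openin T U \<Longrightarrow> closedin T Z \<Longrightarrow> constructible_in T (U \<inter> Z)"
  by (rule constructible_in_locally_closed) (auto simp only: locally_closed_in_def)

lemma constructible_in_closed:
  assumes "closedin T A"
  shows "constructible_in T A"
  using constructible_in_open_Int_closed[OF openin_topspace assms] closedin_subset[OF assms]
  by (simp add: Int_absorb1)

lemma constructible_in_open:
  assumes "openin T A"
  shows "constructible_in T A"
  using constructible_in_open_Int_closed[OF assms closedin_topspace] openin_subset[OF assms]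
  by (simp add: Int_absorb2)

lemma constructible_in_Union:
  "finite I \<Longrightarrow> (\<And>i. i \<in> I \<Longrightarrow> constructible_in T (A i)) \<Longrightarrow> constructible_in T (\<Union>i\<in>I. A i)"
proof (induction I rule: finite_induct)
  case empty
  show ?case unfolding constructible_in_def by (intro exI[of _ "{}"]) auto
qed (auto intro: constructible_in_Un)

lemma constructible_in_Int:
  assumes "constructible_in T A" "constructible_in T B"
  shows "constructible_in T (A \<inter> B)"
proof -
  from assms obtain \<F> \<H> where F: "finite \<F>" "\<And>S. S \<in> \<F> \<Longrightarrow> locally_closed_in T S" "A = \<Union>\<F>"
    and H: "finite \<H>" "\<And>S. S \<in> \<H> \<Longrightarrow> locally_closed_in T S" "B = \<Union>\<H>"
    unfolding constructible_in_def by blast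
  have "locally_closed_in T (S \<inter> S')" if SS': "S \<in> \<F>" "S' \<in> \<H>" for S S'
  proof -
    obtain U Z U' Z' where "openin T U" "closedin T Z" "S = U \<inter> Z" "openin T U'" "closedin T Z'" "S' = U' \<inter> Z'"
      using F(2)[OF SS'(1)] H(2)[OF SS'(2)] unfolding locally_closed_in_def by blast
    then show ?thesis
      unfolding locally_closed_in_def
      by (intro exI[of _ "U \<inter> U'"] exI[of _ "Z \<inter> Z'"]) (auto intro: openin_Int closedin_Int)
  qed
  then have "constructible_in T (\<Union>S\<in>\<F>. \<Union>S'\<in>\<H>. S \<inter> S')"
    using F(1) H(1) by (intro constructible_in_Union constructible_in_locally_closed)
  moreover have "(\<Union>S\<in>\<F>. \<Union>S'\<in>\<H>. S \<inter> S') = A \<inter> B" using F(3) H(3) by blast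
  ultimately show ?thesis by simp
qed

lemma constructible_in_compl:
  assumes "constructible_in T A"
  shows "constructible_in T (topspace T - A)"
proof -
  from assms obtain \<F> where F: "finite \<F>" "\<And>S. S \<in> \<F> \<Longrightarrow> locally_closed_in T S" "A = \<Union>\<F>"
    unfolding constructible_in_def by blast
  from F(1,2) have "constructible_in T (topspace T - \<Union>\<F>)"
  proof (induction \<F> rule: finite_induct)
    case empty
    then show ?case by (auto intro: constructible_in_open)
  next
    case (insert S \<F>)
    then obtain U Z where UZ: "openin T U" "closedin T Z" "S = U \<inter> Z"
      unfolding locally_closed_in_def by blast
    have "constructible_in T ((topspace T - U) \<union> (topspace T - Z))"
      using UZ by (intro constructible_in_Un constructible_in_closed constructible_in_open) auto
    then have "constructible_in T (((topspace T - U) \<union> (topspace T - Z)) \<inter> (topspace T - \<Union>\<F>))"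
      using insert by (intro constructible_in_Int) auto
    moreover have "((topspace T - U) \<union> (topspace T - Z)) \<inter> (topspace T - \<Union>\<F>) = topspace T - \<Union>(insert S \<F>)"
      using UZ(3) by blast
    ultimately show ?case by simp
  qed
  then show ?thesis using F(3) by simp
qed

text \<open>The constructible subsets of affine space, presented as the Boolean algebra generated by
  zero sets of single polynomials. In this form induction carries them through preimages and affine
  charts.\<close>

inductive_set aff_con :: "nat \<Rightarrow> complex vec set set" for N :: nat where
  zeros: "f \<in> function_algebra (coords N) \<Longrightarrow> {x \<in> carrier_vec N. f x = 0} \<in> aff_con N"
| compl: "S \<in> aff_con N \<Longrightarrow> carrier_vec N - S \<in> aff_con N"
| inter: "S \<in> aff_con N \<Longrightarrow> T \<in> aff_con N \<Longrightarrow> S \<inter> T \<in> aff_con N"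

lemma aff_con_carrier: "S \<in> aff_con N \<Longrightarrow> S \<subseteq> carrier_vec N"
  by (induction rule: aff_con.induct) auto

lemma aff_con_UNIV: "carrier_vec N \<in> aff_con N"
  using aff_con.zeros[OF function_algebra.const[of 0]] by simp

lemma aff_con_empty: "{} \<in> aff_con N"
  using aff_con.compl[OF aff_con_UNIV] by simp

lemma aff_con_Un:
  assumes "S \<in> aff_con N" "T \<in> aff_con N"
  shows "S \<union> T \<in> aff_con N"
proof -
  have "S \<union> T = carrier_vec N - ((carrier_vec N - S) \<inter> (carrier_vec N - T))"
    using assms[THEN aff_con_carrier] by blast
  then show ?thesis using assms by (auto intro: aff_con.intros)
qed

lemma aff_con_INT:
  "finite I \<Longrightarrow> (\<And>i. i \<in> I \<Longrightarrow> S i \<in> aff_con N) \<Longrightarrow> {x \<in> carrier_vec N. \<forall>i\<in>I. x \<in> S i} \<in> aff_con N"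
proof (induction I rule: finite_induct)
  case (insert i I)
  have "{x \<in> carrier_vec N. \<forall>i\<in>insert i I. x \<in> S i} = S i \<inter> {x \<in> carrier_vec N. \<forall>i\<in>I. x \<in> S i}"
    using aff_con_carrier[OF insert.prems[of i]] by auto
  then show ?case using insert by (auto intro: aff_con.inter)
qed (auto intro: aff_con_UNIV)

text \<open>Preimages commute with Boolean operations, so the content is that composition with a
  polynomial map preserves polynomial functions.\<close>

lemma aff_con_preimage:
  assumes "S \<in> aff_con M" and carrier: "\<And>x. x \<in> carrier_vec N \<Longrightarrow> u x \<in> carrier_vec M"
    and poly: "\<And>i. i < M \<Longrightarrow> \<exists>f\<in>function_algebra (coords N). \<forall>x\<in>carrier_vec N. u x $ i = f x"
  shows "{x \<in> carrier_vec N. u x \<in> S} \<in> aff_con N"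
  using assms(1)
proof induction
  case (zeros f)
  then have "\<exists>h\<in>function_algebra (coords N). \<forall>x\<in>carrier_vec N. f (u x) = h x"
  proof induction
    case (gen f)
    then show ?case using poly by (auto simp: coords_def)
  next
    case (const c)
    show ?case by (intro bexI[of _ "\<lambda>_. c"]) (auto intro: function_algebra.const)
  next
    case (add f h)
    then obtain f' h' where "f' \<in> function_algebra (coords N)" "h' \<in> function_algebra (coords N)"
      "\<forall>x\<in>carrier_vec N. f (u x) = f' x" "\<forall>x\<in>carrier_vec N. h (u x) = h' x" by blast
    then show ?case by (intro bexI[of _ "\<lambda>x. f' x + h' x"]) (auto intro: function_algebra.add)
  next
    case (mult f h)
    then obtain f' h' where "f' \<in> function_algebra (coords N)" "h' \<in> function_algebra (coords N)"
      "\<forall>x\<in>carrier_vec N. f (u x) = f' x" "\<forall>x\<in>carrier_vec N. h (u x) = h' x" by blast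
    then show ?case by (intro bexI[of _ "\<lambda>x. f' x * h' x"]) (auto intro: function_algebra.mult)
  qed
  then obtain h where "h \<in> function_algebra (coords N)" "\<forall>x\<in>carrier_vec N. f (u x) = h x" by blast
  moreover from this have "{x \<in> carrier_vec N. u x \<in> {x \<in> carrier_vec M. f x = 0}} = {x \<in> carrier_vec N. h x = 0}"
    using carrier by auto
  ultimately show ?case by (simp add: aff_con.zeros)
next
  case (compl S)
  have "{x \<in> carrier_vec N. u x \<in> carrier_vec M - S} = carrier_vec N - {x \<in> carrier_vec N. u x \<in> S}"
    using carrier by auto
  then show ?case using compl by (simp add: aff_con.compl)
next
  case (inter S T)
  have "{x \<in> carrier_vec N. u x \<in> S \<inter> T} = {x \<in> carrier_vec N. u x \<in> S} \<inter> {x \<in> carrier_vec N. u x \<in> T}"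
    by auto
  then show ?case using inter by (simp add: aff_con.inter)
qed

text \<open>The system of equations is finite by definition, which makes membership in
  \<open>aff_con\<close> immediate.\<close>

definition aff_closed :: "nat \<Rightarrow> complex vec set \<Rightarrow> bool" where
  "aff_closed N Z \<longleftrightarrow> (\<exists>F. finite F \<and> F \<subseteq> function_algebra (coords N) \<and> Z = {x \<in> carrier_vec N. \<forall>f\<in>F. f x = 0})"

lemma aff_closed_carrier: "aff_closed N Z \<Longrightarrow> Z \<subseteq> carrier_vec N"
  by (auto simp: aff_closed_def)

lemma aff_closed_aff_con:
  assumes "aff_closed N Z"
  shows "Z \<in> aff_con N"
proof -
  from assms obtain F where F: "finite F" "F \<subseteq> function_algebra (coords N)" "Z = {x \<in> carrier_vec N. \<forall>f\<in>F. f x = 0}"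
    unfolding aff_closed_def by blast
  have "{x \<in> carrier_vec N. \<forall>f\<in>F. x \<in> {x \<in> carrier_vec N. f x = 0}} \<in> aff_con N"
    using F by (intro aff_con_INT aff_con.zeros) auto
  moreover have "{x \<in> carrier_vec N. \<forall>f\<in>F. x \<in> {x \<in> carrier_vec N. f x = 0}} = Z" using F(3) by auto
  ultimately show ?thesis by simp
qed

lemma aff_closed_Int:
  assumes "aff_closed N Z" "f \<in> function_algebra (coords N)"
  shows "aff_closed N {x \<in> Z. f x = 0}"
proof -
  from assms(1) obtain F where "finite F" "F \<subseteq> function_algebra (coords N)" "Z = {x \<in> carrier_vec N. \<forall>f\<in>F. f x = 0}"
    unfolding aff_closed_def by blast
  then show ?thesis
    unfolding aff_closed_def using assms(2) by (intro exI[of _ "insert f F"]) auto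
qed

lemma finite_coords: "finite (coords N)"
proof -
  have "coords N = (\<lambda>i x. x $ i) ` {..<N}" by (auto simp: coords_def)
  then show ?thesis by simp
qed

text \<open>A strictly descending chain of closed sets would have a strictly ascending chain of
  vanishing ideals, contrary to \<open>ideal_chain_stable\<close>.\<close>

lemma wf_aff_closed: "wf {(Z', Z). aff_closed N Z' \<and> aff_closed N Z \<and> Z' \<subset> Z}"
  unfolding wf_iff_no_infinite_down_chain
proof
  assume "\<exists>Z. \<forall>i. (Z (Suc i), Z i) \<in> {(Z', Z). aff_closed N Z' \<and> aff_closed N Z \<and> Z' \<subset> Z}"
  then obtain Z where Z: "\<And>i. aff_closed N (Z i)" "\<And>i. Z (Suc i) \<subset> Z i" by blast
  obtain vs where vs: "set vs = coords N" using finite_list[OF finite_coords] by blast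
  interpret monomial_order "coords N" "map (\<lambda>v. {v}) vs"
    by unfold_locales (auto simp: vs finite_coords)
  define I where "I i = {F \<in> polys (coords N). \<forall>x\<in>Z i. eval (\<lambda>f. f x) F = 0}" for i
  have "ideal_in (coords N) (I i)" for i
    by (rule ideal_inI) (auto simp: I_def ev.lin_ext_add ev.lin_ext_mult polys_add polys_mult)
  moreover have "I i \<subseteq> I (Suc i)" for i using Z(2)[of i] by (auto simp: I_def)
  ultimately obtain i where i: "I (Suc i) = I i" using ideal_chain_stable[of I] by blast
  obtain x where x: "x \<in> Z i" "x \<notin> Z (Suc i)" using Z(2) by blast
  obtain F where F: "F \<subseteq> function_algebra (coords N)" "Z (Suc i) = {x \<in> carrier_vec N. \<forall>f\<in>F. f x = 0}"
    using Z(1)[of "Suc i"] unfolding aff_closed_def by blast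
  obtain f where f: "f \<in> F" "f x \<noteq> 0" using x aff_closed_carrier[OF Z(1)[of i]] F(2) by blast
  obtain H where H: "H \<in> polys (coords N)" "f = (\<lambda>x. eval (\<lambda>f. f x) H)"
    using f(1) F(1) function_algebra_eval by blast
  have "H \<in> I (Suc i)" using H f(1) F(2) by (auto simp: I_def)
  then show False using i H f(2) x(1) by (auto simp: I_def)
qed

context matrix_family
begin

lemma crit_aff_con: "{x \<in> carrier_vec (n + k). crit x} \<in> aff_con (n + k)"
proof -
  let ?N = "n + k"
  have "aff_closed ?N Z \<longrightarrow> {x \<in> Z. crit x} \<in> aff_con ?N" for Z
  proof (induction Z rule: wf_induct_rule[OF wf_aff_closed[of ?N]])
    case (1 Z)
    show ?case
    proof
      assume Z: "aff_closed ?N Z"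
      have IH: "{x \<in> {x \<in> Z. f x = 0}. crit x} \<in> aff_con ?N"
        if f: "f \<in> function_algebra (coords ?N)" "\<exists>x\<in>Z. f x \<noteq> 0" for f
      proof -
        have "{x \<in> Z. f x = 0} \<subset> Z" using f(2) by blast
        then show ?thesis using 1[of "{x \<in> Z. f x = 0}"] Z aff_closed_Int[OF Z f(1)] by blast
      qed
      \<comment> \<open>The second alternative is reducibility of \<open>Z\<close>: the zero sets of
        \<open>f\<close> and \<open>h\<close> in \<open>Z\<close> are proper and cover it.\<close>
      consider "Z = {}"
        | f h where "f \<in> function_algebra (coords ?N)" "h \<in> function_algebra (coords ?N)"
            "\<forall>x\<in>Z. f x * h x = 0" "\<exists>x\<in>Z. f x \<noteq> 0" "\<exists>x\<in>Z. h x \<noteq> 0"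
        | "Z \<noteq> {}" "\<And>f h. f \<in> function_algebra (coords ?N) \<Longrightarrow> h \<in> function_algebra (coords ?N) \<Longrightarrow>
            \<forall>x\<in>Z. f x * h x = 0 \<Longrightarrow> (\<forall>x\<in>Z. f x = 0) \<or> (\<forall>x\<in>Z. h x = 0)"
        by blast
      then show "{x \<in> Z. crit x} \<in> aff_con ?N"
      proof cases
        case 1
        then show ?thesis by (simp add: aff_con_empty)
      next
        case (2 f h)
        have "{x \<in> Z. crit x} = {x \<in> {x \<in> Z. f x = 0}. crit x} \<union> {x \<in> {x \<in> Z. h x = 0}. crit x}"
          using 2(3) by auto
        also have "\<dots> \<in> aff_con ?N" using IH 2 by (intro aff_con_Un) auto
        finally show ?thesis .
      next
        case 3
        interpret ideal_family V ws "coords ?N" Z orbit_ideal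
        proof
          show "\<exists>P\<in>families V (coords ?N). P x = F \<and> (\<forall>y\<in>Z. P y \<in> orbit_ideal y)"
            if "F \<in> orbit_ideal x" for x F
            using extend_orbit_ideal[OF that] by blast
        qed (use 3 ideal_orbit_ideal in auto)
        obtain a where a: "a \<in> function_algebra (coords ?N)" "\<exists>x\<in>Z. a x \<noteq> 0"
          "\<And>x. x \<in> Z \<Longrightarrow> a x \<noteq> 0 \<Longrightarrow> leads ws (orbit_ideal x) = generic_leads"
          using leads_generically_constant by blast
        \<comment> \<open>\<open>crit\<close> depends on \<open>x\<close> only through the leading
          monomials, so it has a single truth value on the part of \<open>Z\<close> where
          \<open>a\<close> is nonzero.\<close>
        define c where "c \<longleftrightarrow> (\<exists>d. \<forall>\<mu>\<in>monomials w_vars. weight w_vars \<mu> = d \<longrightarrow> \<mu> \<in> generic_leads)"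
        have c: "crit x \<longleftrightarrow> c" if "x \<in> Z" "a x \<noteq> 0" for x
          unfolding crit_def c_def a(3)[OF that] ..
        have "Z \<inter> (carrier_vec ?N - {x \<in> carrier_vec ?N. a x = 0}) \<in> aff_con ?N"
          using Z a(1) by (intro aff_con.intros aff_closed_aff_con)
        then have "(if c then Z \<inter> (carrier_vec ?N - {x \<in> carrier_vec ?N. a x = 0}) else {}) \<in> aff_con ?N"
          by (simp add: aff_con_empty)
        then have "{x \<in> {x \<in> Z. a x = 0}. crit x} \<union>
          (if c then Z \<inter> (carrier_vec ?N - {x \<in> carrier_vec ?N. a x = 0}) else {}) \<in> aff_con ?N"
          using IH[OF a(1,2)] by (rule aff_con_Un[rotated])
        also have "{x \<in> {x \<in> Z. a x = 0}. crit x} \<union>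
          (if c then Z \<inter> (carrier_vec ?N - {x \<in> carrier_vec ?N. a x = 0}) else {}) = {x \<in> Z. crit x}"
          using c aff_closed_carrier[OF Z] by auto
        finally show ?thesis .
      qed
    qed
  qed
  moreover have "aff_closed ?N (carrier_vec ?N)"
    unfolding aff_closed_def by (intro exI[of _ "{}"]) auto
  ultimately show ?thesis by blast
qed

end

section \<open>From affine cones to projective space\<close>

lemma line_smult:
  assumes "a \<noteq> 0"
  shows "line (a \<cdot>\<^sub>v x) = line x"
proof -
  have "c \<cdot>\<^sub>v x = (c / a) \<cdot>\<^sub>v (a \<cdot>\<^sub>v x)" for c
    using assms by (simp add: smult_smult_assoc)
  then have "line x \<subseteq> line (a \<cdot>\<^sub>v x)" unfolding line_def by blast
  moreover have "line (a \<cdot>\<^sub>v x) \<subseteq> line x" unfolding line_def by (auto simp: smult_smult_assoc)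
  ultimately show ?thesis by blast
qed

lemma line_self: "x \<in> line x"
  unfolding line_def by (rule range_eqI[of _ _ 1]) simp

lemma line_eqD:
  assumes "line x = line y" "y \<in> carrier_vec N" "y \<noteq> 0\<^sub>v N"
  shows "\<exists>a. a \<noteq> 0 \<and> y = a \<cdot>\<^sub>v x"
proof -
  obtain a where a: "y = a \<cdot>\<^sub>v x" using line_self[of y] assms(1) unfolding line_def by auto
  have "a \<noteq> 0"
  proof
    assume "a = 0"
    then have "y = 0\<^sub>v N" using a assms(2) by (intro eq_vecI) auto
    then show False using assms(3) by simp
  qed
  then show ?thesis using a by blast
qed

lemma homogeneous_on_line:
  assumes "homogeneous_polynomial N d f" "x \<in> carrier_vec N"
  shows "(\<forall>y\<in>line x. f y = 0) \<longleftrightarrow> f x = 0"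
  using homogeneous_polynomial_smult[OF assms(1) carrier_vecD[OF assms(2)]] line_self[of x]
  by (auto simp: line_def)

lemma homogeneous_power:
  assumes "i < N"
  shows "homogeneous_polynomial N e (\<lambda>x. x $ i ^ e)"
proof (induction e)
  case 0
  show ?case by (simp add: homogeneous_polynomial.const)
next
  case (Suc e)
  from homogeneous_polynomial.mult[OF homogeneous_polynomial.coord[OF assms] Suc] show ?case by simp
qed

text \<open>Denominators are cleared in f(x / x_i); summands of different degrees are first brought
  to a common degree by powers of x_i.\<close>

lemma homogenization:
  assumes i: "i < N" and "f \<in> function_algebra (coords N)"
  shows "\<exists>d H. homogeneous_polynomial N d H \<and>
    (\<forall>x\<in>carrier_vec N. x $ i \<noteq> 0 \<longrightarrow> H x = x $ i ^ d * f ((1 / x $ i) \<cdot>\<^sub>v x))"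
  using assms(2)
proof induction
  case (gen f)
  then obtain j where "j < N" "f = (\<lambda>x. x $ j)" by (auto simp: coords_def)
  then show ?case using homogeneous_polynomial.coord by (intro exI[of _ 1] exI[of _ f]) auto
next
  case (const c)
  show ?case
    using homogeneous_polynomial.const by (intro exI[of _ 0] exI[of _ "\<lambda>_. c"]) auto
next
  case (add f h)
  then obtain d H d' H' where H: "homogeneous_polynomial N d H" "homogeneous_polynomial N d' H'"
    "\<forall>x\<in>carrier_vec N. x $ i \<noteq> 0 \<longrightarrow> H x = x $ i ^ d * f ((1 / x $ i) \<cdot>\<^sub>v x)"
    "\<forall>x\<in>carrier_vec N. x $ i \<noteq> 0 \<longrightarrow> H' x = x $ i ^ d' * h ((1 / x $ i) \<cdot>\<^sub>v x)" by blast
  have "homogeneous_polynomial N (d + d') (\<lambda>x. x $ i ^ d' * H x + x $ i ^ d * H' x)"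
    using homogeneous_polynomial.mult[OF homogeneous_power[OF i, of d'] H(1)]
      homogeneous_polynomial.mult[OF homogeneous_power[OF i, of d] H(2)]
    by (intro homogeneous_polynomial.add) (simp_all add: add.commute)
  then show ?case
    using H(3,4)
    by (intro exI[of _ "d + d'"] exI[of _ "\<lambda>x. x $ i ^ d' * H x + x $ i ^ d * H' x"])
      (auto simp: power_add algebra_simps)
next
  case (mult f h)
  then obtain d H d' H' where H: "homogeneous_polynomial N d H" "homogeneous_polynomial N d' H'"
    "\<forall>x\<in>carrier_vec N. x $ i \<noteq> 0 \<longrightarrow> H x = x $ i ^ d * f ((1 / x $ i) \<cdot>\<^sub>v x)"
    "\<forall>x\<in>carrier_vec N. x $ i \<noteq> 0 \<longrightarrow> H' x = x $ i ^ d' * h ((1 / x $ i) \<cdot>\<^sub>v x)" by blast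
  then show ?case
    by (intro exI[of _ "d + d'"] exI[of _ "\<lambda>x. H x * H' x"])
      (auto simp: power_add algebra_simps intro: homogeneous_polynomial.mult)
qed

lemma closedin_zero_locus: "homogeneous_polynomial N d f \<Longrightarrow> closedin (zariski N) (zero_locus N {f})"
  unfolding closedin_zariski proj_closed_def by blast

lemma line_in_zero_locus:
  "homogeneous_polynomial N d f \<Longrightarrow> x \<in> carrier_vec N \<Longrightarrow> x \<noteq> 0\<^sub>v N \<Longrightarrow>
    line x \<in> zero_locus N {f} \<longleftrightarrow> f x = 0"
  using homogeneous_on_line[of N d f x] by (auto simp: zero_locus_def proj_space_def)

text \<open>The open part where coordinate \<open>i\<close> is nonzero is identified with the affine
  hyperplane where it equals 1; \<open>S\<close> enters only through its points on that
  hyperplane.\<close>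

definition chart :: "nat \<Rightarrow> nat \<Rightarrow> complex vec set \<Rightarrow> complex vec set set" where
  "chart N i S = {line x | x. x \<in> carrier_vec N \<and> x $ i \<noteq> 0 \<and> (1 / x $ i) \<cdot>\<^sub>v x \<in> S}"

lemma nonzero_coord: "i < N \<Longrightarrow> x $ i \<noteq> 0 \<Longrightarrow> x \<noteq> (0\<^sub>v N :: complex vec)"
  by auto

lemma chart_subset: "i < N \<Longrightarrow> chart N i S \<subseteq> proj_space N"
  using nonzero_coord[of i N] unfolding chart_def proj_space_def by blast

lemma chart_line:
  assumes i: "i < N" and x: "x \<in> carrier_vec N" "x \<noteq> 0\<^sub>v N"
  shows "line x \<in> chart N i S \<longleftrightarrow> x $ i \<noteq> 0 \<and> (1 / x $ i) \<cdot>\<^sub>v x \<in> S"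
proof
  assume "line x \<in> chart N i S"
  then obtain y where y: "line y = line x" "y \<in> carrier_vec N" "y $ i \<noteq> 0" "(1 / y $ i) \<cdot>\<^sub>v y \<in> S"
    by (auto simp: chart_def)
  obtain a where a: "a \<noteq> 0" "x = a \<cdot>\<^sub>v y" using line_eqD[OF y(1) x] by blast
  then have "(1 / x $ i) \<cdot>\<^sub>v x = (1 / y $ i) \<cdot>\<^sub>v y" "x $ i = a * y $ i"
    using i y(2) by (auto simp: smult_smult_assoc)
  then show "x $ i \<noteq> 0 \<and> (1 / x $ i) \<cdot>\<^sub>v x \<in> S" using y a(1) by simp
qed (use x in \<open>auto simp: chart_def\<close>)

text \<open>A zero set becomes, inside the chart, the zero locus of a homogenization. Complements
  are formed within the chart, hence the intersection with the open set \<open>?U\<close>.\<close>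

lemma chart_constructible:
  assumes i: "i < N" and "S \<in> aff_con N"
  shows "constructible_in (zariski N) (chart N i S)"
  using assms(2)
proof induction
  case (zeros f)
  obtain d H where H: "homogeneous_polynomial N d H"
    "\<And>x. x \<in> carrier_vec N \<Longrightarrow> x $ i \<noteq> 0 \<Longrightarrow> H x = x $ i ^ d * f ((1 / x $ i) \<cdot>\<^sub>v x)"
    using homogenization[OF i zeros] by blast
  have xi: "homogeneous_polynomial N 1 (\<lambda>x. x $ i)" by (rule homogeneous_polynomial.coord[OF i])
  let ?U = "proj_space N - zero_locus N {\<lambda>x. x $ i}" and ?Z = "zero_locus N {H}"
  have "chart N i {x \<in> carrier_vec N. f x = 0} = ?U \<inter> ?Z"
  proof (rule Set.set_eqI)
    fix p
    show "p \<in> chart N i {x \<in> carrier_vec N. f x = 0} \<longleftrightarrow> p \<in> ?U \<inter> ?Z"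
    proof (cases "p \<in> proj_space N")
      case True
      then obtain x where x: "p = line x" "x \<in> carrier_vec N" "x \<noteq> 0\<^sub>v N" unfolding proj_space_def by blast
      then have "p \<in> ?U \<longleftrightarrow> x $ i \<noteq> 0" "p \<in> ?Z \<longleftrightarrow> H x = 0"
        using True line_in_zero_locus[OF xi x(2,3)] line_in_zero_locus[OF H(1) x(2,3)] by auto
      moreover have "p \<in> chart N i {x \<in> carrier_vec N. f x = 0} \<longleftrightarrow> x $ i \<noteq> 0 \<and> f ((1 / x $ i) \<cdot>\<^sub>v x) = 0"
        unfolding x(1) chart_line[OF i x(2,3)] using x(2) by simp
      moreover have "x $ i \<noteq> 0 \<Longrightarrow> H x = 0 \<longleftrightarrow> f ((1 / x $ i) \<cdot>\<^sub>v x) = 0"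
        using H(2)[OF x(2)] by simp
      ultimately show ?thesis by blast
    next
      case False
      then show ?thesis using chart_subset[OF i] by blast
    qed
  qed
  moreover have "openin (zariski N) ?U"
    using closedin_zero_locus[OF xi] unfolding closedin_def topspace_zariski by blast
  moreover have "closedin (zariski N) ?Z" by (rule closedin_zero_locus[OF H(1)])
  ultimately show ?case
    by (simp only: constructible_in_open_Int_closed)
next
  case (compl S)
  have xi: "homogeneous_polynomial N 1 (\<lambda>x. x $ i)" by (rule homogeneous_polynomial.coord[OF i])
  let ?U = "proj_space N - zero_locus N {\<lambda>x. x $ i}"
  have "chart N i (carrier_vec N - S) = ?U \<inter> (topspace (zariski N) - chart N i S)"
  proof (rule Set.set_eqI)
    fix p
    show "p \<in> chart N i (carrier_vec N - S) \<longleftrightarrow> p \<in> ?U \<inter> (topspace (zariski N) - chart N i S)"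
    proof (cases "p \<in> proj_space N")
      case True
      then obtain x where x: "p = line x" "x \<in> carrier_vec N" "x \<noteq> 0\<^sub>v N" unfolding proj_space_def by blast
      then have "p \<in> ?U \<longleftrightarrow> x $ i \<noteq> 0"
        using True line_in_zero_locus[OF xi x(2,3)] by auto
      moreover have "p \<in> chart N i (carrier_vec N - S) \<longleftrightarrow> x $ i \<noteq> 0 \<and> (1 / x $ i) \<cdot>\<^sub>v x \<notin> S"
        unfolding x(1) chart_line[OF i x(2,3)] using x(2) by simp
      moreover have "p \<in> chart N i S \<longleftrightarrow> x $ i \<noteq> 0 \<and> (1 / x $ i) \<cdot>\<^sub>v x \<in> S"
        unfolding x(1) by (rule chart_line[OF i x(2,3)])
      ultimately show ?thesis using True unfolding topspace_zariski by blast
    next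
      case False
      then show ?thesis using chart_subset[OF i] by blast
    qed
  qed
  moreover have "constructible_in (zariski N) ?U"
    using closedin_zero_locus[OF xi] unfolding closedin_def topspace_zariski
    by (intro constructible_in_open) blast
  ultimately show ?case using compl by (simp add: constructible_in_Int constructible_in_compl)
next
  case (inter S T)
  have "chart N i (S \<inter> T) = chart N i S \<inter> chart N i T"
  proof (rule Set.set_eqI)
    fix p
    show "p \<in> chart N i (S \<inter> T) \<longleftrightarrow> p \<in> chart N i S \<inter> chart N i T"
    proof (cases "p \<in> proj_space N")
      case True
      then obtain x where x: "p = line x" "x \<in> carrier_vec N" "x \<noteq> 0\<^sub>v N" unfolding proj_space_def by blast
      show ?thesis unfolding x(1) Int_iff chart_line[OF i x(2,3)] by blast
    next
      case False
      then show ?thesis using chart_subset[OF i] by blast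
    qed
  qed
  then show ?case using inter by (simp add: constructible_in_Int)
qed

text \<open>Invariance under scaling allows each line to be tested on its normalized representative
  in any of the \<open>N\<close> standard charts that contains it.\<close>

lemma cone_constructible:
  assumes S: "S \<in> aff_con N" and cone: "\<And>x a. x \<in> S \<Longrightarrow> a \<noteq> 0 \<Longrightarrow> a \<cdot>\<^sub>v x \<in> S"
  shows "constructible_in (zariski N) {line x | x. x \<in> S \<and> x \<noteq> 0\<^sub>v N}"
proof -
  have "{line x | x. x \<in> S \<and> x \<noteq> 0\<^sub>v N} = (\<Union>i\<in>{..<N}. chart N i S)"
  proof (intro subset_antisym subsetI)
    fix p assume "p \<in> {line x | x. x \<in> S \<and> x \<noteq> 0\<^sub>v N}"
    then obtain x where x: "p = line x" "x \<in> S" "x \<noteq> 0\<^sub>v N" by blast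
    have xc: "x \<in> carrier_vec N" using x(2) aff_con_carrier[OF S] by blast
    obtain i where i: "i < N" "x $ i \<noteq> 0"
      using x(3) xc by (metis carrier_vecD eq_vecI index_zero_vec(1) index_zero_vec(2))
    then have "p \<in> chart N i S" using x xc cone by (auto simp: chart_line)
    then show "p \<in> (\<Union>i\<in>{..<N}. chart N i S)" using i(1) by blast
  next
    fix p assume "p \<in> (\<Union>i\<in>{..<N}. chart N i S)"
    then obtain i x where x: "i < N" "p = line x" "x \<in> carrier_vec N" "x $ i \<noteq> 0" "(1 / x $ i) \<cdot>\<^sub>v x \<in> S"
      by (auto simp: chart_def)
    have "x $ i \<cdot>\<^sub>v ((1 / x $ i) \<cdot>\<^sub>v x) = x" using x(4) by (simp add: smult_smult_assoc)
    then have "x \<in> S" using cone[OF x(5,4)] by simp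
    then show "p \<in> {line x | x. x \<in> S \<and> x \<noteq> 0\<^sub>v N}" using x(2) nonzero_coord[OF x(1,4)] by blast
  qed
  then show ?thesis using S by (auto intro!: constructible_in_Union chart_constructible)
qed

lemma vec_first_eq_zero_iff: "vec_first x n = 0\<^sub>v n \<longleftrightarrow> (\<forall>i\<in>{..<n}. x $ i = (0 :: complex))"
proof
  assume eq: "vec_first x n = 0\<^sub>v n"
  show "\<forall>i\<in>{..<n}. x $ i = 0"
  proof
    fix i assume "i \<in> {..<n}"
    then show "x $ i = 0" using arg_cong[OF eq, of "\<lambda>v. v $ i"] by (simp add: vec_first_def)
  qed
qed (auto simp: vec_first_def intro!: eq_vecI)

section \<open>The semistable locus\<close>

definition regular_matrix ::
  "('g \<Rightarrow> complex) set \<Rightarrow> 'g set \<Rightarrow> nat \<Rightarrow> ('g \<Rightarrow> complex mat) \<Rightarrow> bool" where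
  "regular_matrix X G n M \<longleftrightarrow> (\<forall>g\<in>G. M g \<in> carrier_mat n n) \<and>
    (\<forall>i<n. \<forall>j<n. \<exists>f\<in>function_algebra X. \<forall>g\<in>G. M g $$ (i, j) = f g)"

text \<open>Used for the given representations as well as for the tensor representations in the
  definition of stability. \<open>identity\<close> makes every orbit contain its base point.\<close>

locale matrix_pair =
  fixes X :: "(complex mat \<Rightarrow> complex) set" and G :: "complex mat set" and n k :: nat
    and \<rho> \<sigma> :: "complex mat \<Rightarrow> complex mat"
  assumes finite_generators: "finite X"
    and \<rho>: "regular_matrix X G n \<rho>" and \<sigma>: "regular_matrix X G k \<sigma>"
    and identity: "\<exists>e\<in>G. \<rho> e = 1\<^sub>m n \<and> \<sigma> e = 1\<^sub>m k"
begin

abbreviation D :: "complex mat \<Rightarrow> complex mat" where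
  "D \<equiv> direct_sum_rep n \<rho> k \<sigma>"

text \<open>The matrix entries are regular as functions on \<open>G\<close>; \<open>c i j\<close> is
  a chosen element of the function algebra that agrees with the entry there.\<close>

definition c :: "nat \<Rightarrow> nat \<Rightarrow> complex mat \<Rightarrow> complex" where
  "c i j = (SOME f. f \<in> function_algebra X \<and> (\<forall>g\<in>G. D g $$ (i, j) = f g))"

lemma carriers: "g \<in> G \<Longrightarrow> \<rho> g \<in> carrier_mat n n" "g \<in> G \<Longrightarrow> \<sigma> g \<in> carrier_mat k k"
  using \<rho> \<sigma> by (auto simp: regular_matrix_def)

lemma D_carrier: "g \<in> G \<Longrightarrow> D g \<in> carrier_mat (n + k) (n + k)"
  using carriers[of g] by (auto simp: direct_sum_rep_def)

lemma D_entry: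
  assumes "g \<in> G" "i < n + k" "j < n + k"
  shows "D g $$ (i, j) = (if i < n then if j < n then \<rho> g $$ (i, j) else 0
    else if j < n then 0 else \<sigma> g $$ (i - n, j - n))"
  using carriers[OF assms(1)] assms(2,3) by (auto simp: direct_sum_rep_def)

lemma entry_c:
  assumes "i < n + k" "j < n + k"
  shows "c i j \<in> function_algebra X \<and> (\<forall>g\<in>G. D g $$ (i, j) = c i j g)"
proof -
  have "\<exists>f. f \<in> function_algebra X \<and> (\<forall>g\<in>G. D g $$ (i, j) = f g)"
  proof -
    consider "i < n" "j < n" | "i \<ge> n" "j \<ge> n" | "(i < n) \<noteq> (j < n)" by linarith
    then show ?thesis
    proof cases
      case 1
      then obtain f where "f \<in> function_algebra X" "\<forall>g\<in>G. \<rho> g $$ (i, j) = f g"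
        using \<rho> unfolding regular_matrix_def by blast
      then show ?thesis using 1 assms by (auto simp: D_entry)
    next
      case 2
      then have "i - n < k" "j - n < k" using assms by auto
      then obtain f where "f \<in> function_algebra X" "\<forall>g\<in>G. \<sigma> g $$ (i - n, j - n) = f g"
        using \<sigma> unfolding regular_matrix_def by blast
      then show ?thesis using 2 assms by (auto simp: D_entry)
    next
      case 3
      then show ?thesis
        using assms by (intro exI[of _ "\<lambda>_. 0"]) (auto simp: D_entry intro: function_algebra.const)
    qed
  qed
  from someI_ex[OF this] show ?thesis unfolding c_def .
qed

sublocale matrix_family X G n k c
  by unfold_locales (use finite_generators entry_c in auto)

lemma D_mult:
  assumes "g \<in> G" "x \<in> carrier_vec (n + k)"
  shows "s \<cdot>\<^sub>v (D g *\<^sub>v x) = orbit_vec x g s"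
proof (rule eq_vecI)
  fix i assume "i < dim_vec (orbit_vec x g s)"
  then have i: "i < n + k" by (simp add: orbit_vec_def)
  have "(D g *\<^sub>v x) $ i = (\<Sum>j<n + k. D g $$ (i, j) * x $ j)"
    using D_carrier[OF assms(1)] assms(2) i by (auto simp: scalar_prod_def atLeast0LessThan intro!: sum.cong)
  also have "\<dots> = act g x i"
    unfolding act_def using entry_c[OF i] assms(1) by (intro sum.cong) auto
  finally show "(s \<cdot>\<^sub>v (D g *\<^sub>v x)) $ i = orbit_vec x g s $ i"
    using i D_carrier[OF assms(1)] by (simp add: orbit_vec_def)
qed (use D_carrier[OF assms(1)] in \<open>simp add: orbit_vec_def\<close>)

lemma orbit_line:
  assumes "x \<in> carrier_vec (n + k)"
  shows "orbit G n \<rho> k \<sigma> (line x) = (\<lambda>g. line (D g *\<^sub>v x)) ` G"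
  unfolding orbit_def
proof (rule image_cong[OF refl])
  fix g assume g: "g \<in> G"
  have "D g *\<^sub>v (a \<cdot>\<^sub>v x) = a \<cdot>\<^sub>v (D g *\<^sub>v x)" for a
    by (rule mult_mat_vec[OF D_carrier[OF g] assms])
  then show "(\<lambda>x. D g *\<^sub>v x) ` line x = line (D g *\<^sub>v x)"
    unfolding line_def by (auto simp: image_image)
qed

text \<open>One side speaks of the affine cone, the other of the points of the orbit in projective
  space. The difference concerns the zero vector only: \<open>identity\<close> gives f x = 0, and
  then f vanishes at 0 \<cdot> x by homogeneity, also in degree 0.\<close>

lemma vanish_on_orbit:
  assumes x: "x \<in> carrier_vec (n + k)" "x \<noteq> 0\<^sub>v (n + k)" and f: "homogeneous_polynomial (n + k) d f"
  shows "(\<forall>g\<in>G. \<forall>s. f (orbit_vec x g s) = 0) \<longleftrightarrow>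
    proj_space (n + k) \<inter> orbit G n \<rho> k \<sigma> (line x) \<subseteq> zero_locus (n + k) {f}"
proof
  assume van: "\<forall>g\<in>G. \<forall>s. f (orbit_vec x g s) = 0"
  have "f (s \<cdot>\<^sub>v (D g *\<^sub>v x)) = 0" if "g \<in> G" for g s
    using van that x(1) by (simp add: D_mult)
  then show "proj_space (n + k) \<inter> orbit G n \<rho> k \<sigma> (line x) \<subseteq> zero_locus (n + k) {f}"
    unfolding orbit_line[OF x(1)] zero_locus_def by (auto simp: line_def[of "D g *\<^sub>v x" for g])
next
  assume sub: "proj_space (n + k) \<inter> orbit G n \<rho> k \<sigma> (line x) \<subseteq> zero_locus (n + k) {f}"
  have zero: "f (D g *\<^sub>v x) = 0" if g: "g \<in> G" "D g *\<^sub>v x \<noteq> 0\<^sub>v (n + k)" for g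
  proof -
    have y: "D g *\<^sub>v x \<in> carrier_vec (n + k)" using D_carrier[OF g(1)] x(1) by simp
    then have "line (D g *\<^sub>v x) \<in> proj_space (n + k) \<inter> orbit G n \<rho> k \<sigma> (line x)"
      using g by (auto simp: orbit_line[OF x(1)] proj_space_def)
    then show ?thesis using sub line_in_zero_locus[OF f y g(2)] by blast
  qed
  obtain e where e: "e \<in> G" "\<rho> e = 1\<^sub>m n" "\<sigma> e = 1\<^sub>m k" using identity by blast
  have "D e = 1\<^sub>m (n + k)"
    by (rule eq_matI) (use D_entry[OF e(1)] e D_carrier[OF e(1)] in auto)
  then have "D e *\<^sub>v x = x" using x(1) by simp
  then have fx: "f x = 0" using zero[OF e(1)] x(2) by simp
  show "\<forall>g\<in>G. \<forall>s. f (orbit_vec x g s) = 0"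
  proof (intro ballI allI)
    fix g s assume g: "g \<in> G"
    have y: "D g *\<^sub>v x \<in> carrier_vec (n + k)" using D_carrier[OF g] x(1) by simp
    have "f (s \<cdot>\<^sub>v (D g *\<^sub>v x)) = 0"
    proof (cases "D g *\<^sub>v x = 0\<^sub>v (n + k)")
      case True
      have "s \<cdot>\<^sub>v (D g *\<^sub>v x) = 0 \<cdot>\<^sub>v x" unfolding True using x(1) by (intro eq_vecI) auto
      then show ?thesis using homogeneous_polynomial_smult[OF f, of x 0] x(1) fx by simp
    next
      case False
      then show ?thesis using homogeneous_polynomial_smult[OF f carrier_vecD[OF y], of s] zero[OF g] by simp
    qed
    then show "f (orbit_vec x g s) = 0" using D_mult[OF g x(1)] by simp
  qed
qed

text \<open>Closed sets are zero loci of sets of forms, so the closure of the orbit consists of the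
  common zeros of the forms that vanish on it.\<close>

lemma in_closure_iff_degenerate:
  assumes x: "x \<in> carrier_vec (n + k)" "x \<noteq> 0\<^sub>v (n + k)" and w: "w \<in> carrier_vec k" "w \<noteq> 0\<^sub>v k"
  shows "line (0\<^sub>v n @\<^sub>v w) \<in> zariski (n + k) closure_of orbit G n \<rho> k \<sigma> (line x) \<longleftrightarrow> degenerate x w"
proof -
  let ?z = "0\<^sub>v n @\<^sub>v w" and ?O = "proj_space (n + k) \<inter> orbit G n \<rho> k \<sigma> (line x)"
  have z: "?z \<in> carrier_vec (n + k)" using w(1) by simp
  have zn: "?z \<noteq> 0\<^sub>v (n + k)"
  proof
    assume eq: "?z = 0\<^sub>v (n + k)"
    have "w $ i = 0" if "i < k" for i
      using arg_cong[OF eq, of "\<lambda>v. v $ (n + i)"] that w(1) by simp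
    then show False using w by (metis carrier_vecD eq_vecI index_zero_vec(1) index_zero_vec(2))
  qed
  show ?thesis
  proof
    assume cl: "line ?z \<in> zariski (n + k) closure_of orbit G n \<rho> k \<sigma> (line x)"
    show "degenerate x w"
      unfolding degenerate_def
    proof (intro allI impI, elim conjE)
      fix d f assume f: "homogeneous_polynomial (n + k) d f" and "\<forall>g\<in>G. \<forall>s. f (orbit_vec x g s) = 0"
      then have "?O \<subseteq> zero_locus (n + k) {f}" using vanish_on_orbit[OF x f] by blast
      then have "zariski (n + k) closure_of ?O \<subseteq> zero_locus (n + k) {f}"
        using closedin_zero_locus[OF f] by (rule closure_of_minimal)
      then have "line ?z \<in> zero_locus (n + k) {f}"
        using cl unfolding closure_of_restrict[of _ "orbit G n \<rho> k \<sigma> (line x)"] topspace_zariski by blast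
      then show "f ?z = 0" using line_in_zero_locus[OF f z zn] by blast
    qed
  next
    assume deg: "degenerate x w"
    let ?C = "zariski (n + k) closure_of orbit G n \<rho> k \<sigma> (line x)"
    have "proj_closed (n + k) ?C" using closedin_zariski closedin_closure_of by blast
    then obtain F where F: "\<forall>f\<in>F. \<exists>d. homogeneous_polynomial (n + k) d f" "?C = zero_locus (n + k) F"
      unfolding proj_closed_def by blast
    have "?O \<subseteq> ?C" using closure_of_subset_Int[of "zariski (n + k)"] unfolding topspace_zariski .
    have "\<forall>y\<in>line ?z. f y = 0" if f: "f \<in> F" for f
    proof -
      obtain d where d: "homogeneous_polynomial (n + k) d f" using F(1) f by blast
      have "?O \<subseteq> zero_locus (n + k) {f}" using \<open>?O \<subseteq> ?C\<close> F(2) f by (auto simp: zero_locus_def)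
      then have "f ?z = 0" using deg vanish_on_orbit[OF x d] d unfolding degenerate_def by blast
      then show ?thesis using homogeneous_on_line[OF d z] by blast
    qed
    moreover have "line ?z \<in> proj_space (n + k)" using z zn by (auto simp: proj_space_def)
    ultimately show "line ?z \<in> ?C" unfolding F(2) by (simp add: zero_locus_def)
  qed
qed

text \<open>The representative that witnesses membership in the locus is a nonzero multiple of
  \<open>x\<close>, so any representative of the line may be tested.\<close>

lemma semistable_iff:
  assumes x: "x \<in> carrier_vec (n + k)"
  shows "line x \<in> semistable_locus G n \<rho> k \<sigma> \<longleftrightarrow> vec_first x n \<noteq> 0\<^sub>v n \<and> crit x"
proof -
  have split: "vec_first x n @\<^sub>v vec_last x k = x" by (rule vec_first_last_append[OF x])
  have closure: "zariski (n + k) closure_of orbit G n \<rho> k \<sigma> (line x) \<inter> second_summand n k = {} \<longleftrightarrow> crit x"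
    if "x \<noteq> 0\<^sub>v (n + k)"
    unfolding crit_iff second_summand_def using in_closure_iff_degenerate[OF x that] by blast
  have nonzero: "x \<noteq> 0\<^sub>v (n + k)" if "vec_first x n \<noteq> 0\<^sub>v n"
  proof
    assume "x = 0\<^sub>v (n + k)"
    then have "vec_first x n = 0\<^sub>v n" by (intro eq_vecI) (auto simp: vec_first_def)
    then show False using that by simp
  qed
  show ?thesis
  proof
    assume "line x \<in> semistable_locus G n \<rho> k \<sigma>"
    then obtain v w where vw: "line x = line (v @\<^sub>v w)" "v \<in> carrier_vec n" "w \<in> carrier_vec k" "v \<noteq> 0\<^sub>v n"
      "zariski (n + k) closure_of orbit G n \<rho> k \<sigma> (line x) \<inter> second_summand n k = {}"
      unfolding semistable_locus_def by auto
    have vw0: "v @\<^sub>v w \<noteq> 0\<^sub>v (n + k)"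
    proof
      assume eq: "v @\<^sub>v w = 0\<^sub>v (n + k)"
      have "v $ i = 0" if "i < n" for i
        using arg_cong[OF eq, of "\<lambda>v. v $ i"] that vw(2,3) by simp
      then show False using vw(2,4) by (metis carrier_vecD eq_vecI index_zero_vec(1) index_zero_vec(2))
    qed
    obtain a where a: "a \<noteq> 0" "v @\<^sub>v w = a \<cdot>\<^sub>v x"
      using line_eqD[OF vw(1) _ vw0] vw(2,3) by auto
    have "vec_first x n \<noteq> 0\<^sub>v n"
    proof
      assume eq: "vec_first x n = 0\<^sub>v n"
      have "v $ i = 0" if "i < n" for i
      proof -
        have "x $ i = 0" using arg_cong[OF eq, of "\<lambda>v. v $ i"] that by (simp add: vec_first_def)
        then show ?thesis using arg_cong[OF a(2), of "\<lambda>v. v $ i"] that vw(2,3) x by simp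
      qed
      then show False using vw(2,4) by (metis carrier_vecD eq_vecI index_zero_vec(1) index_zero_vec(2))
    qed
    then show "vec_first x n \<noteq> 0\<^sub>v n \<and> crit x" using closure[OF nonzero] vw(5) by blast
  next
    assume r: "vec_first x n \<noteq> 0\<^sub>v n \<and> crit x"
    then have "zariski (n + k) closure_of orbit G n \<rho> k \<sigma> (line (vec_first x n @\<^sub>v vec_last x k)) \<inter>
      second_summand n k = {}"
      unfolding split using closure nonzero by blast
    then have "line (vec_first x n @\<^sub>v vec_last x k) \<in> semistable_locus G n \<rho> k \<sigma>"
      unfolding semistable_locus_def using r vec_first_carrier vec_last_carrier by blast
    then show "line x \<in> semistable_locus G n \<rho> k \<sigma>" unfolding split .
  qed
qed

lemma semistable_aff_con:
  "{x \<in> carrier_vec (n + k). line x \<in> semistable_locus G n \<rho> k \<sigma>} \<in> aff_con (n + k)"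
proof -
  let ?N = "n + k"
  have "{x \<in> carrier_vec ?N. line x \<in> semistable_locus G n \<rho> k \<sigma>} =
    (carrier_vec ?N - {x \<in> carrier_vec ?N. \<forall>i\<in>{..<n}. x \<in> {x \<in> carrier_vec ?N. x $ i = 0}}) \<inter>
    {x \<in> carrier_vec ?N. crit x}"
    using semistable_iff by (auto simp: vec_first_eq_zero_iff)
  also have "\<dots> \<in> aff_con ?N"
    by (intro aff_con.inter aff_con.compl aff_con_INT aff_con.zeros crit_aff_con)
      (auto intro: coordinate_regular)
  finally show ?thesis .
qed

lemma scale_append:
  "v \<in> carrier_vec n \<Longrightarrow> w \<in> carrier_vec k \<Longrightarrow> scale a b (v @\<^sub>v w) = a \<cdot>\<^sub>v v @\<^sub>v b \<cdot>\<^sub>v w"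
  by (rule eq_vecI) (auto simp: scale_def)

lemma semistable_scale:
  assumes x: "x \<in> carrier_vec (n + k)" and ab: "a \<noteq> 0" "b \<noteq> 0"
  shows "line (scale a b x) \<in> semistable_locus G n \<rho> k \<sigma> \<longleftrightarrow> line x \<in> semistable_locus G n \<rho> k \<sigma>"
proof -
  have carrier: "scale a b x \<in> carrier_vec (n + k)" by (simp add: scale_def)
  have "crit (scale a b x) \<longleftrightarrow> crit x"
  proof (rule crit_scale[OF ab])
    fix i j g assume g: "g \<in> G" "i < n + k" "j < n + k" "(i < n) \<noteq> (j < n)"
    then have "c i j g = D g $$ (i, j)" using entry_c by simp
    then show "c i j g = 0" using D_entry[OF g(1-3)] g(4) by simp
  qed
  moreover have "vec_first (scale a b x) n \<noteq> 0\<^sub>v n \<longleftrightarrow> vec_first x n \<noteq> 0\<^sub>v n"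
    unfolding vec_first_eq_zero_iff using ab(1) by (auto simp: scale_def)
  ultimately show ?thesis by (simp add: semistable_iff[OF x] semistable_iff[OF carrier])
qed

lemma semistable_constructible: "constructible_in (zariski (n + k)) (semistable_locus G n \<rho> k \<sigma>)"
proof -
  let ?S = "{x \<in> carrier_vec (n + k). line x \<in> semistable_locus G n \<rho> k \<sigma>}"
  have "constructible_in (zariski (n + k)) {line x | x. x \<in> ?S \<and> x \<noteq> 0\<^sub>v (n + k)}"
    by (rule cone_constructible[OF semistable_aff_con]) (auto simp: line_smult)
  also have "{line x | x. x \<in> ?S \<and> x \<noteq> 0\<^sub>v (n + k)} = semistable_locus G n \<rho> k \<sigma>"
  proof (intro subset_antisym subsetI)
    fix p assume p: "p \<in> semistable_locus G n \<rho> k \<sigma>"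
    then obtain v w where vw: "p = line (v @\<^sub>v w)" "v \<in> carrier_vec n" "w \<in> carrier_vec k"
      unfolding semistable_locus_def by blast
    then have x: "v @\<^sub>v w \<in> carrier_vec (n + k)" by simp
    have "v @\<^sub>v w \<noteq> 0\<^sub>v (n + k)"
      using p semistable_iff[OF x] unfolding vw(1) vec_first_eq_zero_iff by auto
    then show "p \<in> {line x | x. x \<in> ?S \<and> x \<noteq> 0\<^sub>v (n + k)}" using x p vw(1) by blast
  qed auto
  finally show ?thesis .
qed

end

section \<open>The stable locus\<close>

lemma tensor_index:
  assumes "i < a * (b::nat)"
  shows "i div b < a" "i mod b < b"
proof -
  have "b > 0" using assms by (cases b) auto
  then show "i div b < a" "i mod b < b" using assms by (auto simp: less_mult_imp_div_less)
qed

lemma regular_matrix_tensor: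
  assumes A: "regular_matrix X G a A" and B: "regular_matrix X G b B"
  shows "regular_matrix X G (a * b) (\<lambda>g. tensor_mat (A g) (B g))"
  unfolding regular_matrix_def
proof (intro conjI ballI allI impI)
  fix g assume g: "g \<in> G"
  then have "A g \<in> carrier_mat a a" "B g \<in> carrier_mat b b" using A B by (auto simp: regular_matrix_def)
  then show "tensor_mat (A g) (B g) \<in> carrier_mat (a * b) (a * b)" by (auto simp: tensor_mat_def)
next
  fix i j assume ij: "i < a * b" "j < a * b"
  obtain f where f: "f \<in> function_algebra X" "\<forall>g\<in>G. A g $$ (i div b, j div b) = f g"
    using A tensor_index(1)[OF ij(1)] tensor_index(1)[OF ij(2)] unfolding regular_matrix_def by blast
  obtain h where h: "h \<in> function_algebra X" "\<forall>g\<in>G. B g $$ (i mod b, j mod b) = h g"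
    using B tensor_index(2)[OF ij(1)] tensor_index(2)[OF ij(2)] unfolding regular_matrix_def by blast
  have "tensor_mat (A g) (B g) $$ (i, j) = f g * h g" if g: "g \<in> G" for g
  proof -
    have "A g \<in> carrier_mat a a" "B g \<in> carrier_mat b b" using A B g by (auto simp: regular_matrix_def)
    then show ?thesis using f(2) h(2) g ij by (auto simp: tensor_mat_def)
  qed
  then show "\<exists>f\<in>function_algebra X. \<forall>g\<in>G. tensor_mat (A g) (B g) $$ (i, j) = f g"
    using f(1) h(1) by (intro bexI[of _ "\<lambda>g. f g * h g"]) (auto intro: function_algebra.mult)
qed

lemma regular_matrix_const: "M \<in> carrier_mat a a \<Longrightarrow> regular_matrix X G a (\<lambda>_. M)"
  by (auto simp: regular_matrix_def intro: bexI[OF _ function_algebra.const])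

lemma regular_matrix_power:
  "regular_matrix X G a A \<Longrightarrow> regular_matrix X G (a ^ l) (\<lambda>g. mat_tensor_power (A g) l)"
proof (induction l)
  case 0
  then show ?case by (simp add: regular_matrix_const)
next
  case (Suc l)
  from regular_matrix_tensor[OF Suc.prems Suc.IH[OF Suc.prems]] show ?case by simp
qed

lemma tensor_mat_one: "tensor_mat (1\<^sub>m a) (1\<^sub>m b) = 1\<^sub>m (a * b)"
proof (rule eq_matI)
  fix i j assume "i < dim_row (1\<^sub>m (a * b))" "j < dim_col (1\<^sub>m (a * b))"
  then have ij: "i < a * b" "j < a * b" by auto
  have "i = j \<longleftrightarrow> i div b = j div b \<and> i mod b = j mod b" by (metis div_mult_mod_eq)
  then show "tensor_mat (1\<^sub>m a) (1\<^sub>m b) $$ (i, j) = 1\<^sub>m (a * b) $$ (i, j)"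
    using ij tensor_index[OF ij(1)] tensor_index[OF ij(2)] by (auto simp: tensor_mat_def)
qed (auto simp: tensor_mat_def)

lemma mat_tensor_power_one: "mat_tensor_power (1\<^sub>m a) l = 1\<^sub>m (a ^ l)"
  by (induction l) (simp_all add: tensor_mat_one)

definition polynomial_map :: "nat \<Rightarrow> nat \<Rightarrow> (complex vec \<Rightarrow> complex vec) \<Rightarrow> bool" where
  "polynomial_map N M u \<longleftrightarrow> (\<forall>x\<in>carrier_vec N. u x \<in> carrier_vec M) \<and>
    (\<forall>i<M. \<exists>f\<in>function_algebra (coords N). \<forall>x\<in>carrier_vec N. u x $ i = f x)"

lemma polynomial_map_const: "v \<in> carrier_vec M \<Longrightarrow> polynomial_map N M (\<lambda>_. v)"
  by (auto simp: polynomial_map_def intro: bexI[OF _ function_algebra.const])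

lemma polynomial_map_tensor:
  assumes A: "polynomial_map N a A" and B: "polynomial_map N b B"
  shows "polynomial_map N (a * b) (\<lambda>x. tensor_vec (A x) (B x))"
  unfolding polynomial_map_def
proof (intro conjI ballI allI impI)
  fix x :: "complex vec" assume x: "x \<in> carrier_vec N"
  then have "A x \<in> carrier_vec a" "B x \<in> carrier_vec b" using A B by (auto simp: polynomial_map_def)
  then show "tensor_vec (A x) (B x) \<in> carrier_vec (a * b)" by (auto simp: tensor_vec_def)
next
  fix i assume i: "i < a * b"
  obtain f where f: "f \<in> function_algebra (coords N)" "\<forall>x\<in>carrier_vec N. A x $ (i div b) = f x"
    using A tensor_index(1)[OF i] unfolding polynomial_map_def by blast
  obtain h where h: "h \<in> function_algebra (coords N)" "\<forall>x\<in>carrier_vec N. B x $ (i mod b) = h x"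
    using B tensor_index(2)[OF i] unfolding polynomial_map_def by blast
  have "tensor_vec (A x) (B x) $ i = f x * h x" if x: "x \<in> carrier_vec N" for x
  proof -
    have "A x \<in> carrier_vec a" "B x \<in> carrier_vec b" using A B x by (auto simp: polynomial_map_def)
    then show ?thesis using f(2) h(2) x i by (auto simp: tensor_vec_def)
  qed
  then show "\<exists>f\<in>function_algebra (coords N). \<forall>x\<in>carrier_vec N. tensor_vec (A x) (B x) $ i = f x"
    using f(1) h(1) by (intro bexI[of _ "\<lambda>x. f x * h x"]) (auto intro: function_algebra.mult)
qed

lemma polynomial_map_power:
  "polynomial_map N a A \<Longrightarrow> polynomial_map N (a ^ l) (\<lambda>x. vec_tensor_power (A x) l)"
proof (induction l)
  case 0
  then show ?case by (simp add: polynomial_map_const)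
next
  case (Suc l)
  from polynomial_map_tensor[OF Suc.prems Suc.IH[OF Suc.prems]] show ?case by simp
qed

lemma polynomial_map_append:
  assumes A: "polynomial_map N a A" and B: "polynomial_map N b B"
  shows "polynomial_map N (a + b) (\<lambda>x. A x @\<^sub>v B x)"
  unfolding polynomial_map_def
proof (intro conjI ballI allI impI)
  fix x :: "complex vec" assume x: "x \<in> carrier_vec N"
  then show "A x @\<^sub>v B x \<in> carrier_vec (a + b)" using A B by (auto simp: polynomial_map_def)
next
  fix i assume i: "i < a + b"
  have dims: "dim_vec (A x) = a" "dim_vec (B x) = b" if "x \<in> carrier_vec N" for x
    using A B that by (auto simp: polynomial_map_def)
  show "\<exists>f\<in>function_algebra (coords N). \<forall>x\<in>carrier_vec N. (A x @\<^sub>v B x) $ i = f x"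
  proof (cases "i < a")
    case True
    then obtain f where "f \<in> function_algebra (coords N)" "\<forall>x\<in>carrier_vec N. A x $ i = f x"
      using A unfolding polynomial_map_def by blast
    moreover have "(A x @\<^sub>v B x) $ i = A x $ i" if "x \<in> carrier_vec N" for x
      using dims[OF that] True by simp
    ultimately show ?thesis by (intro bexI[of _ f]) auto
  next
    case False
    then have "i - a < b" using i by simp
    then obtain f where "f \<in> function_algebra (coords N)" "\<forall>x\<in>carrier_vec N. B x $ (i - a) = f x"
      using B unfolding polynomial_map_def by blast
    moreover have "(A x @\<^sub>v B x) $ i = B x $ (i - a)" if "x \<in> carrier_vec N" for x
      using dims[OF that] False i by simp
    ultimately show ?thesis by (intro bexI[of _ f]) auto
  qed
qed

lemma polynomial_map_coords:
  assumes "\<And>x. x \<in> carrier_vec N \<Longrightarrow> u x \<in> carrier_vec M"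
    and "\<And>x i. x \<in> carrier_vec N \<Longrightarrow> i < M \<Longrightarrow> u x $ i = x $ (t i)" "\<And>i. i < M \<Longrightarrow> t i < N"
  shows "polynomial_map N M u"
  unfolding polynomial_map_def
proof (intro conjI ballI allI impI)
  fix i assume i: "i < M"
  have "\<forall>x\<in>carrier_vec N. u x $ i = x $ t i" using assms(2) i by simp
  then show "\<exists>f\<in>function_algebra (coords N). \<forall>x\<in>carrier_vec N. u x $ i = f x"
    by (rule bexI[OF _ coordinate_regular[OF assms(3)[OF i]]])
qed (rule assms(1))

lemma tensor_vec_smult: "tensor_vec (a \<cdot>\<^sub>v v) (b \<cdot>\<^sub>v w) = (a * b) \<cdot>\<^sub>v tensor_vec v w"
  by (rule eq_vecI) (auto simp: tensor_vec_def tensor_index)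

lemma vec_tensor_power_smult: "vec_tensor_power (a \<cdot>\<^sub>v v) l = a ^ l \<cdot>\<^sub>v vec_tensor_power v l"
proof (induction l)
  case 0
  show ?case by (intro eq_vecI) auto
next
  case (Suc l)
  then show ?case by (simp add: tensor_vec_smult)
qed

lemma vec_first_smult: "x \<in> carrier_vec (n + k) \<Longrightarrow> vec_first (a \<cdot>\<^sub>v x) n = a \<cdot>\<^sub>v vec_first x n"
  by (rule eq_vecI) (auto simp: vec_first_def)

lemma vec_last_smult: "x \<in> carrier_vec (n + k) \<Longrightarrow> vec_last (a \<cdot>\<^sub>v x) k = a \<cdot>\<^sub>v vec_last x k"
  by (rule eq_vecI) (auto simp: vec_last_def)

text \<open>For fixed \<open>l\<close> the condition is pulled back from a semistable locus along
  the map that sends (v, w) to the associated tensors. This map is polynomial, but its components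
  have the different degrees \<open>l\<close> and \<open>l + 1\<close>, so it does not act on lines;
  the preimage is therefore taken between affine spaces.\<close>

lemma stable_slice_constructible:
  assumes X: "finite X" and G: "G \<subseteq> carrier_mat m m" "1\<^sub>m m \<in> G" "matrix_entries m \<subseteq> function_algebra X"
    and \<rho>: "regular_matrix X G n \<rho>" "\<rho> (1\<^sub>m m) = 1\<^sub>m n" and \<sigma>: "regular_matrix X G k \<sigma>" "\<sigma> (1\<^sub>m m) = 1\<^sub>m k"
  shows "constructible_in (zariski (n + k)) {line (v @\<^sub>v w) | v w. v \<in> carrier_vec n \<and> w \<in> carrier_vec k \<and> v \<noteq> 0\<^sub>v n \<and>
    line (tensor_vec (vec_tensor_power (vec_of_matrix m (1\<^sub>m m)) d) (vec_tensor_power v l)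
              @\<^sub>v vec_tensor_power w (l + 1))
        \<in> semistable_locus G
            ((m * m) ^ d * n ^ l)
            (\<lambda>g. tensor_mat (mat_tensor_power (left_mult_rep m g) d) (mat_tensor_power (\<rho> g) l))
            (k ^ (l + 1))
            (\<lambda>g. mat_tensor_power (\<sigma> g) (l + 1))}"
proof -
  let ?n = "(m * m) ^ d * n ^ l" and ?k = "k ^ (l + 1)"
  let ?\<rho> = "\<lambda>g. tensor_mat (mat_tensor_power (left_mult_rep m g) d) (mat_tensor_power (\<rho> g) l)"
  let ?\<sigma> = "\<lambda>g. mat_tensor_power (\<sigma> g) (l + 1)"
  let ?SS = "semistable_locus G ?n ?\<rho> ?k ?\<sigma>"
  let ?e = "vec_tensor_power (vec_of_matrix m (1\<^sub>m m)) d"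
  define A where "A = (\<lambda>x. tensor_vec ?e (vec_tensor_power (vec_first x n) l))"
  define B where "B = (\<lambda>x. vec_tensor_power (vec_last x k) (l + 1))"
  \<comment> \<open>Left multiplication is the tensor product of the tautological representation
    with a constant matrix.\<close>
  have id: "regular_matrix X G m (\<lambda>g. g)"
    using G by (auto simp: regular_matrix_def matrix_entries_def subset_iff)
      (metis (mono_tags, lifting))
  have "regular_matrix X G ?n ?\<rho>"
    unfolding left_mult_rep_def
    by (intro regular_matrix_tensor regular_matrix_power id regular_matrix_const \<rho>(1)) simp
  moreover have "regular_matrix X G ?k ?\<sigma>" by (intro regular_matrix_power \<sigma>(1))
  moreover have "?\<rho> (1\<^sub>m m) = 1\<^sub>m ?n" "?\<sigma> (1\<^sub>m m) = 1\<^sub>m ?k"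
    by (simp_all only: left_mult_rep_def \<rho>(2) \<sigma>(2) tensor_mat_one mat_tensor_power_one)
  ultimately interpret big: matrix_pair X G ?n ?k ?\<rho> ?\<sigma>
    using X G(2) by unfold_locales blast+
  have first: "polynomial_map (n + k) n (\<lambda>x. vec_first x n)"
    by (rule polynomial_map_coords[of _ _ _ "\<lambda>i. i"]) (auto simp: vec_first_def)
  have last: "polynomial_map (n + k) k (\<lambda>x. vec_last x k)"
    by (rule polynomial_map_coords[of _ _ _ "\<lambda>i. n + i"]) (auto simp: vec_last_def)
  have e: "polynomial_map (n + k) ((m * m) ^ d) (\<lambda>_. ?e)"
    by (intro polynomial_map_power polynomial_map_const) (simp add: vec_of_matrix_def)
  have A: "polynomial_map (n + k) ?n A"
    unfolding A_def by (intro polynomial_map_tensor e polynomial_map_power[OF first])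
  have B: "polynomial_map (n + k) ?k B"
    unfolding B_def by (intro polynomial_map_power last)
  have AB: "polynomial_map (n + k) (?n + ?k) (\<lambda>x. A x @\<^sub>v B x)"
    by (rule polynomial_map_append[OF A B])
  have pre: "{x \<in> carrier_vec (n + k). A x @\<^sub>v B x \<in> {y \<in> carrier_vec (?n + ?k). line y \<in> ?SS}} \<in> aff_con (n + k)"
    using AB unfolding polynomial_map_def by (intro aff_con_preimage[OF big.semistable_aff_con]) auto
  define S where "S = (carrier_vec (n + k) - {x \<in> carrier_vec (n + k). \<forall>i\<in>{..<n}. x \<in> {x \<in> carrier_vec (n + k). x $ i = 0}}) \<inter>
    {x \<in> carrier_vec (n + k). A x @\<^sub>v B x \<in> {y \<in> carrier_vec (?n + ?k). line y \<in> ?SS}}"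
  have S_con: "S \<in> aff_con (n + k)"
    unfolding S_def
    by (intro aff_con.inter aff_con.compl aff_con_INT aff_con.zeros pre)
      (auto intro: coordinate_regular)
  have S: "x \<in> S \<longleftrightarrow> x \<in> carrier_vec (n + k) \<and> vec_first x n \<noteq> 0\<^sub>v n \<and> line (A x @\<^sub>v B x) \<in> ?SS" for x
    unfolding S_def vec_first_eq_zero_iff using AB by (auto simp: polynomial_map_def)
  \<comment> \<open>The two tensor components are multiplied by \<open>a ^ l\<close> and
    \<open>a ^ (l + 1)\<close>. In general this changes the line, but not its semistability.\<close>
  have "a \<cdot>\<^sub>v x \<in> S" if x: "x \<in> S" and a: "a \<noteq> 0" for x a
  proof -
    have xc: "x \<in> carrier_vec (n + k)" using x S by blast
    have dims: "A x \<in> carrier_vec ?n" "B x \<in> carrier_vec ?k"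
      using A B xc by (auto simp: polynomial_map_def)
    have "A (a \<cdot>\<^sub>v x) = a ^ l \<cdot>\<^sub>v A x"
      unfolding A_def vec_first_smult[OF xc] vec_tensor_power_smult
      using tensor_vec_smult[of 1 ?e "a ^ l"] by simp
    moreover have "B (a \<cdot>\<^sub>v x) = a ^ (l + 1) \<cdot>\<^sub>v B x"
      unfolding B_def vec_last_smult[OF xc] vec_tensor_power_smult ..
    moreover have "big.scale (a ^ l) (a ^ (l + 1)) (A x @\<^sub>v B x) = a ^ l \<cdot>\<^sub>v A x @\<^sub>v a ^ (l + 1) \<cdot>\<^sub>v B x"
      by (rule big.scale_append[OF dims])
    ultimately have "line (A (a \<cdot>\<^sub>v x) @\<^sub>v B (a \<cdot>\<^sub>v x)) \<in> ?SS \<longleftrightarrow> line (A x @\<^sub>v B x) \<in> ?SS"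
      using big.semistable_scale[of "A x @\<^sub>v B x" "a ^ l" "a ^ (l + 1)"] dims a by simp
    moreover have "vec_first (a \<cdot>\<^sub>v x) n \<noteq> 0\<^sub>v n \<longleftrightarrow> vec_first x n \<noteq> 0\<^sub>v n"
      unfolding vec_first_eq_zero_iff using xc a by auto
    ultimately show ?thesis using x xc S by simp
  qed
  then have "constructible_in (zariski (n + k)) {line x | x. x \<in> S \<and> x \<noteq> 0\<^sub>v (n + k)}"
    by (rule cone_constructible[OF S_con])
  also have "{line x | x. x \<in> S \<and> x \<noteq> 0\<^sub>v (n + k)} = {line (v @\<^sub>v w) | v w. v \<in> carrier_vec n \<and> w \<in> carrier_vec k \<and> v \<noteq> 0\<^sub>v n \<and>
    line (tensor_vec ?e (vec_tensor_power v l) @\<^sub>v vec_tensor_power w (l + 1)) \<in> ?SS}" (is "_ = ?R")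
  proof (intro subset_antisym subsetI)
    fix p assume "p \<in> {line x | x. x \<in> S \<and> x \<noteq> 0\<^sub>v (n + k)}"
    then obtain x where x: "p = line x" "x \<in> S" by blast
    then have "vec_first x n @\<^sub>v vec_last x k = x" using S by (intro vec_first_last_append) blast
    then have "p = line (vec_first x n @\<^sub>v vec_last x k)" using x(1) by simp
    moreover have "vec_first x n \<in> carrier_vec n" "vec_last x k \<in> carrier_vec k" by auto
    ultimately show "p \<in> ?R" using x(2) S unfolding A_def B_def by blast
  next
    fix p assume "p \<in> ?R"
    then obtain v w where vw: "p = line (v @\<^sub>v w)" "v \<in> carrier_vec n" "w \<in> carrier_vec k" "v \<noteq> 0\<^sub>v n"
      "line (tensor_vec ?e (vec_tensor_power v l) @\<^sub>v vec_tensor_power w (l + 1)) \<in> ?SS" by blast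
    have fl: "vec_first (v @\<^sub>v w) n = v" "vec_last (v @\<^sub>v w) k = w"
      using vw(2,3) by (auto simp: vec_first_def vec_last_def intro!: eq_vecI)
    have "v @\<^sub>v w \<in> S" unfolding S A_def B_def fl using vw by simp
    moreover have "v @\<^sub>v w \<noteq> 0\<^sub>v (n + k)"
    proof
      assume "v @\<^sub>v w = 0\<^sub>v (n + k)"
      then have "\<forall>i\<in>{..<n}. (v @\<^sub>v w) $ i = 0" by simp
      then show False using vec_first_eq_zero_iff[of "v @\<^sub>v w" n] vw(4) unfolding fl by blast
    qed
    ultimately show "p \<in> {line x | x. x \<in> S \<and> x \<noteq> 0\<^sub>v (n + k)}" using vw(1) by blast
  qed
  finally show ?thesis .
qed

section \<open>Representations as regular families of matrices\<close>

lemma GL_carrier: "carrier (GL n) \<subseteq> carrier_mat n n"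
  by (auto simp: GL_def units_of_def Units_def ring_mat_def)

lemma GL_one: "\<one>\<^bsub>GL n\<^esub> = 1\<^sub>m n"
  by (simp add: GL_def units_of_def ring_mat_def)

lemma GL_group: "group (GL n)"
proof -
  interpret ring "ring_mat TYPE(complex) n ()" by (rule ring_mat)
  show ?thesis unfolding GL_def by (rule units_group)
qed

lemma representation_one:
  assumes G: "linear_algebraic_group m G" and \<rho>: "representation m G n \<rho>"
  shows "\<rho> (1\<^sub>m m) = 1\<^sub>m n"
proof -
  have sub: "subgroup G (GL m)" using G by (simp add: linear_algebraic_group_def)
  interpret group_hom "GL m\<lparr>carrier := G\<rparr>" "GL n" \<rho>
    using \<rho> GL_group group.subgroup_imp_group[OF GL_group sub]
    by (simp add: group_hom_def group_hom_axioms_def algebraic_hom_def)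
  show ?thesis using hom_one by (simp add: GL_one)
qed

text \<open>With the inverse determinant as one more generator, regular functions on GL(m) are
  polynomials in finitely many functions. Its relation with the entries holds at all points of the
  graphs and so belongs to every \<open>orbit_ideal\<close>.\<close>

lemma representation_regular:
  assumes \<rho>: "representation m G n \<rho>"
  shows "regular_matrix (insert (\<lambda>g. inverse (det g)) (matrix_entries m)) G n \<rho>"
  unfolding regular_matrix_def
proof (intro conjI)
  show "\<forall>g\<in>G. \<rho> g \<in> carrier_mat n n"
    using \<rho> GL_carrier[of n] by (auto simp: algebraic_hom_def hom_def)
qed (use \<rho> in \<open>auto simp: algebraic_hom_def regular_functions_def\<close>)

lemma finite_matrix_entries: "finite (matrix_entries m)"
proof -
  have "matrix_entries m = (\<lambda>(i, j) g. g $$ (i, j)) ` ({..<m} \<times> {..<m})"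
    by (auto simp: matrix_entries_def)
  then show ?thesis by simp
qed

theorem theorem1p3:
  fixes m n k :: nat
    and G :: "complex mat set"
    and \<rho> \<sigma> :: "complex mat \<Rightarrow> complex mat"
  assumes "linear_algebraic_group m G"
    and "representation m G n \<rho>"
    and "representation m G k \<sigma>"
  shows "(\<forall>T r \<phi>. maximal_torus m G T \<and> algebraic_iso r (standard_torus r) m T \<phi> \<and>
              (\<exists>d. degree_bound m r \<phi> n \<rho> d) \<longrightarrow>
            (\<exists>\<F>. countable \<F> \<and> (\<forall>S\<in>\<F>. constructible_in (zariski (n + k)) S) \<and>
                 stable_locus m G r \<phi> n \<rho> k \<sigma> = \<Union>\<F>)) \<and>
         constructible_in (zariski (n + k)) (semistable_locus G n \<rho> k \<sigma>)"
proof -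
  let ?X = "insert (\<lambda>g. inverse (det g)) (matrix_entries m)"
  have sub: "subgroup G (GL m)" using assms(1) by (simp add: linear_algebraic_group_def)
  have X: "finite ?X" "matrix_entries m \<subseteq> function_algebra ?X"
    using finite_matrix_entries by (auto intro: function_algebra.gen)
  have G: "G \<subseteq> carrier_mat m m" "1\<^sub>m m \<in> G"
    using subgroup.subset[OF sub] GL_carrier subgroup.one_closed[OF sub] by (auto simp: GL_one)
  note rho = representation_regular[OF assms(2)] representation_one[OF assms(1,2)]
  note sigma = representation_regular[OF assms(3)] representation_one[OF assms(1,3)]
  interpret matrix_pair ?X G n k \<rho> \<sigma>
    using X(1) rho sigma G(2) by unfold_locales auto
  have "\<exists>\<F>. countable \<F> \<and> (\<forall>S\<in>\<F>. constructible_in (zariski (n + k)) S) \<and>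
    stable_locus m G r \<phi> n \<rho> k \<sigma> = \<Union>\<F>" for r \<phi>
  proof -
    define d where "d = rep_degree m r \<phi> n \<rho>"
    define slice where "slice l = {line (v @\<^sub>v w) | v w. v \<in> carrier_vec n \<and> w \<in> carrier_vec k \<and> v \<noteq> 0\<^sub>v n \<and>
      line (tensor_vec (vec_tensor_power (vec_of_matrix m (1\<^sub>m m)) d) (vec_tensor_power v l)
              @\<^sub>v vec_tensor_power w (l + 1))
        \<in> semistable_locus G
            ((m * m) ^ d * n ^ l)
            (\<lambda>g. tensor_mat (mat_tensor_power (left_mult_rep m g) d) (mat_tensor_power (\<rho> g) l))
            (k ^ (l + 1))
            (\<lambda>g. mat_tensor_power (\<sigma> g) (l + 1))}" for l
    have "constructible_in (zariski (n + k)) (slice l)" for l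
      unfolding slice_def by (rule stable_slice_constructible[OF X(1) G X(2) rho sigma])
    \<comment> \<open>The slices are indexed by the positive exponents \<open>l\<close> in the
      definition of stability, hence countable in number.\<close>
    moreover have "stable_locus m G r \<phi> n \<rho> k \<sigma> = \<Union>(slice ` {0<..})"
      unfolding stable_locus_def Let_def d_def[symmetric] slice_def by blast
    ultimately show ?thesis by (intro exI[of _ "slice ` {0<..}"]) auto
  qed
  then show ?thesis using semistable_constructible by blast
qed

end
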